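(* Let $M$ be a moon polyomino and $k\ge 0$ an integer. There is a permutation $w(M,k)$, depending only on $M$ and $k$, such that the following hold. (1) For every vector $\mathbf r$ of integers, the map sending a filling $F$ to the pipe dream $D(F)$ (zeros of $F$ become crosses; cells of $M$ containing a one, as well as all cells of $\mathbb N^2$ not in $M$, become elbow joints) is a bijection from $\mathcal F_{01}^{ne}(M,k,\mathbf r)$ onto the set of those reduced pipe dreams in $\mathcal{RC}(w(M,k),\mathbf r)$ all of whose crosses lie inside $M$. (2) More precisely, under this identification the set $\mathcal F_{01}^{ne}(M,k)$ is an interval in the poset $\mathcal{RC}(w(M,k))$ of reduced pipe dreams ordered by chute moves, with maximal element $D_{top}(M,k)$ and minimal element $D_{bot}(M,k)$.
   Context: **Polyominoes.** $\mathbb N=\{1,2,\dots\}$. A polyomino is a finite subset of $\mathbb N^2$, whose elements are called cells. Matrix conventions are used: cell $(i,j)$ is in row $i$ (counted from top to bottom) and column $j$ (counted from left to right). A polyomino is convex if for any two of its cells in the same row or the same column, all elements of $\mathbb N^2$ in between are also cells of it. It is intersection-free if for any two columns the set of row coordinates of cells of one is contained in that of the other (equivalently, the same for rows). A moon polyomino is a convex, intersection-free polyomino; its top row and left-most column are assumed to have index $1$. **Fillings.** A $0$-$1$-filling of $M$ assigns $0$ or $1$ to each cell; cells with $0$ are called empty. A north-east chain is a sequence of cells containing $1$ such that the smallest rectangle containing all of them is contained in $M$, and for any two of them one is strictly to the right of and strictly above the other. $\mathcal F_{01}^{ne}(M,k)$ is the set of $0$-$1$-fillings of $M$ having no north-east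 chain of length greater than $k$ that are maximal, i.e. changing any single $0$ to $1$ creates a north-east chain of length $k+1$. $\mathcal F_{01}^{ne}(M,k,\mathbf r)$ is the subset of fillings having exactly $\mathbf r_i$ zeros in row $i$ for all $i$. **Special fillings.** $D_{top}(M,k)$ is the filling of $M$ whose ones are exactly the cells covered by some rectangle with at most $k$ rows and at most $k$ columns that is contained in $M$ and touches the boundary of $M$ with its lower-left corner. (Viewing cells as unit squares, this means that the lower-left corner point of the rectangle lies on the boundary of the region $M$; i.e. if $(i,j)$ is the lower-left cell of the rectangle, at least one of $(i,j-1),(i+1,j-1),(i+1,j)$ is not in $M$.) $D_{bot}(M,k)$ is defined in the same way with "upper-right corner" in place of "lower-left corner" (if $(i,j)$ is the upper-right cell, at least one of $(i-1,j),(i-1,j+1),(i,j+1)$ is not in $M$). **Pipe dreams.** A pipe dream is a filling of all cells of $\mathbb N^2$ with elbow joints and finitely many crosses. In a cross, one pipe runs straight vertically and one straight horizontally; in an elbow joint, one pipe connects the top edge with the left edge and another connects the right edge with the bottom edge of the cell. It is a pipe dream for the permutation $w$ if the pipe entering from above in column $i$ exits to the left from row $w^{-1}(i)$, for all $i$. It is reduced if each pair of pipes crosses at most once. $\mathcal{RC}(w)$ is the set of reduced pipe dreams for $w$, and $\mathcal{RC}(w,\mathbf r)$ is the subset of those having exactly $\mathbf r_i$ crosses in row $i$ for all $i$. **Chute moves.** A chutable rectangle of a pipe dream is a rectangular region with at least two rows and two columns in which all cells are crosses except exactly the north-west, south-west and south-east corners, which are elbow joints. The chute move replaces the elbow joint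 in the south-west corner by a cross and the cross in the north-east corner by an elbow joint. The partial order on $\mathcal{RC}(w)$ is: $D\le E$ if $D$ can be obtained from $E$ by a (possibly empty) sequence of chute moves. An interval with minimal element $A$ and maximal element $B$ is the set $\{D: A\le D\le B\}$. *)

theory Defs
  imports Main "HOL.Hull" "HOL-Combinatorics.Permutations" "HOL-Library.FuncSet"
begin

text \<open>
  Cells are pairs (row, column) with 1-based coordinates; rows are counted from top to bottom.
\<close>

type_synonym cell = "nat \<times> nat"

definition grid :: "cell set" where
  "grid = {1..} \<times> {1..}"


section \<open>Moon polyominoes\<close>

definition polyomino :: "cell set \<Rightarrow> bool" where
  "polyomino M \<longleftrightarrow> finite M \<and> M \<subseteq> grid"

definition convex_polyomino :: "cell set \<Rightarrow> bool" where
  "convex_polyomino M \<longleftrightarrow>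
     (\<forall>i j j' l. (i, j) \<in> M \<longrightarrow> (i, j') \<in> M \<longrightarrow> j \<le> l \<longrightarrow> l \<le> j' \<longrightarrow> (i, l) \<in> M) \<and>
     (\<forall>i i' j l. (i, j) \<in> M \<longrightarrow> (i', j) \<in> M \<longrightarrow> i \<le> l \<longrightarrow> l \<le> i' \<longrightarrow> (l, j) \<in> M)"

definition intersection_free :: "cell set \<Rightarrow> bool" where
  "intersection_free M \<longleftrightarrow>
     (\<forall>j j'. {i. (i, j) \<in> M} \<subseteq> {i. (i, j') \<in> M} \<or> {i. (i, j') \<in> M} \<subseteq> {i. (i, j) \<in> M})"

text \<open>
  The last conjunct is the normalization that the top row and the left-most column have index 1;
  it is void for the empty polyomino.
\<close>

definition moon_polyomino :: "cell set \<Rightarrow> bool" where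
  "moon_polyomino M \<longleftrightarrow>
     polyomino M \<and> convex_polyomino M \<and> intersection_free M \<and>
     (M \<noteq> {} \<longrightarrow> (\<exists>j. (1, j) \<in> M) \<and> (\<exists>i. (i, 1) \<in> M))"


section \<open>Fillings\<close>

definition fillings :: "cell set \<Rightarrow> (cell \<Rightarrow> nat) set" where
  "fillings M = M \<rightarrow>\<^sub>E {0, 1}"

definition rectangle :: "cell set \<Rightarrow> bool" where
  "rectangle R \<longleftrightarrow> (\<exists>a b c d. R = {a..b} \<times> {c..d})"

definition north_east_of :: "cell \<Rightarrow> cell \<Rightarrow> bool" where
  "north_east_of x y \<longleftrightarrow> fst x < fst y \<and> snd y < snd x"

text \<open>
  \<open>rectangle hull (set cs)\<close> is the intersection of all rectangles containing the cells of the
  chain, i.e. the smallest such rectangle.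
\<close>

definition ne_chain :: "cell set \<Rightarrow> (cell \<Rightarrow> nat) \<Rightarrow> cell list \<Rightarrow> bool" where
  "ne_chain M F cs \<longleftrightarrow>
     set cs \<subseteq> {x \<in> M. F x = 1} \<and>
     rectangle hull (set cs) \<subseteq> M \<and>
     sorted_wrt (\<lambda>x y. north_east_of x y \<or> north_east_of y x) cs"

definition F01ne :: "cell set \<Rightarrow> nat \<Rightarrow> (cell \<Rightarrow> nat) set" where
  "F01ne M k = {F \<in> fillings M.
     (\<forall>cs. ne_chain M F cs \<longrightarrow> length cs \<le> k) \<and>
     (\<forall>x\<in>M. F x = 0 \<longrightarrow> (\<exists>cs. ne_chain M (F(x := 1)) cs \<and> length cs = k + 1))}"

definition F01ne_rows :: "cell set \<Rightarrow> nat \<Rightarrow> (nat \<Rightarrow> int) \<Rightarrow> (cell \<Rightarrow> nat) set" where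
  "F01ne_rows M k r =
     {F \<in> F01ne M k. \<forall>i\<ge>1. int (card {j. (i, j) \<in> M \<and> F (i, j) = 0}) = r i}"

text \<open>
  A corner point of a cell of \<open>M\<close> lies on the boundary of the region \<open>M\<close> iff one of the other three
  cells around that point is not in \<open>M\<close>.  The truncated subtraction is harmless, because cells of
  \<open>M\<close> have positive coordinates and no pair with a zero coordinate belongs to \<open>M\<close>.
\<close>

definition lower_left_on_boundary :: "cell set \<Rightarrow> nat \<Rightarrow> nat \<Rightarrow> bool" where
  "lower_left_on_boundary M i j \<longleftrightarrow>
     (i, j - 1) \<notin> M \<or> (i + 1, j - 1) \<notin> M \<or> (i + 1, j) \<notin> M"

definition upper_right_on_boundary :: "cell set \<Rightarrow> nat \<Rightarrow> nat \<Rightarrow> bool" where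
  "upper_right_on_boundary M i j \<longleftrightarrow>
     (i - 1, j) \<notin> M \<or> (i - 1, j + 1) \<notin> M \<or> (i, j + 1) \<notin> M"

definition D_top :: "cell set \<Rightarrow> nat \<Rightarrow> cell \<Rightarrow> nat" where
  "D_top M k = (\<lambda>x\<in>M. if \<exists>a b c d. x \<in> {a..b} \<times> {c..d} \<and> {a..b} \<times> {c..d} \<subseteq> M \<and>
       card {a..b} \<le> k \<and> card {c..d} \<le> k \<and> lower_left_on_boundary M b c then 1 else 0)"

definition D_bot :: "cell set \<Rightarrow> nat \<Rightarrow> cell \<Rightarrow> nat" where
  "D_bot M k = (\<lambda>x\<in>M. if \<exists>a b c d. x \<in> {a..b} \<times> {c..d} \<and> {a..b} \<times> {c..d} \<subseteq> M \<and>
       card {a..b} \<le> k \<and> card {c..d} \<le> k \<and> upper_right_on_boundary M a d then 1 else 0)"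


section \<open>Pipe dreams\<close>

text \<open>
  A pipe dream is represented by the set of its crosses; all other cells of the grid are elbow
  joints.
\<close>

type_synonym pipe_dream = "cell set"

definition pipe_dream :: "pipe_dream \<Rightarrow> bool" where
  "pipe_dream D \<longleftrightarrow> finite D \<and> D \<subseteq> grid"

datatype side = From_Top | From_Right

text \<open>
  \<open>enters D p s (i, j)\<close>: the pipe that enters the grid from above in column \<open>p\<close> enters the cell
  \<open>(i, j)\<close> through its top edge, resp. its right edge.  A pipe leaving the grid to the left from
  row \<open>i\<close> is recorded as entering the fictitious cell \<open>(i, 0)\<close> from the right, where it stops.
  Every pipe of a pipe dream enters the grid from above, since there are only finitely many crosses.
\<close>

inductive enters :: "pipe_dream \<Rightarrow> nat \<Rightarrow> side \<Rightarrow> cell \<Rightarrow> bool" for D :: pipe_dream and p :: nat where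
  start: "1 \<le> p \<Longrightarrow> enters D p From_Top (1, p)"
| cross_vertical: "enters D p From_Top (i, j) \<Longrightarrow> (i, j) \<in> D \<Longrightarrow> enters D p From_Top (i + 1, j)"
| cross_horizontal:
    "enters D p From_Right (i, j) \<Longrightarrow> 1 \<le> j \<Longrightarrow> (i, j) \<in> D \<Longrightarrow> enters D p From_Right (i, j - 1)"
| elbow_top_left:
    "enters D p From_Top (i, j) \<Longrightarrow> (i, j) \<notin> D \<Longrightarrow> enters D p From_Right (i, j - 1)"
| elbow_right_bottom:
    "enters D p From_Right (i, j) \<Longrightarrow> 1 \<le> j \<Longrightarrow> (i, j) \<notin> D \<Longrightarrow> enters D p From_Top (i + 1, j)"

definition exits_from_row :: "pipe_dream \<Rightarrow> nat \<Rightarrow> nat \<Rightarrow> bool" where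
  "exits_from_row D p i \<longleftrightarrow> enters D p From_Right (i, 0)"

definition pipe_dream_for :: "(nat \<Rightarrow> nat) \<Rightarrow> pipe_dream \<Rightarrow> bool" where
  "pipe_dream_for w D \<longleftrightarrow> pipe_dream D \<and> (\<forall>i\<ge>1. exits_from_row D i (inv w i))"

definition crossings :: "pipe_dream \<Rightarrow> nat \<Rightarrow> nat \<Rightarrow> cell set" where
  "crossings D p q = {x \<in> D. (enters D p From_Top x \<and> enters D q From_Right x) \<or>
                             (enters D q From_Top x \<and> enters D p From_Right x)}"

definition reduced :: "pipe_dream \<Rightarrow> bool" where
  "reduced D \<longleftrightarrow> (\<forall>p\<ge>1. \<forall>q\<ge>1. p \<noteq> q \<longrightarrow> card (crossings D p q) \<le> 1)"

definition RC :: "(nat \<Rightarrow> nat) \<Rightarrow> pipe_dream set" where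
  "RC w = {D. pipe_dream_for w D \<and> reduced D}"

definition RC_rows :: "(nat \<Rightarrow> nat) \<Rightarrow> (nat \<Rightarrow> int) \<Rightarrow> pipe_dream set" where
  "RC_rows w r = {D \<in> RC w. \<forall>i\<ge>1. int (card {j. (i, j) \<in> D}) = r i}"

definition filling_to_pipe_dream :: "cell set \<Rightarrow> (cell \<Rightarrow> nat) \<Rightarrow> pipe_dream" where
  "filling_to_pipe_dream M F = {x \<in> M. F x = 0}"


section \<open>Chute moves\<close>

text \<open>
  The rectangle has rows \<open>a..b\<close> and columns \<open>c..d\<close>; it lies in the grid because \<open>a\<close> and \<open>c\<close> are
  positive.
\<close>

definition chutable :: "pipe_dream \<Rightarrow> nat \<Rightarrow> nat \<Rightarrow> nat \<Rightarrow> nat \<Rightarrow> bool" where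
  "chutable D a b c d \<longleftrightarrow> 1 \<le> a \<and> a < b \<and> 1 \<le> c \<and> c < d \<and>
     ({a..b} \<times> {c..d}) - D = {(a, c), (b, c), (b, d)}"

definition chute_move :: "pipe_dream \<Rightarrow> pipe_dream \<Rightarrow> bool" where
  "chute_move E D \<longleftrightarrow>
     (\<exists>a b c d. chutable E a b c d \<and> D = insert (b, c) (E - {(a, d)}))"

definition chute_le :: "pipe_dream \<Rightarrow> pipe_dream \<Rightarrow> bool" where
  "chute_le D E \<longleftrightarrow> chute_move\<^sup>*\<^sup>* E D"

definition chute_interval :: "(nat \<Rightarrow> nat) \<Rightarrow> pipe_dream \<Rightarrow> pipe_dream \<Rightarrow> pipe_dream set" where
  "chute_interval w A B = {D \<in> RC w. chute_le A D \<and> chute_le D B}"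

end

theory Submission
  imports Defs
begin

text \<open>
  For a reduced pipe dream the number of pipes that enter a rectangle from above and leave it to the
  left is the length of its longest north-east chain of elbow joints; for arbitrary pipe dreams it
  is at least that length. So the longest chains in the boxes \<open>{1..i} \<times> {1..j}\<close> are the rank
  function of the permutation.

  Any chain in a largest rectangle \<open>{a..b} \<times> {c..d}\<close> of \<open>M\<close> extends by \<open>a - 1\<close> cells to the
  north-east and \<open>c - 1\<close> cells to the south-west, all outside \<open>M\<close>, to a chain in the box
  \<open>{1..b + c - 1} \<times> {1..d + a - 1}\<close>, and this is optimal. Hence the chain condition on fillings is
  a condition on ranks. The crosses of \<open>D_top\<close> form the erosion of \<open>M\<close> by squares, which has the
  longest chains in all boxes among the admissible fillings. Maximal fillings are therefore reduced,
  and if the permutation of one of them were not that of \<open>D_top\<close>, it would be strictly above it in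
  Bruhat order, and some cross could be deleted.

  By maximality every inversion of the permutation is visible in the rank condition of some largest
  rectangle, and the two pipes must then cross in that rectangle. This confines reduced pipe dreams
  to \<open>M\<close> as soon as their crosses avoid the regions north-east and south-west of \<open>M\<close>,
    and chute moves
  between \<open>D_top\<close> and \<open>D_bot\<close> cannot reach these regions. The first difference, in reading
  order, between a maximal filling and \<open>D_top\<close> is an elbow joint at which two pipes touch that cross
  later; it leads to an inverse chute move. The statement for \<open>D_bot\<close> follows by transposition.
\<close>


section \<open>Labelling the edges of a pipe dream\<close>

text \<open>The obstacle is a mismatch of boxes: fillings are constrained in all rectangles inside
  \<open>M\<close>, whereas a permutation only knows the ranks of boxes anchored at
  \<open>(1, 1)\<close>. For the rectangle \<open>{a..b} \<times> {c..d}\<close> the box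
  \<open>{1..b + c - 1} \<times> {1..d + a - 1}\<close> is the one in which the detours of a chain
  past the rectangle have equal room in rows and in columns, \<open>a - 1\<close> on the north-east
  side and \<open>c - 1\<close> on the south-west side. The passage from rectangles to all anchored
  boxes is a min-max duality: either the ones of \<open>D_top\<close> contain a chain of length
  \<open>n\<close> in the box, or one of \<open>n\<close> smaller boxes, shifted step by step to the
  north-east, lies in the erosion. Thickening that one by \<open>k\<close> gives a rectangle of
  \<open>M\<close> that keeps every admissible chain shorter than \<open>n\<close>. The duality is
  applied to the erosion, so erosions have to be moon shapes again. Reducedness is handled through
  labels, as the smaller label entering every cross from above, and after an inverse chute move
  through the equality of the numbers of crosses and of inversions.\<close>

text \<open>
  \<open>t i j\<close> and \<open>r i j\<close> are the columns in which the pipes that enter the cell \<open>(i, j)\<close> through its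
  top and right edge start. As in \<open>enters\<close>, the pipe leaving the grid from row \<open>i\<close> is \<open>r i 0\<close>.
\<close>

definition labeling :: "pipe_dream \<Rightarrow> (nat \<Rightarrow> nat \<Rightarrow> nat) \<Rightarrow> (nat \<Rightarrow> nat \<Rightarrow> nat) \<Rightarrow> bool" where
  "labeling D t r \<longleftrightarrow>
     (\<forall>j\<ge>1. t 1 j = j) \<and>
     (\<exists>m. \<forall>i\<ge>1. \<forall>j\<ge>m. r i j = i + j) \<and>
     (\<forall>i\<ge>1. \<forall>j\<ge>1. r i (j - 1) = (if (i, j) \<in> D then r i j else t i j)) \<and>
     (\<forall>i\<ge>1. \<forall>j\<ge>1. t (i + 1) j = (if (i, j) \<in> D then t i j else r i j))"

lemma labelingD:
  assumes "labeling D t r"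
  shows "j \<ge> 1 \<Longrightarrow> t (Suc 0) j = j"
    and "i \<ge> 1 \<Longrightarrow> r i j = (if (i, Suc j) \<in> D then r i (Suc j) else t i (Suc j))"
    and "i \<ge> 1 \<Longrightarrow> j \<ge> 1 \<Longrightarrow> t (Suc i) j = (if (i, j) \<in> D then t i j else r i j)"
    and "i \<ge> 1 \<Longrightarrow> j \<ge> 1 \<Longrightarrow> (i, j) \<notin> D \<Longrightarrow> r i (j - 1) = t i j"
    and "i \<ge> 1 \<Longrightarrow> j \<ge> 1 \<Longrightarrow> (i, j) \<in> D \<Longrightarrow> r i (j - 1) = r i j"
proof -
  show "j \<ge> 1 \<Longrightarrow> t (Suc 0) j = j" using assms by (auto simp: labeling_def)
  have *: "\<forall>i\<ge>1. \<forall>j\<ge>1. r i (j - 1) = (if (i, j) \<in> D then r i j else t i j)"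
    using assms unfolding labeling_def by blast
  show "i \<ge> 1 \<Longrightarrow> r i j = (if (i, Suc j) \<in> D then r i (Suc j) else t i (Suc j))"
    using *[rule_format, of i "Suc j"] by simp
  show "i \<ge> 1 \<Longrightarrow> j \<ge> 1 \<Longrightarrow> (i, j) \<notin> D \<Longrightarrow> r i (j - 1) = t i j"
    and "i \<ge> 1 \<Longrightarrow> j \<ge> 1 \<Longrightarrow> (i, j) \<in> D \<Longrightarrow> r i (j - 1) = r i j"
    using *[rule_format, of i j] by simp_all
  have *: "\<forall>i\<ge>1. \<forall>j\<ge>1. t (i + 1) j = (if (i, j) \<in> D then t i j else r i j)"
    using assms unfolding labeling_def by blast
  show "i \<ge> 1 \<Longrightarrow> j \<ge> 1 \<Longrightarrow> t (Suc i) j = (if (i, j) \<in> D then t i j else r i j)"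
    using *[rule_format, of i j] by simp
qed

lemma labeling_far:
  assumes "labeling D t r"
  obtains m where "\<And>i j. i \<ge> 1 \<Longrightarrow> j \<ge> m \<Longrightarrow> r i j = i + j"
proof -
  from assms obtain m where "\<forall>i\<ge>1. \<forall>j\<ge>m. r i j = i + j"
    unfolding labeling_def by (elim conjE exE)
  then show thesis using that by blast
qed

text \<open>A row is determined from the far right, where \<open>r i j = i + j\<close>, leftwards,
  and it determines the top labels of the next row. Agreement is only asked for on cells read
  earlier, so that labels can be compared at the first difference of two pipe dreams.\<close>

lemma labeling_agree:
  assumes "labeling D t r" and "labeling D' t' r'"
  shows "\<lbrakk>\<And>i' j'. 1 \<le> i' \<Longrightarrow> i' < i \<Longrightarrow> 1 \<le> j' \<Longrightarrow> (i', j') \<in> D \<longleftrightarrow> (i', j') \<in> D'; i \<ge> 1\<rbrakk> \<Longrightarrow>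
      (\<forall>j\<ge>1. t i j = t' i j) \<and>
      (\<forall>j. (\<forall>j'>j. (i, j') \<in> D \<longleftrightarrow> (i, j') \<in> D') \<longrightarrow> r i j = r' i j)"
proof -
  obtain m1 m2 where m: "\<And>i j. i \<ge> 1 \<Longrightarrow> j \<ge> m1 \<Longrightarrow> r i j = i + j"
      "\<And>i j. i \<ge> 1 \<Longrightarrow> j \<ge> m2 \<Longrightarrow> r' i j = i + j"
    using assms labeling_far by metis
  define m where "m = max m1 m2"
  have row: "r i j = r' i j"
    if ag: "\<forall>j'>j. (i, j') \<in> D \<longleftrightarrow> (i, j') \<in> D'" and i: "i \<ge> 1" and t: "\<forall>j\<ge>1. t i j = t' i j"
    for i j
    using ag
  proof (induction "m - j" arbitrary: j rule: less_induct)
    case less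
    show ?case
    proof (cases "j \<ge> m")
      case True
      then show ?thesis using m i by (simp add: m_def)
    next
      case False
      then have "m - Suc j < m - j" by auto
      then have "r i (Suc j) = r' i (Suc j)" using less by auto
      then show ?thesis
        using labelingD(2)[OF assms(1) i, of j] labelingD(2)[OF assms(2) i, of j] t less.prems
          by auto
    qed
  qed
  show "\<lbrakk>\<And>i' j'. 1 \<le> i' \<Longrightarrow> i' < i \<Longrightarrow> 1 \<le> j' \<Longrightarrow> (i', j') \<in> D \<longleftrightarrow> (i', j') \<in> D'; i \<ge> 1\<rbrakk> \<Longrightarrow>
      (\<forall>j\<ge>1. t i j = t' i j) \<and>
      (\<forall>j. (\<forall>j'>j. (i, j') \<in> D \<longleftrightarrow> (i, j') \<in> D') \<longrightarrow> r i j = r' i j)"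
  proof (induction i)
    case 0
    then show ?case by simp
  next
    case (Suc i)
    have t: "\<forall>j\<ge>1. t (Suc i) j = t' (Suc i) j"
    proof (cases "i = 0")
      case True
      then show ?thesis using labelingD(1)[OF assms(1)] labelingD(1)[OF assms(2)] by auto
    next
      case False
      have "(\<forall>j\<ge>1. t i j = t' i j) \<and>
        (\<forall>j. (\<forall>j'>j. (i, j') \<in> D \<longleftrightarrow> (i, j') \<in> D') \<longrightarrow> r i j = r' i j)"
        using Suc.prems(1) False by (intro Suc.IH) (auto intro: less_SucI)
      moreover have "\<forall>j'\<ge>1. (i, j') \<in> D \<longleftrightarrow> (i, j') \<in> D'" using Suc.prems(1) False by auto
      ultimately show ?thesis
        using False labelingD(3)[OF assms(1), of i] labelingD(3)[OF assms(2), of i] by auto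
    qed
    then show ?case using row Suc.prems by blast
  qed
qed

lemma labeling_unique:
  assumes "labeling D t r" and "labeling D t' r'" and "i \<ge> 1"
  shows "j \<ge> 1 \<Longrightarrow> t i j = t' i j" and "r i j = r' i j"
  using labeling_agree[OF assms(1,2) _ assms(3)] by auto

lemma labeling_enters:
  assumes lab: "labeling D t r" and D: "pipe_dream D"
  shows "enters D p From_Top (i, j) \<longleftrightarrow> i \<ge> 1 \<and> j \<ge> 1 \<and> t i j = p"
    and "enters D p From_Right (i, j) \<longleftrightarrow> i \<ge> 1 \<and> r i j = p"
proof -
  have fwd: "1 \<le> fst x \<and> (case s of From_Top \<Rightarrow> 1 \<le> snd x \<and> t (fst x) (snd x) = p
      | From_Right \<Rightarrow> r (fst x) (snd x) = p)" if "enters D p s x" for s x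
    using that
  proof induction
    case start
    then show ?case using labelingD(1)[OF lab] by auto
  next
    case (cross_vertical i j)
    then show ?case using labelingD(3)[OF lab, of i j] by auto
  next
    case (cross_horizontal i j)
    then show ?case using labelingD(2)[OF lab, of i "j - 1"] by auto
  next
    case (elbow_top_left i j)
    then show ?case using labelingD(2)[OF lab, of i "j - 1"] by auto
  next
    case (elbow_right_bottom i j)
    then show ?case using labelingD(3)[OF lab, of i j] by auto
  qed
  obtain m0 where m0: "\<And>i j. i \<ge> 1 \<Longrightarrow> j \<ge> m0 \<Longrightarrow> r i j = i + j" using lab labeling_far by metis
  have "finite (snd ` D)" using D by (simp add: pipe_dream_def)
  then obtain m1 where m1: "\<forall>x\<in>snd ` D. x \<le> m1" using finite_nat_set_iff_bounded_le by metis
  define m where "m = max m0 m1"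
  have row: "enters D (r i j) From_Right (i, j)"
    if i: "i \<ge> 1" and t: "\<forall>j\<ge>1. enters D (t i j) From_Top (i, j)" for i j
  proof (induction "m - j" arbitrary: j rule: less_induct)
    case less
    have el: "enters D (r i j) From_Right (i, j)" if "(i, Suc j) \<notin> D"
      using enters.elbow_top_left[of D _ i "Suc j"] t that labelingD(2)[OF lab i, of j] by auto
    show ?case
    proof (cases "j \<ge> m")
      case True
      then have "(i, Suc j) \<notin> D" using m1 by (force simp: m_def)
      then show ?thesis by (rule el)
    next
      case False
      then have "m - Suc j < m - j" by auto
      then have "enters D (r i (Suc j)) From_Right (i, Suc j)" using less by auto
      then show ?thesis
        using el enters.cross_horizontal[of D _ i "Suc j"] labelingD(2)[OF lab i, of j]
        by (cases "(i, Suc j) \<in> D") auto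
    qed
  qed
  have top: "i \<ge> 1 \<Longrightarrow> \<forall>j\<ge>1. enters D (t i j) From_Top (i, j)" for i
  proof (induction i)
    case (Suc i)
    show ?case
    proof (cases "i = 0")
      case True
      then show ?thesis using enters.start[of _ D] labelingD(1)[OF lab] by auto
    next
      case False
      then have *: "\<forall>j\<ge>1. enters D (t i j) From_Top (i, j)" using Suc by auto
      show ?thesis
        using * row[of i] False enters.cross_vertical[of D _ i] enters.elbow_right_bottom[of D _ i]
          labelingD(3)[OF lab, of i] by auto
    qed
  qed simp
  show "enters D p From_Top (i, j) \<longleftrightarrow> i \<ge> 1 \<and> j \<ge> 1 \<and> t i j = p"
    using fwd[of From_Top "(i, j)"] top by auto
  show "enters D p From_Right (i, j) \<longleftrightarrow> i \<ge> 1 \<and> r i j = p"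
    using fwd[of From_Right "(i, j)"] top row by auto
qed

text \<open>Pipes never move upwards, whence the first two claims. Below the last cross all cells
  are elbow joints and a pipe descends as a staircase, one row down for each column to the
  left.\<close>

lemma labeling_exit:
  assumes lab: "labeling D t r" and N: "\<And>i j. (i, j) \<in> D \<Longrightarrow> i \<le> N" and i: "i \<ge> 1"
  shows "\<exists>i'\<ge>i. r i' 0 = r i j" and "j \<ge> 1 \<Longrightarrow> \<exists>i'\<ge>i. r i' 0 = t i j"
    and "i > N \<Longrightarrow> r i j = r (i + j) 0"
proof -
  show far: "i > N \<Longrightarrow> r i j = r (i + j) 0" for i j
  proof (induction j arbitrary: i)
    case (Suc j)
    have "r i (Suc j) = t (Suc i) (Suc j)"
      using N Suc.prems labelingD(3)[OF lab, of i "Suc j"] by force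
    also have "\<dots> = r (Suc i) j" using N Suc.prems labelingD(2)[OF lab, of "Suc i" j] by force
    also have "\<dots> = r (i + Suc j) 0" using Suc.IH[of "Suc i"] Suc.prems by simp
    finally show ?case .
  qed simp
  have R: "(\<exists>i'\<ge>i. r i' 0 = r i j) \<and> (j \<ge> 1 \<longrightarrow> (\<exists>i'\<ge>i. r i' 0 = t i j))" if "i \<ge> 1" for i j
    using that
  proof (induction "Suc N - i" arbitrary: i j rule: less_induct)
    case less
    show ?case
    proof (cases "i > N")
      case True
      have "r (i + j) 0 = r i j" using far[OF True] by (rule sym)
      moreover have "r (i + j - 1) 0 = t i j" if "j \<ge> 1"
      proof -
        have "(i, j) \<notin> D" using True N linorder_not_less by blast
        then have "r i (j - 1) = t i j"
          using that labelingD(4)[OF lab less.prems] by blast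
        then show ?thesis using far[OF True, of "j - 1"] that by (metis Nat.add_diff_assoc)
      qed
      ultimately show ?thesis
        by (intro conjI impI exI[of _ "i + j"] exI[of _ "i + j - 1"]) auto
    next
      case False
      then have "Suc N - Suc i < Suc N - i" by auto
      then have "\<forall>j\<ge>1. \<exists>i'\<ge>Suc i. r i' 0 = t (Suc i) j" using less.hyps[of "Suc i"] by simp
      then have IH: "\<exists>i'\<ge>i. r i' 0 = t (Suc i) j" if "j \<ge> 1" for j
        using that Suc_leD by blast
      show ?thesis
      proof (induction j)
        case (Suc j)
        have 1: "\<exists>i'\<ge>i. r i' 0 = r i (Suc j)"
          using Suc IH[of "Suc j"] labelingD(2)[OF lab less.prems, of j]
            labelingD(3)[OF lab less.prems, of "Suc j"] by (cases "(i, Suc j) \<in> D") auto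
        have 2: "\<exists>i'\<ge>i. r i' 0 = t i (Suc j)"
          using Suc IH[of "Suc j"] labelingD(2)[OF lab less.prems, of j]
            labelingD(3)[OF lab less.prems, of "Suc j"] by (cases "(i, Suc j) \<in> D") auto
        show ?case using 1 2 by simp
      qed auto
    qed
  qed
  show "\<exists>i'\<ge>i. r i' 0 = r i j" using R i by blast
  show "j \<ge> 1 \<Longrightarrow> \<exists>i'\<ge>i. r i' 0 = t i j" using R i by blast
qed

section \<open>Reading the cells one by one\<close>

text \<open>
  Cells are read row by row, each row from right to left. The staircase between the cells read so far
  and the others meets every antidiagonal once; the edge it meets on antidiagonal \<open>a\<close> carries the pipe
  \<open>frontier D cs a\<close>, and a cross exchanges the pipes on two neighbouring antidiagonals.
\<close>

definition diag :: "cell \<Rightarrow> nat" where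
  "diag x = fst x + snd x - 1"

definition frontier :: "pipe_dream \<Rightarrow> cell list \<Rightarrow> nat \<Rightarrow> nat" where
  "frontier D cs = foldl (\<lambda>s x. if x \<in> D then s \<circ> transpose (diag x) (Suc (diag x)) else s) id cs"

lemma frontier_Nil [simp]: "frontier D [] = id"
  by (simp add: frontier_def)

lemma frontier_snoc:
  "frontier D (cs @ [x]) =
     (if x \<in> D then frontier D cs \<circ> transpose (diag x) (Suc (diag x)) else frontier D cs)"
  by (simp add: frontier_def)

lemma bij_frontier: "bij (frontier D cs)"
proof (induction cs rule: rev_induct)
  case Nil
  show ?case unfolding frontier_Nil by (rule bij_id)
next
  case (snoc x cs)
  then show ?case unfolding frontier_snoc by (auto intro: bij_comp)
qed

lemma frontier_untouched:
  assumes "\<And>x. x \<in> set cs \<Longrightarrow> x \<in> D \<Longrightarrow> diag x \<noteq> a \<and> Suc (diag x) \<noteq> a"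
  shows "frontier D (pre @ cs) a = frontier D pre a"
  using assms
proof (induction cs rule: rev_induct)
  case (snoc x cs)
  have "frontier D ((pre @ cs) @ [x]) a = frontier D (pre @ cs) a"
    using snoc.prems[of x] unfolding frontier_snoc by (auto simp: transpose_def)
  then show ?case using snoc by simp
qed simp

lemma frontier_cong:
  assumes "\<And>x. x \<in> set cs \<Longrightarrow> x \<in> D \<longleftrightarrow> x \<in> D'"
  shows "frontier D cs = frontier D' cs"
  using assms by (induction cs rule: rev_induct) (auto simp: frontier_snoc)

text \<open>Dropping one factor from a product of adjacent transpositions amounts to multiplying on
  the left by the transposition of the two values exchanged there: the two pipes swap names from
  that point on.\<close>

lemma frontier_delete:
  assumes "x \<in> D" and "x \<notin> set pre" and "x \<notin> set post"
  shows "frontier (D - {x}) (pre @ x # post) =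
    transpose (frontier D pre (diag x)) (frontier D pre (Suc (diag x))) \<circ> frontier D (pre @ x # post)"
  using assms(3)
proof (induction post rule: rev_induct)
  case Nil
  have "frontier (D - {x}) pre = frontier D pre"
    using assms(2) by (intro frontier_cong) auto
  moreover have "transpose (s a) (s b) \<circ> (s \<circ> transpose a b) = s" if "bij s" for s :: "nat \<Rightarrow> nat"
    and a b
    using bij_is_inj[OF that] by (auto simp: fun_eq_iff transpose_def inj_eq)
  ultimately have "frontier (D - {x}) pre = transpose (frontier D pre (diag x))
      (frontier D pre (Suc (diag x))) \<circ> frontier D (pre @ [x])"
    using assms(1) bij_frontier unfolding frontier_snoc by metis
  then show ?case by (simp only: frontier_snoc) simp
next
  case (snoc y post)
  have "frontier E ((pre @ x # post) @ [y]) = (if y \<in> E then frontier E (pre @ x # post) \<circ>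
      transpose (diag y) (Suc (diag y)) else frontier E (pre @ x # post))" for E
    by (rule frontier_snoc)
  then show ?case using snoc by (auto simp: comp_assoc)
qed

section \<open>The order of two pipes along the staircase\<close>

definition precedes :: "(nat \<Rightarrow> nat) \<Rightarrow> nat \<Rightarrow> nat \<Rightarrow> bool" where
  "precedes s p q \<longleftrightarrow> inv s p < inv s q"

text \<open>\<open>inv s p\<close> is the antidiagonal on which the pipe \<open>p\<close> meets the
  staircase; an adjacent transposition alters only the relative order of the two pipes it
  exchanges.\<close>

lemma precedes_step:
  assumes "bij s" and "p \<noteq> q" and "{s a, s (Suc a)} \<noteq> {p, q}"
  shows "precedes (s \<circ> transpose a (Suc a)) p q \<longleftrightarrow> precedes s p q"
proof -
  have "inv (s \<circ> transpose a (Suc a)) = transpose a (Suc a) \<circ> inv s"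
    using assms(1) by (simp add: o_inv_distrib)
  moreover have "inv s p \<noteq> inv s q" using assms by (metis bij_inv_eq_iff)
  moreover have "{inv s p, inv s q} \<noteq> {a, Suc a}"
  proof
    assume "{inv s p, inv s q} = {a, Suc a}"
    then have "s ` {inv s p, inv s q} = s ` {a, Suc a}" by simp
    then have "{p, q} = {s a, s (Suc a)}"
      using assms(1) by (simp add: bij_is_surj surj_f_inv_f)
    with assms(3) show False by simp
  qed
  ultimately show ?thesis by (auto simp: precedes_def transpose_def doubleton_eq_iff)
qed

lemma precedes_at:
  assumes "bij s" and "s a = p" and "s b = q"
  shows "precedes s p q \<longleftrightarrow> a < b"
  using assms by (auto simp: precedes_def bij_is_inj)

lemma precedes_asym: "precedes s p q \<Longrightarrow> \<not> precedes s q p"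
  by (simp add: precedes_def)

lemma precedes_uncrossed:
  assumes "p \<noteq> q"
    and "\<And>mid1 x mid2. mid = mid1 @ x # mid2 \<Longrightarrow> x \<in> D \<Longrightarrow>
      {frontier D (pre @ mid1) (diag x), frontier D (pre @ mid1) (Suc (diag x))} \<noteq> {p, q}"
  shows "precedes (frontier D (pre @ mid)) p q \<longleftrightarrow> precedes (frontier D pre) p q"
  using assms(2)
proof (induction mid rule: rev_induct)
  case (snoc x mid)
  have "precedes (frontier D (pre @ mid)) p q \<longleftrightarrow> precedes (frontier D pre) p q"
    using snoc.prems by (intro snoc.IH) auto
  moreover have "precedes (frontier D ((pre @ mid) @ [x])) p q \<longleftrightarrow>
    precedes (frontier D (pre @ mid)) p q"
    using snoc.prems[of mid x "[]"] assms(1) precedes_step[OF bij_frontier]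
    unfolding frontier_snoc by auto
  ultimately show ?case by simp
qed simp

text \<open>Once \<open>q\<close> lies before \<open>p < q\<close>, a further cross of the two would
  have the larger pipe on the lower antidiagonal, against the order assumed at all crosses.\<close>

lemma precedes_ordered_crossings:
  assumes "p < q" and "precedes (frontier D pre) q p"
    and "\<And>mid1 x mid2. mid = mid1 @ x # mid2 \<Longrightarrow> x \<in> D \<Longrightarrow>
      frontier D (pre @ mid1) (diag x) < frontier D (pre @ mid1) (Suc (diag x))"
  shows "precedes (frontier D (pre @ mid)) q p"
    and "mid = mid1 @ x # mid2 \<Longrightarrow> x \<in> D \<Longrightarrow>
      {frontier D (pre @ mid1) (diag x), frontier D (pre @ mid1) (Suc (diag x))} \<noteq> {p, q}"
proof -
  have *: "{frontier D ys (diag x), frontier D ys (Suc (diag x))} \<noteq> {p, q}"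
    if "precedes (frontier D ys) q p" "frontier D ys (diag x) < frontier D ys (Suc (diag x))"
      for ys x
  proof
    assume "{frontier D ys (diag x), frontier D ys (Suc (diag x))} = {p, q}"
    then have "frontier D ys (diag x) = p" "frontier D ys (Suc (diag x)) = q"
      using that(2) assms(1) by (auto simp: doubleton_eq_iff)
    from precedes_at[OF bij_frontier this] that(1) precedes_asym show False by auto
  qed
  have **: "precedes (frontier D (pre @ mid)) q p"
    if "\<And>mid1 x mid2. mid = mid1 @ x # mid2 \<Longrightarrow> x \<in> D \<Longrightarrow>
      frontier D (pre @ mid1) (diag x) < frontier D (pre @ mid1) (Suc (diag x))" for mid
    using that
  proof (induction mid rule: rev_induct)
    case (snoc x mid)
    have IH: "precedes (frontier D (pre @ mid)) q p"
      using snoc.prems by (intro snoc.IH) auto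
    have "x \<in> D \<Longrightarrow> {frontier D (pre @ mid) (diag x), frontier D (pre @ mid) (Suc (diag x))} \<noteq> {q, p}"
      using *[OF IH] snoc.prems[of mid x "[]"] by (auto simp: insert_commute)
    then have "precedes (frontier D ((pre @ mid) @ [x])) q p"
      using IH precedes_step[OF bij_frontier] assms(1) unfolding frontier_snoc by auto
    then show ?case by simp
  qed (use assms in simp)
  show "precedes (frontier D (pre @ mid)) q p" by (rule **) (rule assms(3))
  show "mid = mid1 @ x # mid2 \<Longrightarrow> x \<in> D \<Longrightarrow>
      {frontier D (pre @ mid1) (diag x), frontier D (pre @ mid1) (Suc (diag x))} \<noteq> {p, q}"
    using assms(3) by (intro * **) auto
qed

text \<open>This prefix stops just before \<open>(i, j)\<close>, with columns cut off at
  \<open>m\<close>; hence \<open>reading m i 0\<close> is everything up to and including row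
  \<open>i\<close>.\<close>

definition reading :: "nat \<Rightarrow> nat \<Rightarrow> nat \<Rightarrow> cell list" where
  "reading m i j = concat (map (\<lambda>i'. map (Pair i') (rev [1..<Suc m])) [1..<i]) @
     map (Pair i) (rev [Suc j..<Suc m])"

lemma reading_step: "1 \<le> j \<Longrightarrow> j \<le> m \<Longrightarrow> reading m i (j - 1) = reading m i j @ [(i, j)]"
  by (simp add: reading_def upt_conv_Cons)

lemma reading_beyond: "j \<ge> m \<Longrightarrow> reading m i j = reading m i m"
  by (simp add: reading_def)

lemma reading_row: "1 \<le> i \<Longrightarrow> m \<le> j \<Longrightarrow> reading m (Suc i) j = reading m i 0"
  by (simp add: reading_def)

lemma reading_split:
  "1 \<le> i \<Longrightarrow> j \<le> m \<Longrightarrow> reading m i 0 = reading m i j @ map (Pair i) (rev [1..<Suc j])"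
proof -
  assume "1 \<le> i" "j \<le> m"
  then have "[1..<Suc m] = [1..<Suc j] @ [Suc j..<Suc m]"
    using upt_add_eq_append[of 1 "Suc j" "m - j"] by simp
  then show ?thesis by (simp add: reading_def)
qed

lemma reading_rows:
  assumes "1 \<le> i" and "i \<le> i'"
  obtains post where "reading m i' 0 = reading m i 0 @ post" and "\<And>x. x \<in> set post \<Longrightarrow> fst x > i"
proof -
  have "\<exists>post. reading m i' 0 = reading m i 0 @ post \<and> (\<forall>x\<in>set post. fst x > i)"
    using assms(2)
  proof (induction i' rule: dec_induct)
    case (step n)
    have "reading m (Suc n) 0 = reading m (Suc n) m @ map (Pair (Suc n)) (rev [1..<Suc m])"
      using reading_split[of "Suc n" m m] by simp
    also have "reading m (Suc n) m = reading m n 0" using reading_row step assms by simp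
    finally show ?case using step by auto
  qed simp
  then show ?thesis using that by blast
qed

lemma set_reading: "set (reading m i 0) = {1..<Suc i} \<times> {1..<Suc m}" if "i \<ge> 1"
proof -
  have "set (reading m i 0) = (\<Union>i'\<in>{1..<i}. {i'} \<times> {1..<Suc m}) \<union> {i} \<times> {1..<Suc m}"
    unfolding reading_def set_append set_concat set_map set_rev set_upt One_nat_def image_image
      by blast
  also have "\<dots> = {1..<Suc i} \<times> {1..<Suc m}" using that by (auto simp: less_Suc_eq)
  finally show ?thesis .
qed

lemma set_reading_lt: "x \<in> set (reading m i j) \<Longrightarrow> j \<ge> m \<Longrightarrow> fst x < i \<and> 1 \<le> fst x \<and> 1 \<le> snd x \<and>
  snd x \<le> m"
  by (auto simp: reading_def)

lemma distinct_reading: "distinct (reading m i j)"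
proof -
  have "distinct (concat (map (\<lambda>i'. map (Pair i') (rev [1..<Suc m])) [1..<i]))"
    by (induction i) (auto simp: distinct_map inj_on_def)
  then show ?thesis by (auto simp: reading_def distinct_map inj_on_def)
qed

definition top_label :: "nat \<Rightarrow> pipe_dream \<Rightarrow> nat \<Rightarrow> nat \<Rightarrow> nat" where
  "top_label m D i j = frontier D (reading m i j) (i + j - 1)"

definition right_label :: "nat \<Rightarrow> pipe_dream \<Rightarrow> nat \<Rightarrow> nat \<Rightarrow> nat" where
  "right_label m D i j = frontier D (reading m i j) (i + j)"

lemma labeling_frontier:
  assumes D: "\<And>x. x \<in> D \<Longrightarrow> 1 \<le> fst x \<and> 1 \<le> snd x \<and> snd x \<le> m"
  shows "labeling D (top_label m D) (right_label m D)"
proof -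
  have start: "top_label m D 1 j = j" if "j \<ge> 1" for j
  proof -
    have "frontier D ([] @ reading m 1 j) j = frontier D [] j"
      by (rule frontier_untouched) (auto simp: reading_def diag_def)
    then show ?thesis by (simp add: top_label_def)
  qed
  have far: "right_label m D i j = i + j" if "i \<ge> 1" "j \<ge> m" for i j
  proof -
    have "frontier D ([] @ reading m i j) (i + j) = frontier D [] (i + j)"
    proof (rule frontier_untouched)
      fix x assume "x \<in> set (reading m i j)"
      then have "fst x < i \<and> 1 \<le> fst x \<and> 1 \<le> snd x \<and> snd x \<le> m" using set_reading_lt that by blast
      then show "diag x \<noteq> i + j \<and> Suc (diag x) \<noteq> i + j" using that by (auto simp: diag_def)
    qed
    then show ?thesis by (simp add: right_label_def)
  qed
  have left: "right_label m D i (j - 1) = (if (i, j) \<in> D then right_label m D i j else top_label m D i j)"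
    if "i \<ge> 1" "j \<ge> 1" for i j
  proof (cases "j \<le> m")
    case True
    then have "reading m i (j - 1) = reading m i j @ [(i, j)]" using reading_step that by blast
    moreover have "diag (i, j) = i + j - 1" by (simp add: diag_def)
    ultimately show ?thesis
      using that by (simp add: right_label_def top_label_def frontier_snoc)
  next
    case False
    then have "(i, j) \<notin> D" using D by force
    moreover have "reading m i (j - 1) = reading m i j"
      using False reading_beyond[of m "j - 1" i] reading_beyond[of m j i] by auto
    ultimately show ?thesis using that by (simp add: right_label_def top_label_def)
  qed
  have bot: "top_label m D (i + 1) j = (if (i, j) \<in> D then top_label m D i j else right_label m D i j)"
    if "i \<ge> 1" "j \<ge> 1" for i j
  proof -
    \<comment> \<open>Between \<open>(i, j)\<close> and \<open>(i + 1, j)\<close> only cells of row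
      \<open>i\<close> left of column \<open>j\<close> and of row \<open>i + 1\<close> right of it
      are read; none of them touches antidiagonal \<open>i + j\<close>.\<close>
    have "frontier D (reading m (Suc i) j) (i + j) = frontier D (reading m i (j - 1)) (i + j)"
    proof -
      define j1 where "j1 = min (j - 1) m"
      have "reading m (Suc i) j = reading m i 0 @ map (Pair (Suc i)) (rev [Suc j..<Suc m])"
        using that by (simp add: reading_def)
      also have "reading m i 0 = reading m i j1 @ map (Pair i) (rev [1..<Suc j1])"
        using that by (intro reading_split) (auto simp: j1_def)
      also have "reading m i j1 = reading m i (j - 1)"
        using reading_beyond[of m "j - 1" i] by (auto simp: j1_def min_def)
      finally have "reading m (Suc i) j = reading m i (j - 1) @
          (map (Pair i) (rev [1..<Suc j1]) @ map (Pair (Suc i)) (rev [Suc j..<Suc m]))" by simp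
      moreover have "frontier D (reading m i (j - 1) @
          (map (Pair i) (rev [1..<Suc j1]) @ map (Pair (Suc i)) (rev [Suc j..<Suc m]))) (i + j)
          = frontier D (reading m i (j - 1)) (i + j)"
        by (rule frontier_untouched) (auto simp: diag_def j1_def)
      ultimately show ?thesis by simp
    qed
    also have "\<dots> = (if (i, j) \<in> D then top_label m D i j else right_label m D i j)"
    proof (cases "j \<le> m")
      case True
      then have "reading m i (j - 1) = reading m i j @ [(i, j)]" using reading_step that by blast
      moreover have "diag (i, j) = i + j - 1" by (simp add: diag_def)
      ultimately show ?thesis
        using that by (simp add: right_label_def top_label_def frontier_snoc)
    next
      case False
      then have "(i, j) \<notin> D" using D by force
      moreover have "reading m i (j - 1) = reading m i j"
        using False reading_beyond[of m "j - 1" i] reading_beyond[of m j i] by auto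
      ultimately show ?thesis using that by (simp add: right_label_def top_label_def)
    qed
    finally show ?thesis by (simp add: top_label_def)
  qed
  show ?thesis unfolding labeling_def using start far left bot by blast
qed

section \<open>Inversions and crossings\<close>

text \<open>An interface hiding the bounds of the reading. It quantifies over all \<open>D\<close>
  inside \<open>E\<close> so that one word serves a pipe dream before and after deleting a cross;
  \<open>E\<close> may also contain elbow joints whose labels are of interest.\<close>

definition sweep :: "cell set \<Rightarrow> cell list \<Rightarrow> bool" where
  "sweep E cs \<longleftrightarrow> distinct cs \<and> E \<subseteq> set cs \<and> set cs \<subseteq> grid \<and>
     (\<forall>D t r. D \<subseteq> E \<longrightarrow> labeling D t r \<longrightarrow>
        (\<forall>pre x post. cs = pre @ x # post \<longrightarrow>
           t (fst x) (snd x) = frontier D pre (diag x) \<and>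
           r (fst x) (snd x) = frontier D pre (Suc (diag x))) \<and>
        (\<forall>i\<ge>1. r i 0 = frontier D cs i))"

lemma sweepD:
  assumes "sweep E cs"
  shows "distinct cs" and "E \<subseteq> set cs" and "set cs \<subseteq> grid"
    and "\<lbrakk>labeling D t r; D \<subseteq> E; cs = pre @ x # post\<rbrakk> \<Longrightarrow>
      t (fst x) (snd x) = frontier D pre (diag x) \<and> r (fst x) (snd x) = frontier D pre (Suc (diag x))"
    and "\<lbrakk>labeling D t r; D \<subseteq> E; i \<ge> 1\<rbrakk> \<Longrightarrow> r i 0 = frontier D cs i"
  using assms unfolding sweep_def by blast+

lemma sweep_exists:
  assumes "finite E" and "E \<subseteq> grid"
  obtains cs where "sweep E cs"
proof -
  have "finite (fst ` E)" "finite (snd ` E)" using assms by auto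
  then obtain n0 m where nm0: "\<forall>x\<in>fst ` E. x \<le> n0" "\<forall>x\<in>snd ` E. x \<le> m"
    by (meson finite_nat_set_iff_bounded_le)
  define n where "n = Suc n0"
  have nm: "1 \<le> fst x \<and> fst x \<le> n \<and> 1 \<le> snd x \<and> snd x \<le> m" if "x \<in> E" for x
    using nm0 assms that by (fastforce simp: n_def grid_def)
  define cs where "cs = reading m n 0"
  have set_cs: "set cs = {1..<Suc n} \<times> {1..<Suc m}"
    unfolding cs_def by (rule set_reading) (simp add: n_def)
  have lab: "t i j = top_label m D i j" "r i j' = right_label m D i j'"
    if "D \<subseteq> E" "labeling D t r" "i \<ge> 1" "j \<ge> 1" for D t r i j j'
  proof -
    have "labeling D (top_label m D) (right_label m D)"
      using nm that by (intro labeling_frontier) auto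
    then show "t i j = top_label m D i j" "r i j' = right_label m D i j'"
      using labeling_unique[OF that(2)] that by auto
  qed
  have "sweep E cs"
    unfolding sweep_def
  proof (intro conjI allI impI)
    show "distinct cs" by (simp add: cs_def distinct_reading)
    show "E \<subseteq> set cs" "set cs \<subseteq> grid" using nm unfolding set_cs
      by (force simp: grid_def less_Suc_eq_le)+
  next
    fix D t r pre x post
    assume D: "D \<subseteq> E" and l: "labeling D t r" and cs: "cs = pre @ x # post"
    obtain i j where x: "x = (i, j)" by (cases x)
    have "x \<in> set cs" using cs by simp
    then have ij: "1 \<le> i" "i \<le> n" "1 \<le> j" "j \<le> m" using x unfolding set_cs by auto
    obtain post1 where "cs = reading m i 0 @ post1"
      using reading_rows[OF ij(1,2), of m] cs_def by metis
    moreover have "reading m i 0 = reading m i j @ (x # map (Pair i) (rev [1..<j]))"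
      using reading_split[of i "j - 1" m] reading_step[OF ij(3,4), of i] ij x by simp
    ultimately have "cs = reading m i j @ x # (map (Pair i) (rev [1..<j]) @ post1)" by simp
    moreover have "x \<notin> set pre" "x \<notin> set post"
      using cs distinct_reading[of m n 0] by (auto simp: cs_def)
    ultimately have "pre = reading m i j"
      using cs append_Cons_eq_iff[of x pre post] by metis
    then show "t (fst x) (snd x) = frontier D pre (diag x)"
      "r (fst x) (snd x) = frontier D pre (Suc (diag x))"
      using lab[OF D l] ij x by (simp_all add: top_label_def right_label_def diag_def)
  next
    fix D t r and i :: nat
    assume D: "D \<subseteq> E" and l: "labeling D t r" and i: "i \<ge> 1"
    have r: "r i 0 = frontier D (reading m i 0) i"
      using lab(2)[OF D l i, where j = 1 and j' = 0] by (simp add: right_label_def)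
    show "r i 0 = frontier D cs i"
    proof (cases "i \<le> n")
      case True
      then obtain post where "cs = reading m i 0 @ post" and "\<And>x. x \<in> set post \<Longrightarrow> fst x > i"
        using reading_rows[OF i, of n m] cs_def by metis
      moreover have "frontier D (reading m i 0 @ post) i = frontier D (reading m i 0) i"
        using calculation(2) nm D by (intro frontier_untouched) (force simp: diag_def)
      ultimately show ?thesis using r by simp
    next
      case False
      then obtain post where "reading m i 0 = cs @ post" and "\<And>x. x \<in> set post \<Longrightarrow> fst x > n"
        using reading_rows[of n i m] cs_def
          by (metis Suc_le_mono Zero_not_Suc bot_nat_0.extremum le_cases n_def One_nat_def)
      moreover have "frontier D (cs @ post) i = frontier D cs i"
        using calculation(2) nm D by (intro frontier_untouched) force
      ultimately show ?thesis using r by simp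
    qed
  qed
  then show ?thesis by (rule that)
qed

lemma labeling_exists:
  assumes "pipe_dream D"
  obtains t r where "labeling D t r"
proof -
  have "finite (snd ` D)" using assms by (simp add: pipe_dream_def)
  then obtain m where "\<forall>x\<in>snd ` D. x \<le> m"
    by (meson finite_nat_set_iff_bounded_le)
  then have "labeling D (top_label m D) (right_label m D)"
    using assms by (intro labeling_frontier) (auto simp: pipe_dream_def grid_def)
  then show ?thesis by (rule that)
qed

lemma frontier_grid_0: "set cs \<subseteq> grid \<Longrightarrow> frontier D cs 0 = 0"
  using frontier_untouched[of cs D 0 "[]"] by (force simp: grid_def diag_def)

lemma labeling_exits_bij:
  assumes "labeling D t r" and "pipe_dream D"
  shows "bij_betw (\<lambda>i. r i 0) {1..} {1..}"
proof -
  obtain cs where sw: "sweep D cs" using assms(2) sweep_exists unfolding pipe_dream_def by blast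
  note cs = sweepD(3)[OF sw] and r = sweepD(5)[OF sw assms(1) order_refl]
  have "bij_betw (frontier D cs) (UNIV - {0}) (UNIV - {frontier D cs 0})"
    using bij_frontier[of D cs] by (simp add: bij_betw_DiffI)
  moreover have "UNIV - {0} = {1::nat..}" by (auto simp: Suc_le_eq)
  ultimately have "bij_betw (frontier D cs) {1..} {1..}" using frontier_grid_0[OF cs] by simp
  then show ?thesis using r bij_betw_cong[of "{1..}" "\<lambda>i. r i 0" "frontier D cs" "{1..}"] by auto
qed

lemma labeling_delete:
  assumes "labeling D t r" and "pipe_dream D" and "(i, j) \<in> D" and "labeling (D - {(i, j)}) t' r'"
    and "k \<ge> 1"
  shows "r' k 0 = transpose (t i j) (r i j) (r k 0)"
proof -
  obtain cs where sw: "sweep D cs" using assms(2) sweep_exists unfolding pipe_dream_def by blast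
  note cs = sweepD(1,2)[OF sw]
  obtain pre post where s: "cs = pre @ (i, j) # post" using cs assms(3)
    by (meson split_list subsetD)
  then have "(i, j) \<notin> set pre" "(i, j) \<notin> set post" using cs by auto
  then have "frontier (D - {(i, j)}) cs = transpose (t i j) (r i j) \<circ> frontier D cs"
    using frontier_delete[OF assms(3)] sweepD(4)[OF sw assms(1) order_refl s] s by simp
  then show ?thesis
    using sweepD(5)[OF sw assms(1) order_refl assms(5)] sweepD(5)[OF sw assms(4) _ assms(5)] by simp
qed

lemma labeling_pos:
  assumes "labeling D t r" and "pipe_dream D" and "i \<ge> 1" and "j \<ge> 1"
  shows "t i j \<ge> 1" and "r i j \<ge> 1" and "t i j \<noteq> r i j"
proof -
  \<comment> \<open>Adding the cell to the word covers elbow joints too. Antidiagonal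
    \<open>0\<close> always carries \<open>0\<close>, so injectivity of the frontier makes the
    labels positive and distinct.\<close>
  have "finite (insert (i, j) D)" "insert (i, j) D \<subseteq> grid"
    using assms by (auto simp: pipe_dream_def grid_def)
  then obtain cs where sw: "sweep (insert (i, j) D) cs" by (rule sweep_exists)
  note cs = sweepD(2,3)[OF sw] and x = sweepD(4)[OF sw assms(1) subset_insertI]
  obtain pre post where s: "cs = pre @ (i, j) # post"
    using cs split_list[of "(i, j)" cs] by auto
  have l: "t i j = frontier D pre (diag (i, j))" "r i j = frontier D pre (Suc (diag (i, j)))"
    using x[OF s] by auto
  have 0: "frontier D pre 0 = 0" using cs s by (intro frontier_grid_0) auto
  have inj: "inj (frontier D pre)" using bij_frontier by (rule bij_is_inj)
  show "t i j \<noteq> r i j" unfolding l using inj_eq[OF inj, of "diag (i, j)" "Suc (diag (i, j))"]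
    by simp
  have "diag (i, j) \<noteq> 0" using assms by (simp add: diag_def)
  then have "frontier D pre (diag (i, j)) \<noteq> frontier D pre 0" by (simp add: inj_eq[OF inj])
  moreover have "frontier D pre (Suc (diag (i, j))) \<noteq> frontier D pre 0"
    by (simp add: inj_eq[OF inj])
  ultimately show "t i j \<ge> 1" "r i j \<ge> 1" using 0 l by auto
qed

text \<open>On the initial staircase the smaller pipe comes first, on the final one the larger; the
  order can only be reversed at a cross of the two.\<close>

lemma labeling_inversion_crossing:
  assumes "labeling D t r" and "pipe_dream D" and "1 \<le> i1" and "i1 < i2" and "r i1 0 > r i2 0"
  obtains i j where "(i, j) \<in> D" and "{t i j, r i j} = {r i2 0, r i1 0}"
proof -
  obtain cs where sw: "sweep D cs" using assms(2) sweep_exists unfolding pipe_dream_def by blast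
  note x = sweepD(4)[OF sw assms(1) order_refl] and w = sweepD(5)[OF sw assms(1) order_refl]
  define p q where "p = r i2 0" and "q = r i1 0"
  have fin: "\<not> precedes (frontier D ([] @ cs)) p q"
    using precedes_at[OF bij_frontier, of D cs i2 p i1 q] w assms by (simp add: p_def q_def)
  have "precedes (frontier D []) p q" using assms by (simp add: precedes_def p_def q_def)
  then obtain mid1 y mid2 where "cs = mid1 @ y # mid2" "y \<in> D"
      "{frontier D mid1 (diag y), frontier D mid1 (Suc (diag y))} = {p, q}"
    using fin precedes_uncrossed[of p q cs D "[]"] assms(5) unfolding p_def q_def by force
  then show ?thesis using x that[of "fst y" "snd y"] by (auto simp: p_def q_def)
qed

text \<open>Two pipes start in increasing order, so at their first cross the smaller one enters from
  above. A cross in the opposite order is thus a repeated one; if there is none, a pair that has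
  crossed stays inverted up to the exits.\<close>

lemma reduced_iff_labels:
  assumes "labeling D t r" and "pipe_dream D"
  shows "reduced D \<longleftrightarrow> (\<forall>(i, j)\<in>D. t i j < r i j)"
    and "reduced D \<Longrightarrow> (i, j) \<in> D \<Longrightarrow> \<exists>i1\<ge>1. \<exists>i2>i1. r i1 0 = r i j \<and> r i2 0 = t i j"
    and "reduced D \<longleftrightarrow> inj_on (\<lambda>(i, j). {t i j, r i j}) D"
proof -
  have fin: "finite D" and gr: "D \<subseteq> grid" using assms(2) by (auto simp: pipe_dream_def)
  obtain cs where sw: "sweep D cs" using fin gr by (rule sweep_exists)
  note cs = sweepD(1-3)[OF sw]
    and x = sweepD(4)[OF sw assms(1) order_refl] and w = sweepD(5)[OF sw assms(1) order_refl]
  have crossings: "crossings D p q = {y \<in> D. {t (fst y) (snd y), r (fst y) (snd y)} = {p, q}}"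
    for p q
    using gr labeling_enters[OF assms] by (fastforce simp: crossings_def doubleton_eq_iff grid_def)
  have red: "reduced D \<longleftrightarrow> (\<forall>p\<ge>1. \<forall>q\<ge>1. p \<noteq> q \<longrightarrow> (\<forall>y\<in>crossings D p q. \<forall>z\<in>crossings D p q. y = z))"
  proof -
    have "finite (crossings D p q)" for p q using fin by (simp add: crossings_def)
    then show ?thesis unfolding reduced_def by (metis One_nat_def card_le_Suc0_iff_eq)
  qed
  have pos: "t (fst y) (snd y) \<ge> 1 \<and> r (fst y) (snd y) \<ge> 1 \<and> t (fst y) (snd y) \<noteq> r (fst y) (snd y)"
    if "y \<in> D" for y
    using that gr labeling_pos[OF assms, of "fst y" "snd y"] by (auto simp: grid_def)
  have ordered: "t (fst y) (snd y) < r (fst y) (snd y)" if rd: "reduced D" and yD: "y \<in> D" for y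
  proof (rule ccontr)
    assume "\<not> t (fst y) (snd y) < r (fst y) (snd y)"
    define p q where "p = r (fst y) (snd y)" and "q = t (fst y) (snd y)"
    have pq: "p < q" "p \<ge> 1" "q \<ge> 1" using pos[OF yD] \<open>\<not> _\<close> by (auto simp: p_def q_def)
    obtain pre post where s: "cs = pre @ y # post" using cs yD split_list[of y cs] by blast
    have "precedes (frontier D ([] @ pre)) q p"
      using precedes_at[OF bij_frontier, of D pre "diag y" q "Suc (diag y)" p] x[OF s]
        by (simp add: p_def q_def)
    then have "\<not> precedes (frontier D ([] @ pre)) p q" by (rule precedes_asym)
    moreover have "precedes (frontier D []) p q" using pq by (simp add: precedes_def)
    ultimately obtain mid1 z mid2 where z: "pre = mid1 @ z # mid2" "z \<in> D"
        "{frontier D mid1 (diag z), frontier D mid1 (Suc (diag z))} = {p, q}"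
      using precedes_uncrossed[of p q pre D "[]"] pq(1) by force
    then have "z \<in> crossings D p q" using x[of mid1 z "mid2 @ y # post"] s by (simp add: crossings)
    moreover have "y \<in> crossings D p q" using yD by (auto simp: crossings p_def q_def)
    ultimately have "y = z" using red rd pq by (metis less_irrefl)
    then show False using z s cs by auto
  qed
  have after: "precedes (frontier D cs) q p \<and>
      (\<forall>z\<in>set post. z \<in> D \<longrightarrow> {t (fst z) (snd z), r (fst z) (snd z)} \<noteq> {p, q})"
    if ord: "\<forall>y\<in>D. t (fst y) (snd y) < r (fst y) (snd y)" and y: "y \<in> D" "cs = pre @ y # post"
      and pq: "p = t (fst y) (snd y)" "q = r (fst y) (snd y)" for y pre post p q
  proof -
    have "frontier D (pre @ [y]) (Suc (diag y)) = p" "frontier D (pre @ [y]) (diag y) = q"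
      using x[OF y(2)] y(1) pq by (simp_all add: frontier_snoc)
    then have 1: "precedes (frontier D (pre @ [y])) q p"
      using precedes_at[OF bij_frontier, of D "pre @ [y]" "diag y" q "Suc (diag y)" p] by simp
    have 2: "frontier D ((pre @ [y]) @ mid1) (diag z) < frontier D ((pre @ [y]) @ mid1) (Suc (diag z))"
      if "post = mid1 @ z # mid2" "z \<in> D" for mid1 z mid2
      using x[of "(pre @ [y]) @ mid1" z mid2] y(2) that ord by auto
    have pq1: "p < q" using ord y pq by blast
    have "precedes (frontier D ((pre @ [y]) @ post)) q p"
      using precedes_ordered_crossings(1)[OF pq1 1, of post] 2 by blast
    moreover have "{t (fst z) (snd z), r (fst z) (snd z)} \<noteq> {p, q}" if z: "z \<in> set post" "z \<in> D"
      for z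
    proof -
      obtain mid1 mid2 where m: "post = mid1 @ z # mid2" using z by (meson split_list)
      then have "{frontier D ((pre @ [y]) @ mid1) (diag z), frontier D ((pre @ [y]) @ mid1) (Suc (diag z))} \<noteq> {p, q}"
        by (intro precedes_ordered_crossings(2)[OF pq1 1 _ m z(2)] 2)
      then show ?thesis using x[of "(pre @ [y]) @ mid1" z mid2] y(2) m by auto
    qed
    ultimately show ?thesis using y(2) by simp
  qed
  have unique: "y = z" if ord: "\<forall>y\<in>D. t (fst y) (snd y) < r (fst y) (snd y)"
    and yz: "y \<in> D" "z \<in> D"
      "{t (fst y) (snd y), r (fst y) (snd y)} = {t (fst z) (snd z), r (fst z) (snd z)}" for y z
  proof (rule ccontr)
    assume "y \<noteq> z"
    obtain pre post where s: "cs = pre @ y # post" using cs yz split_list[of y cs] by blast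
    obtain pre' post' where s': "cs = pre' @ z # post'" using cs yz split_list[of z cs] by blast
    have "z \<in> set post \<or> y \<in> set post'"
    proof (rule ccontr)
      assume a: "\<not> ?thesis"
      then have "z \<in> set pre" using s s' \<open>y \<noteq> z\<close> yz cs
        by (metis in_set_conv_decomp set_ConsD set_append Un_iff)
      then obtain u v where "pre = u @ z # v" by (meson split_list)
      then have "cs = u @ z # (v @ y # post)" using s by simp
      moreover have "z \<notin> set u" "z \<notin> set (v @ y # post)" using calculation cs(1) by auto
      ultimately have "post' = v @ y # post"
        using s' append_Cons_eq_iff[of z u "v @ y # post" pre' post'] by auto
      then show False using a by simp
    qed
    then show False
      using after[OF ord yz(1) s refl refl] after[OF ord yz(2) s' refl refl] yz by auto
  qed
  show iff: "reduced D \<longleftrightarrow> (\<forall>(i, j)\<in>D. t i j < r i j)"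
  proof
    assume "reduced D"
    then show "\<forall>(i, j)\<in>D. t i j < r i j" using ordered by force
  next
    assume "\<forall>(i, j)\<in>D. t i j < r i j"
    then have ord: "\<forall>y\<in>D. t (fst y) (snd y) < r (fst y) (snd y)" by auto
    show "reduced D"
      unfolding red
    proof (intro allI impI ballI)
      fix p q y z
      assume "y \<in> crossings D p q" "z \<in> crossings D p q"
      then show "y = z" unfolding crossings by (intro unique[OF ord]) simp_all
    qed
  qed
  show "reduced D \<longleftrightarrow> inj_on (\<lambda>(i, j). {t i j, r i j}) D"
  proof
    assume "reduced D"
    then have "\<forall>y\<in>D. t (fst y) (snd y) < r (fst y) (snd y)" using ordered by blast
    from unique[OF this] show "inj_on (\<lambda>(i, j). {t i j, r i j}) D"
      unfolding inj_on_def case_prod_beta by blast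
  next
    assume inj: "inj_on (\<lambda>(i, j). {t i j, r i j}) D"
    show "reduced D"
      unfolding red
    proof (intro allI impI ballI)
      fix p q y z
      assume "y \<in> crossings D p q" "z \<in> crossings D p q"
      then show "y = z" unfolding crossings by (intro inj_onD[OF inj]) (auto simp: case_prod_beta)
    qed
  qed
  show "\<exists>i1\<ge>1. \<exists>i2>i1. r i1 0 = r i j \<and> r i2 0 = t i j" if rd: "reduced D" and ij: "(i, j) \<in> D"
  proof -
    obtain pre post where s: "cs = pre @ (i, j) # post" using cs ij split_list[of "(i, j)" cs]
      by blast
    have "\<forall>y\<in>D. t (fst y) (snd y) < r (fst y) (snd y)" using ordered rd by blast
    from after[OF this ij s refl refl]
    have pr: "inv (frontier D cs) (r i j) < inv (frontier D cs) (t i j)" by (simp add: precedes_def)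
    have b: "bij_betw (\<lambda>i. r i 0) {1..} {1..}" by (rule labeling_exits_bij[OF assms])
    have "r i j \<in> {1..}" "t i j \<in> {1..}" using pos[OF ij] by auto
    then have "r i j \<in> (\<lambda>i. r i 0) ` {1..}" "t i j \<in> (\<lambda>i. r i 0) ` {1..}"
      using b unfolding bij_betw_def by blast+
    then obtain i1 i2 where i: "i1 \<ge> 1" "r i1 0 = r i j" "i2 \<ge> 1" "r i2 0 = t i j"
      by (elim imageE) (auto dest!: sym)
    then have "frontier D cs i1 = r i j" "frontier D cs i2 = t i j" using w by auto
    then have "i1 = inv (frontier D cs) (r i j)" "i2 = inv (frontier D cs) (t i j)"
      using bij_frontier[of D cs] by (auto simp: bij_inv_eq_iff)
    then have "i1 < i2" using pr by simp
    then show ?thesis using i by blast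
  qed
qed

section \<open>Chains and flows of pipes\<close>

definition ne_set :: "cell set \<Rightarrow> bool" where
  "ne_set S \<longleftrightarrow> finite S \<and> (\<forall>x\<in>S. \<forall>y\<in>S. x \<noteq> y \<longrightarrow> north_east_of x y \<or> north_east_of y x)"

lemma ne_set_empty [simp]: "ne_set {}"
  by (simp add: ne_set_def)

lemma ne_set_subset: "ne_set S \<Longrightarrow> T \<subseteq> S \<Longrightarrow> ne_set T"
  unfolding ne_set_def using finite_subset by blast

lemma ne_set_wider:
  "\<lbrakk>\<exists>S. ne_set S \<and> S \<subseteq> A - D \<and> card S = n; A \<subseteq> B\<rbrakk> \<Longrightarrow> \<exists>S. ne_set S \<and> S \<subseteq> B - D \<and> card S = n"
  by blast

lemma ne_set_card_subset:
  assumes "ne_set S" and "n \<le> card S"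
  obtains T where "T \<subseteq> S" and "ne_set T" and "card T = n"
  by (metis assms ne_set_subset obtain_subset_with_card_n)

lemma ne_set_Un:
  assumes "ne_set S" and "ne_set T" and "\<And>x y. x \<in> S \<Longrightarrow> y \<in> T \<Longrightarrow> north_east_of x y"
  shows "ne_set (S \<union> T)" and "card (S \<union> T) = card S + card T"
proof -
  show "ne_set (S \<union> T)" using assms unfolding ne_set_def by blast
  have "S \<inter> T = {}" using assms(3) unfolding north_east_of_def by blast
  then show "card (S \<union> T) = card S + card T"
    using assms by (simp add: card_Un_disjoint ne_set_def)
qed

lemma ne_set_cell: "ne_set {x}"
  by (simp add: ne_set_def)

lemma ne_set_inj:
  assumes "ne_set S"
  shows "inj_on fst S" and "inj_on snd S"
  using assms unfolding ne_set_def north_east_of_def inj_on_def by (metis less_irrefl)+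

text \<open>Pipes move left and down only, so none gets to the right of its starting column. This
  yields the boundary value \<open>flow r J i J = 0\<close>.\<close>

lemma labeling_lower:
  assumes lab: "labeling D t r" and "i \<ge> 1"
  shows "j \<ge> 1 \<Longrightarrow> j \<le> t i j" and "j < r i j"
proof -
  obtain m where m: "\<And>i j. i \<ge> 1 \<Longrightarrow> j \<ge> m \<Longrightarrow> r i j = i + j" using lab labeling_far by metis
  have row: "j < r i j" if i: "i \<ge> 1" and t: "\<forall>j\<ge>1. j \<le> t i j" for i j
  proof (induction "m - j" arbitrary: j rule: less_induct)
    case less
    show ?case
    proof (cases "j \<ge> m")
      case False
      then have "m - Suc j < m - j" by auto
      then have "Suc j < r i (Suc j)" using less by auto
      moreover have "Suc j \<le> t i (Suc j)" using t by simp
      ultimately show ?thesis using labelingD(2)[OF lab i, of j] by (auto split: if_splits)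
    qed (use m i in simp)
  qed
  have "\<forall>j\<ge>1. j \<le> t i j" if "i \<ge> 1" for i
    using that
  proof (induction i rule: dec_induct)
    case base
    then show ?case using labelingD(1)[OF lab] by simp
  next
    case (step i)
    then show ?case
      using row[of i] labelingD(3)[OF lab, of i] by (auto simp: less_imp_le)
  qed
  then show "j \<ge> 1 \<Longrightarrow> j \<le> t i j" and "j < r i j" using row assms(2) by blast+
qed

text \<open>
  The number of pipes starting in columns up to \<open>J\<close> that cross the line between columns \<open>j\<close> and
  \<open>j + 1\<close> in one of the first \<open>i\<close> rows; it obeys the recursion for the longest chain of elbow joints
  in rows \<open>1..i\<close> and columns \<open>j + 1..J\<close>.
\<close>

definition flow :: "(nat \<Rightarrow> nat \<Rightarrow> nat) \<Rightarrow> nat \<Rightarrow> nat \<Rightarrow> nat \<Rightarrow> nat" where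
  "flow r J i j = card {i' \<in> {1..i}. r i' j \<le> J}"

lemma flow_0 [simp]: "flow r J 0 j = 0"
  by (simp add: flow_def)

lemma flow_Suc: "flow r J (Suc i) j = flow r J i j + (if r (Suc i) j \<le> J then 1 else 0)"
proof -
  have "{i' \<in> {1..Suc i}. r i' j \<le> J} = (if r (Suc i) j \<le> J then insert (Suc i) {i' \<in> {1..i}. r i' j \<le> J}
      else {i' \<in> {1..i}. r i' j \<le> J})"
    by (auto simp: le_Suc_eq)
  then show ?thesis by (simp add: flow_def)
qed

lemma flow_last: "labeling D t r \<Longrightarrow> flow r J i J = 0"
  using labeling_lower(2)[of D t r _ J] by (auto simp: flow_def not_le)

text \<open>Conservation in column \<open>j + 1\<close>, for pipes starting in columns up to
  \<open>J\<close>: what enters from the right in the first \<open>i\<close> rows, plus the pipe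
  starting on top of the column, leaves to the left or through the bottom of row
  \<open>i\<close>.\<close>

lemma flow_column:
  assumes "labeling D t r" and "j < J"
  shows "flow r J i j + (if t (Suc i) (Suc j) \<le> J then 1 else 0) = flow r J i (Suc j) + 1"
proof (induction i)
  case 0
  then show ?case using assms labelingD(1)[OF assms(1), of "Suc j"] by simp
next
  case (Suc i)
  then show ?case
    using labelingD(2)[OF assms(1), of "Suc i" j] labelingD(3)[OF assms(1), of "Suc i" "Suc j"]
    by (cases "(Suc i, Suc j) \<in> D") (auto simp: flow_Suc)
qed

lemma flow_elbow:
  assumes "labeling D t r" and "j < J" and "(Suc i, Suc j) \<notin> D"
  shows "flow r J (Suc i) j = flow r J i (Suc j) + 1"
  using flow_column[OF assms(1,2), of i] labelingD(2)[OF assms(1), of "Suc i" j] assms(3)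
  by (simp add: flow_Suc)

text \<open>Induction through the south-west cell of the box. If the chain uses it, this elbow joint
  accounts for one unit of flow; otherwise the chain misses the bottom row or the leftmost column,
  as cells in one and in the other would be incomparable.\<close>

lemma ne_set_le_flow:
  assumes lab: "labeling D t r"
  shows "\<lbrakk>j \<le> J; ne_set S; S \<subseteq> {1..i} \<times> {Suc j..J} - D\<rbrakk> \<Longrightarrow> card S \<le> flow r J i j"
proof (induction "i + (J - j)" arbitrary: i j S rule: less_induct)
  case less
  show ?case
  proof (cases "i = 0 \<or> j = J")
    case True
    then have "S = {}" using less.prems by auto
    then show ?thesis by simp
  next
    case False
    then obtain i' where i: "i = Suc i'" and j: "j < J" using less.prems(1) by (cases i) auto
    define x where "x = (Suc i', Suc j)"
    have rel: "north_east_of y z \<or> north_east_of z y" if "y \<in> S" "z \<in> S" "y \<noteq> z" for y z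
      using less.prems(2) that by (auto simp: ne_set_def)
    have sub: "fst y \<ge> 1 \<and> fst y \<le> i \<and> Suc j \<le> snd y \<and> snd y \<le> J \<and> y \<notin> D" if "y \<in> S" for y
      using less.prems(3) that by auto
    show ?thesis
    proof (cases "x \<in> S")
      case True
      have "S - {x} \<subseteq> {1..i'} \<times> {Suc (Suc j)..J} - D"
      proof
        fix y assume "y \<in> S - {x}"
        then have "north_east_of y x" and s: "fst y \<ge> 1" "snd y \<le> J" "y \<notin> D"
          using rel[of y x] True sub[of y] by (auto simp: north_east_of_def x_def i)
        then show "y \<in> {1..i'} \<times> {Suc (Suc j)..J} - D"
          by (cases y) (auto simp: north_east_of_def x_def)
      qed
      then have "card (S - {x}) \<le> flow r J i' (Suc j)"
        using less.prems i j by (intro less.hyps) (auto intro: ne_set_subset)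
      moreover have "card S = Suc (card (S - {x}))"
        using True less.prems(2) by (metis card_Suc_Diff1 ne_set_def)
      ultimately show ?thesis
        using flow_elbow[OF lab j, of i'] sub[OF True] by (simp add: i x_def)
    next
      case False
      have "S \<subseteq> {1..i'} \<times> {Suc j..J} - D \<or> S \<subseteq> {1..i} \<times> {Suc (Suc j)..J} - D"
      proof (rule ccontr)
        assume "\<not> ?thesis"
        then obtain y z where y: "y \<in> S" "y \<notin> {1..i'} \<times> {Suc j..J} - D"
          and z: "z \<in> S" "z \<notin> {1..i} \<times> {Suc (Suc j)..J} - D" by blast
        have "fst y = i" using sub[OF y(1)] y(2) by (cases y) (auto simp: i)
        moreover have "snd z = Suc j" using sub[OF z(1)] z(2) by (cases z) auto
        ultimately show False
          using rel[OF y(1) z(1)] sub[OF y(1)] sub[OF z(1)] False y z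
          by (cases "y = z"; cases y; cases z) (auto simp: north_east_of_def x_def i)
      qed
      then show ?thesis
      proof
        assume "S \<subseteq> {1..i'} \<times> {Suc j..J} - D"
        then have "card S \<le> flow r J i' j" using less.prems i j by (intro less.hyps) auto
        then show ?thesis by (simp add: i flow_Suc)
      next
        assume "S \<subseteq> {1..i} \<times> {Suc (Suc j)..J} - D"
        then have "card S \<le> flow r J i (Suc j)" using less.prems i j by (intro less.hyps) auto
        then show ?thesis using flow_column[OF lab j, of i] by (auto split: if_splits)
      qed
    qed
  qed
qed

text \<open>If the south-west cell is a cross with labels \<open>p < q\<close>, its column (for
  \<open>q \<le> J\<close>) or its row (for \<open>J < q\<close>) can be removed without changing
  the flow. For \<open>q \<le> J < p\<close> either removal would lose a unit; this is where the
  order of the labels enters.\<close>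

lemma flow_attained:
  assumes lab: "labeling D t r"
  shows "\<lbrakk>j \<le> J; \<And>a b. (a, b) \<in> D \<Longrightarrow> a \<le> i \<Longrightarrow> j < b \<Longrightarrow> b \<le> J \<Longrightarrow> t a b < r a b\<rbrakk> \<Longrightarrow>
    \<exists>S. ne_set S \<and> S \<subseteq> {1..i} \<times> {Suc j..J} - D \<and> card S = flow r J i j"
proof (induction "i + (J - j)" arbitrary: i j rule: less_induct)
  case less
  show ?case
  proof (cases "i = 0 \<or> j = J")
    case True
    then show ?thesis using flow_last[OF lab] by (intro exI[of _ "{}"]) auto
  next
    case False
    then obtain i' where i: "i = Suc i'" and j: "j < J" using less.prems(1) by (cases i) auto
    have up: "\<exists>S. ne_set S \<and> S \<subseteq> {1..i'} \<times> {Suc j..J} - D \<and> card S = flow r J i' j"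
      using less.prems i j by (intro less.hyps) auto
    have right: "\<exists>S. ne_set S \<and> S \<subseteq> {1..i} \<times> {Suc (Suc j)..J} - D \<and> card S = flow r J i (Suc j)"
      using less.prems i j by (intro less.hyps) auto
    show ?thesis
    proof (cases "(i, Suc j) \<in> D")
      case False
      have "\<exists>S. ne_set S \<and> S \<subseteq> {1..i'} \<times> {Suc (Suc j)..J} - D \<and> card S = flow r J i' (Suc j)"
        using less.prems i j by (intro less.hyps) auto
      then obtain S where S: "ne_set S" "S \<subseteq> {1..i'} \<times> {Suc (Suc j)..J} - D"
        "card S = flow r J i' (Suc j)"
        by blast
      have ne: "north_east_of y z" if "y \<in> S" "z \<in> {(i, Suc j)}" for y z
        using S(2) that by (auto simp: north_east_of_def i)
      show ?thesis
        using ne_set_Un[OF S(1) ne_set_cell ne] S False j flow_elbow[OF lab j, of i']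
        by (intro exI[of _ "S \<union> {(i, Suc j)}"]) (auto simp: i)
    next
      case True
      define p q where "p = t i (Suc j)" and "q = r i (Suc j)"
      have "p < q" using less.prems(2)[OF True] j by (simp add: p_def q_def)
      have q: "r i j = q" using labelingD(2)[OF lab, of i j] True by (simp add: q_def i)
      show ?thesis
      proof (cases "q \<le> J")
        case True
        then have "flow r J i j = flow r J i (Suc j)"
          using flow_column[OF lab j, of i'] \<open>p < q\<close> q unfolding i flow_Suc p_def q_def by simp
        moreover have "{1..i} \<times> {Suc (Suc j)..J} \<subseteq> {1..i} \<times> {Suc j..J}" by auto
        ultimately show ?thesis using ne_set_wider[OF right] by simp
      next
        case False
        then have "flow r J i j = flow r J i' j" using q by (simp add: i flow_Suc)
        moreover have "{1..i'} \<times> {Suc j..J} \<subseteq> {1..i} \<times> {Suc j..J}" by (auto simp: i)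
        ultimately show ?thesis using ne_set_wider[OF up] by simp
      qed
    qed
  qed
qed

text \<open>
  The first cross, in reading order, that repeats a crossing is redundant: the part of a chain
  north-east of it, lengthened by one cell, can be rerouted through the rows above or the columns to
  the right, because there flows count chains.
\<close>

lemma redundant_cross:
  assumes lab: "labeling D t r" and D: "pipe_dream D" and "\<not> reduced D"
  obtains x where "x \<in> D"
    and "\<And>S i J. ne_set S \<Longrightarrow> S \<subseteq> {1..i} \<times> {1..J} - (D - {x}) \<Longrightarrow>
      \<exists>S'. ne_set S' \<and> S' \<subseteq> {1..i} \<times> {1..J} - D \<and> card S' = card S"
proof -
  define B where "B = {(i, j) \<in> D. \<not> t i j < r i j}"
  have B: "finite B" "B \<noteq> {}"
    using D assms(3) reduced_iff_labels(1)[OF lab D]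
      by (auto simp: B_def pipe_dream_def intro: finite_subset)
  define a where "a = Min (fst ` B)"
  have a: "a \<in> fst ` B" "\<And>y. y \<in> B \<Longrightarrow> a \<le> fst y" using B by (auto simp: a_def)
  define C where "C = {b. (a, b) \<in> B}"
  have "C \<subseteq> snd ` B" by (force simp: C_def)
  then have C: "finite C" "C \<noteq> {}" using B a(1) finite_subset by (auto simp: C_def)
  define b where "b = Max C"
  have b: "b \<in> C" "\<And>y. y \<in> C \<Longrightarrow> y \<le> b" using C by (auto simp: b_def)
  have x: "(a, b) \<in> D" "\<not> t a b < r a b" using b(1) by (auto simp: C_def B_def)
  then have ab: "a \<ge> 1" "b \<ge> 1" using D by (auto simp: pipe_dream_def grid_def)
  then obtain i' j where i': "a = Suc i'" and j: "b = Suc j" by (metis Suc_le_D One_nat_def)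
  have good: "t a' b' < r a' b'" if "(a', b') \<in> D" "a' < a \<or> a' = a \<and> b' > b" for a' b'
  proof (rule ccontr)
    assume "\<not> t a' b' < r a' b'"
    then have "(a', b') \<in> B" using that by (simp add: B_def)
    then show False using that a(2)[of "(a', b')"] b(2)[of b'] by (auto simp: C_def)
  qed
  have pq: "r a b < t a b" using x(2) labeling_pos(3)[OF lab D ab] by linarith
  have q: "r a j = r a b" using labelingD(2)[OF lab ab(1), of j] x(1) by (simp add: j)
  \<comment> \<open>At \<open>(a, b)\<close> the pipe from above has the larger label. If it starts
    by column \<open>J\<close>, so does the other one, and row \<open>a\<close> adds one to the flow
    right of column \<open>b\<close>. Otherwise no counted pipe descends from column
    \<open>b\<close> into row \<open>a\<close>, and the flow to its left in the rows above is one
    larger. Both flows are realized by chains, since the crosses involved are read earlier.\<close>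
  have key: "\<exists>T. ne_set T \<and> T \<subseteq> {1..a} \<times> {b..J} - D \<and> card T = flow r J i' b + 1" if "b \<le> J" for J
  proof (cases "t a b \<le> J")
    case True
    then have "flow r J a b = flow r J i' b + 1" using pq by (simp add: i' flow_Suc)
    moreover have "\<exists>T. ne_set T \<and> T \<subseteq> {1..a} \<times> {Suc b..J} - D \<and> card T = flow r J a b"
      using that by (intro flow_attained[OF lab] good) auto
    moreover have "{1..a} \<times> {Suc b..J} \<subseteq> {1..a} \<times> {b..J}" by auto
    ultimately show ?thesis using ne_set_wider by simp
  next
    case False
    then have "flow r J i' j = flow r J i' b + 1"
      using flow_column[OF lab, of j J i'] that by (simp add: i' j)
    moreover have "\<exists>T. ne_set T \<and> T \<subseteq> {1..i'} \<times> {Suc j..J} - D \<and> card T = flow r J i' j"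
      using that by (intro flow_attained[OF lab] good) (auto simp: j i')
    moreover have "{1..i'} \<times> {Suc j..J} \<subseteq> {1..a} \<times> {b..J}" by (auto simp: i' j)
    ultimately show ?thesis using ne_set_wider by simp
  qed
  show ?thesis
  proof (rule that[OF x(1)])
    fix S i J
    assume S: "ne_set S" "S \<subseteq> {1..i} \<times> {1..J} - (D - {(a, b)})"
    show "\<exists>S'. ne_set S' \<and> S' \<subseteq> {1..i} \<times> {1..J} - D \<and> card S' = card S"
    proof (cases "(a, b) \<in> S")
      case False
      then show ?thesis using S by blast
    next
      case True
      define S1 S2 where "S1 = {y \<in> S. north_east_of y (a, b)}"
        and "S2 = {y \<in> S. north_east_of (a, b) y}"
      have aJ: "a \<le> i" "b \<le> J" using True S by auto
      have S_eq: "S = S1 \<union> ({(a, b)} \<union> S2)"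
        using S(1) True by (auto simp: S1_def S2_def ne_set_def)
      have s12: "ne_set S1" "ne_set S2" using S(1)
        by (auto intro: ne_set_subset simp: S1_def S2_def)
      have n2: "north_east_of y z" if "y \<in> {(a, b)}" "z \<in> S2" for y z using that
        by (auto simp: S2_def)
      have n1: "north_east_of y z" if "y \<in> S1" "z \<in> {(a, b)} \<union> S2" for y z
        using that by (auto simp: S1_def S2_def north_east_of_def)
      have card: "card S = card S1 + 1 + card S2"
        unfolding S_eq using ne_set_Un[OF s12(1) ne_set_Un(1)[OF ne_set_cell s12(2) n2] n1]
          ne_set_Un(2)[OF ne_set_cell s12(2) n2] by simp
      have "S1 \<subseteq> {1..i'} \<times> {Suc b..J} - D"
        using S(2) by (fastforce simp: S1_def north_east_of_def i')
      then have "card S1 \<le> flow r J i' b" using ne_set_le_flow[OF lab] s12(1) aJ by blast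
      moreover obtain T where T: "ne_set T" "T \<subseteq> {1..a} \<times> {b..J} - D" "card T = flow r J i' b + 1"
        using key aJ by blast
      ultimately obtain T' where T': "T' \<subseteq> T" "ne_set T'" "card T' = card S1 + 1"
        using ne_set_card_subset[OF T(1), of "card S1 + 1"] by auto
      have n3: "north_east_of y z" if "y \<in> T'" "z \<in> S2" for y z
        using that T'(1) T(2) by (auto simp: S2_def north_east_of_def)
      have "T' \<union> S2 \<subseteq> {1..i} \<times> {1..J} - D"
      proof
        fix y assume "y \<in> T' \<union> S2"
        then show "y \<in> {1..i} \<times> {1..J} - D"
        proof
          assume "y \<in> T'"
          then show ?thesis using T' T aJ ab by force
        next
          assume "y \<in> S2"
          then have "y \<in> S" "y \<noteq> (a, b)" by (auto simp: S2_def north_east_of_def)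
          then show ?thesis using S(2) by blast
        qed
      qed
      then show ?thesis using ne_set_Un[OF T'(2) s12(2) n3] T' card by auto
    qed
  qed
qed

section \<open>Moon polyominoes and their largest rectangles\<close>

text \<open>The axioms are inherited by \<open>erosion\<close> and by \<open>flip\<close>, so that
  results can be applied to these shapes as well. \<open>corner\<close> is the comparability of two
  columns, expressed by single cells.\<close>

locale moon_shape =
  fixes M :: "cell set"
  assumes finite_M: "finite M" and M_grid: "M \<subseteq> grid"
    and row_convex: "\<And>i j j' l. (i, j) \<in> M \<Longrightarrow> (i, j') \<in> M \<Longrightarrow> j \<le> l \<Longrightarrow> l \<le> j' \<Longrightarrow> (i, l) \<in> M"
    and col_convex: "\<And>i i' j l. (i, j) \<in> M \<Longrightarrow> (i', j) \<in> M \<Longrightarrow> i \<le> l \<Longrightarrow> l \<le> i' \<Longrightarrow> (l, j) \<in> M"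
    and corner: "\<And>i j i' j'. (i, j) \<in> M \<Longrightarrow> (i', j') \<in> M \<Longrightarrow> (i, j') \<in> M \<or> (i', j) \<in> M"

definition largest_rectangle :: "cell set \<Rightarrow> nat \<Rightarrow> nat \<Rightarrow> nat \<Rightarrow> nat \<Rightarrow> bool" where
  "largest_rectangle M a b c d \<longleftrightarrow> a \<le> b \<and> c \<le> d \<and> {a..b} \<times> {c..d} \<subseteq> M \<and>
     (\<forall>a' b' c' d'. a' \<le> a \<longrightarrow> b \<le> b' \<longrightarrow> c' \<le> c \<longrightarrow> d \<le> d' \<longrightarrow> {a'..b'} \<times> {c'..d'} \<subseteq> M \<longrightarrow>
        a' = a \<and> b' = b \<and> c' = c \<and> d' = d)"

definition chain_free :: "cell set \<Rightarrow> nat \<Rightarrow> pipe_dream \<Rightarrow> bool" where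
  "chain_free M k D \<longleftrightarrow> D \<subseteq> M \<and>
     (\<forall>a b c d S. {a..b} \<times> {c..d} \<subseteq> M \<longrightarrow> ne_set S \<longrightarrow> S \<subseteq> {a..b} \<times> {c..d} - D \<longrightarrow> card S \<le> k)"

text \<open>These are the complements of the facets of a simplicial complex whose faces are the sets
  of ones without a long chain. Deleting single cells tests minimality, because enlarging a
  chain-free set of zeros inside \<open>M\<close> keeps it chain-free.\<close>

definition facets :: "cell set \<Rightarrow> nat \<Rightarrow> pipe_dream set" where
  "facets M k = {D. chain_free M k D \<and> (\<forall>x\<in>D. \<not> chain_free M k (D - {x}))}"

text \<open>
  The zeros of \<open>D_top\<close>. For \<open>j \<le> k\<close> the truncated \<open>j - k\<close> is \<open>0\<close>, so that the square is not
  contained in any subset of the grid.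
\<close>

definition erosion :: "cell set \<Rightarrow> nat \<Rightarrow> cell set" where
  "erosion M k = {(i, j). {i..i + k} \<times> {j - k..j} \<subseteq> M}"

lemma ne_set_sequence:
  assumes "\<And>s t. s < t \<Longrightarrow> t < n \<Longrightarrow> f t < f s \<and> g s < g t"
  shows "ne_set ((\<lambda>t. (f t, g t)) ` {..<n})" and "card ((\<lambda>t. (f t, g t)) ` {..<n}) = n"
proof -
  have "north_east_of (f s, g s) (f t, g t) \<or> north_east_of (f t, g t) (f s, g s)"
    if "s < n" "t < n" "s \<noteq> t" for s t
    using assms[of s t] assms[of t s] that by (auto simp: north_east_of_def neq_iff)
  then show "ne_set ((\<lambda>t. (f t, g t)) ` {..<n})" by (auto simp: ne_set_def)
  have "inj_on (\<lambda>t. (f t, g t)) {..<n}"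
    using assms by (intro inj_onI) (metis lessThan_iff less_irrefl nat_neq_iff prod.inject)
  then show "card ((\<lambda>t. (f t, g t)) ` {..<n}) = n" by (simp add: card_image)
qed

lemma ne_set_card_box:
  assumes "ne_set S" and "S \<subseteq> {a..b} \<times> {c..d}"
  shows "card S \<le> Suc b - a" and "card S \<le> Suc d - c"
proof -
  have "card (fst ` S) \<le> card {a..b}" using assms by (intro card_mono) auto
  moreover have "card (snd ` S) \<le> card {c..d}" using assms by (intro card_mono) auto
  ultimately show "card S \<le> Suc b - a" "card S \<le> Suc d - c"
    using ne_set_inj[OF assms(1)] by (simp_all add: card_image)
qed

text \<open>No two cells of a chain can lie one above the rectangle and the other to the right of it but
  not above it, as the first would be north-west of the second.\<close>

lemma ne_set_card_rectangle:
  assumes S: "ne_set S" "S \<subseteq> {1..i} \<times> {1..j}" and k: "card (S \<inter> {a..b} \<times> {c..d}) \<le> k"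
  shows "card S \<le> k + max (a - 1) (j - d) + max (c - 1) (i - b)"
proof -
  have fin: "finite S" using S by (simp add: ne_set_def)
  define P Q where "P = {x \<in> S. fst x < a \<or> d < snd x}" and "Q = {x \<in> S. b < fst x \<or> snd x < c}"
  have sub: "1 \<le> fst x \<and> fst x \<le> i \<and> 1 \<le> snd x \<and> snd x \<le> j" if "x \<in> S" for x using S(2) that by auto
  have rel: "fst x < fst y \<longleftrightarrow> snd y < snd x" if "x \<in> S" "y \<in> S" for x y
    using S(1) that unfolding ne_set_def north_east_of_def by (metis less_asym)
  have "card P \<le> max (a - 1) (j - d)"
  proof -
    have "P \<subseteq> {1..a - 1} \<times> {1..j} \<or> P \<subseteq> {1..i} \<times> {Suc d..j}"
    proof (rule ccontr)
      assume "\<not> ?thesis"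
      then obtain y z where y: "y \<in> P" "y \<notin> {1..a - 1} \<times> {1..j}"
        and z: "z \<in> P" "z \<notin> {1..i} \<times> {Suc d..j}" by blast
      have "a \<le> fst y" "d < snd y" using y sub[of y] by (cases y; auto simp: P_def)+
      moreover have "snd z \<le> d" "fst z < a" using z sub[of z] by (cases z; auto simp: P_def)+
      ultimately show False using rel[of z y] y z by (auto simp: P_def)
    qed
    moreover have "ne_set P" using S(1) by (rule ne_set_subset) (auto simp: P_def)
    ultimately show ?thesis
      using ne_set_card_box(1)[of P 1 "a - 1" 1 j] ne_set_card_box(2)[of P 1 i "Suc d" j] by auto
  qed
  moreover have "card Q \<le> max (c - 1) (i - b)"
  proof -
    have "Q \<subseteq> {1..i} \<times> {1..c - 1} \<or> Q \<subseteq> {Suc b..i} \<times> {1..j}"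
    proof (rule ccontr)
      assume "\<not> ?thesis"
      then obtain y z where y: "y \<in> Q" "y \<notin> {1..i} \<times> {1..c - 1}"
        and z: "z \<in> Q" "z \<notin> {Suc b..i} \<times> {1..j}" by blast
      have "c \<le> snd y" "b < fst y" using y sub[of y] by (cases y; auto simp: Q_def)+
      moreover have "fst z \<le> b" "snd z < c" using z sub[of z] by (cases z; auto simp: Q_def)+
      ultimately show False using rel[of z y] y z by (auto simp: Q_def)
    qed
    moreover have "ne_set Q" using S(1) by (rule ne_set_subset) (auto simp: Q_def)
    ultimately show ?thesis
      using ne_set_card_box(2)[of Q 1 i 1 "c - 1"] ne_set_card_box(1)[of Q "Suc b" i 1 j] by auto
  qed
  moreover have "card S \<le> card ((S \<inter> {a..b} \<times> {c..d}) \<union> (P \<union> Q))"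
    using fin by (intro card_mono) (auto simp: P_def Q_def)
  moreover have "card ((S \<inter> {a..b} \<times> {c..d}) \<union> (P \<union> Q)) \<le> card (S \<inter> {a..b} \<times> {c..d}) + (card P + card Q)"
    by (meson add_left_mono card_Un_le order_trans)
  ultimately show ?thesis using k by linarith
qed

section \<open>Geometry of a moon polyomino and of its erosion\<close>

context moon_shape
begin

lemma M_pos: "(i, j) \<in> M \<Longrightarrow> 1 \<le> i \<and> 1 \<le> j"
  using M_grid by (auto simp: grid_def)

lemma rectangle_in_M:
  assumes "(a, c) \<in> M" and "(a, d) \<in> M" and "(b, c) \<in> M" and "(b, d) \<in> M"
  shows "{a..b} \<times> {c..d} \<subseteq> M"
proof
  fix x assume "x \<in> {a..b} \<times> {c..d}"
  then obtain i j where x: "x = (i, j)" "a \<le> i" "i \<le> b" "c \<le> j" "j \<le> d" by auto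
  then show "x \<in> M" using assms row_convex[of _ c d j] col_convex[of a j b i] by blast
qed

lemma largest_rectangle_exists:
  assumes "{a..b} \<times> {c..d} \<subseteq> M" and "a \<le> b" and "c \<le> d"
  obtains a' b' c' d' where "largest_rectangle M a' b' c' d'"
    and "a' \<le> a" "b \<le> b'" "c' \<le> c" "d \<le> d'"
proof -
  define A where "A = {R \<in> Pow M. \<exists>a b c d. R = {a..b} \<times> {c..d}}"
  have "finite A" using finite_M by (simp add: A_def)
  moreover have "{a..b} \<times> {c..d} \<in> A" using assms by (auto simp: A_def)
  ultimately obtain R where R: "R \<in> A" "{a..b} \<times> {c..d} \<subseteq> R" "\<And>R'. R' \<in> A \<Longrightarrow> R \<subseteq> R' \<Longrightarrow> R = R'"
    using finite_has_maximal2[of A "{a..b} \<times> {c..d}"] by auto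
  then obtain a' b' c' d' where R': "R = {a'..b'} \<times> {c'..d'}" "R \<subseteq> M" by (auto simp: A_def)
  have ac: "(a, c) \<in> R" "(b, d) \<in> R" using R(2) assms by auto
  have "largest_rectangle M a' b' c' d'"
    unfolding largest_rectangle_def
  proof (intro conjI allI impI)
    show "a' \<le> b'" "c' \<le> d'" using ac R' by auto
    show "{a'..b'} \<times> {c'..d'} \<subseteq> M" using R' by simp
  next
    fix a2 b2 c2 d2
    assume *: "a2 \<le> a'" "b' \<le> b2" "c2 \<le> c'" "d' \<le> d2" "{a2..b2} \<times> {c2..d2} \<subseteq> M"
    then have "{a2..b2} \<times> {c2..d2} \<in> A" "R \<subseteq> {a2..b2} \<times> {c2..d2}" using R' by (auto simp: A_def)
    then have "{a'..b'} \<times> {c'..d'} = {a2..b2} \<times> {c2..d2}" using R R' by blast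
    then have "{a'..b'} = {a2..b2}" "{c'..d'} = {c2..d2}" using ac R' by (auto simp: times_eq_iff)
    moreover have "a' \<le> b'" "c' \<le> d'" using ac R' by auto
    ultimately show "a2 = a'" "b2 = b'" "c2 = c'" "d2 = d'" by (auto simp: Icc_eq_Icc)
  qed
  then show ?thesis using that ac R' by auto
qed

text \<open>By \<open>corner\<close> and convexity, a cell of \<open>M\<close> diagonally outside
  would let the rectangle grow by rows or by columns.\<close>

lemma largest_rectangle_quadrants:
  assumes "largest_rectangle M a b c d" and "(i, j) \<in> M"
  shows "\<not> (i < a \<and> d < j)" and "\<not> (b < i \<and> j < c)"
proof -
  have ab: "a \<le> b" "c \<le> d" and R: "{a..b} \<times> {c..d} \<subseteq> M"
    and max: "\<And>a' b' c' d'. a' \<le> a \<Longrightarrow> b \<le> b' \<Longrightarrow> c' \<le> c \<Longrightarrow> d \<le> d' \<Longrightarrow> {a'..b'} \<times> {c'..d'} \<subseteq> M \<Longrightarrow>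
        a' = a \<and> b' = b \<and> c' = c \<and> d' = d"
    using assms(1) unfolding largest_rectangle_def by blast+
  have c4: "(a, c) \<in> M" "(a, d) \<in> M" "(b, c) \<in> M" "(b, d) \<in> M" using R ab by auto
  show "\<not> (i < a \<and> d < j)"
  proof
    assume ij: "i < a \<and> d < j"
    show False
    proof (cases "(i, c) \<in> M")
      case True
      then have "(i, d) \<in> M" using row_convex[OF True assms(2), of d] ij ab by auto
      then show False using max[of i b c d] rectangle_in_M[OF True _ c4(3,4)] ij by auto
    next
      case False
      then have "(a, j) \<in> M" "(b, j) \<in> M"
        using corner[OF assms(2) c4(1)] corner[OF assms(2) c4(3)] by auto
      then show False using max[of a b c j] rectangle_in_M[OF c4(1) _ c4(3)] ij by auto
    qed
  qed
  show "\<not> (b < i \<and> j < c)"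
  proof
    assume ij: "b < i \<and> j < c"
    show False
    proof (cases "(i, d) \<in> M")
      case True
      then have "(i, c) \<in> M" using row_convex[OF assms(2) True, of c] ij ab by auto
      then show False using max[of a i c d] rectangle_in_M[OF c4(1,2) _ True] ij by auto
    next
      case False
      then have "(a, j) \<in> M" "(b, j) \<in> M"
        using corner[OF assms(2) c4(2)] corner[OF assms(2) c4(4)] by auto
      then show False using max[of a b j d] rectangle_in_M[OF _ c4(2) _ c4(4)] ij by auto
    qed
  qed
qed

lemma erosion_moon: "moon_shape (erosion M k)"
proof
  have sub: "erosion M k \<subseteq> M" by (fastforce simp: erosion_def)
  then show "finite (erosion M k)" "erosion M k \<subseteq> grid" using finite_M M_grid finite_subset by auto
next
  fix i j j' l assume a: "(i, j) \<in> erosion M k" "(i, j') \<in> erosion M k" "j \<le> l" "l \<le> j'"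
  show "(i, l) \<in> erosion M k"
    unfolding erosion_def mem_Collect_eq prod.case
  proof
    fix y assume "y \<in> {i..i + k} \<times> {l - k..l}"
    then obtain u v where y: "y = (u, v)" "u \<in> {i..i + k}" "l - k \<le> v" "v \<le> l" by auto
    have "(u, j - k) \<in> M" "(u, j') \<in> M" using a y by (auto simp: erosion_def)
    moreover have "j - k \<le> v" "v \<le> j'" using a y by auto
    ultimately show "y \<in> M" using row_convex y by blast
  qed
next
  fix i i' j l assume a: "(i, j) \<in> erosion M k" "(i', j) \<in> erosion M k" "i \<le> l" "l \<le> i'"
  show "(l, j) \<in> erosion M k"
    unfolding erosion_def mem_Collect_eq prod.case
  proof
    fix y assume "y \<in> {l..l + k} \<times> {j - k..j}"
    then obtain u v where y: "y = (u, v)" "v \<in> {j - k..j}" "l \<le> u" "u \<le> l + k" by auto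
    have "(i, v) \<in> M" "(i' + k, v) \<in> M" using a y by (auto simp: erosion_def)
    moreover have "i \<le> u" "u \<le> i' + k" using a y by auto
    ultimately show "y \<in> M" using col_convex y by blast
  qed
next
  fix i j i' j' assume a: "(i, j) \<in> erosion M k" "(i', j') \<in> erosion M k"
  show "(i, j') \<in> erosion M k \<or> (i', j) \<in> erosion M k"
  proof (rule ccontr)
    assume "\<not> ?thesis"
    \<comment> \<open>The missing cells \<open>(u, v)\<close> and \<open>(u', v')\<close> belong to
      the two mixed squares, while \<open>(u, v')\<close> and \<open>(u', v)\<close> belong to the
      two given ones, so \<open>corner\<close> for \<open>M\<close> gives a contradiction.\<close>
    then obtain u v u' v' where u: "u \<in> {i..i + k}" "v \<in> {j' - k..j'}" "(u, v) \<notin> M"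
      and u': "u' \<in> {i'..i' + k}" "v' \<in> {j - k..j}" "(u', v') \<notin> M" by (force simp: erosion_def)
    have "(u, v') \<in> M" "(u', v) \<in> M" using a u u' by (auto simp: erosion_def)
    then show False using corner u u' by blast
  qed
qed

text \<open>The topmost cell of a chain of more than \<open>k\<close> cells in a rectangle of
  \<open>M\<close> has \<open>k\<close> rows of the rectangle below it and \<open>k\<close> columns
  to its left, so its square lies in \<open>M\<close> and it is itself in the erosion.\<close>

lemma erosion_chain_free: "chain_free M k (erosion M k)"
  unfolding chain_free_def
proof (intro conjI allI impI)
  show "erosion M k \<subseteq> M" by (fastforce simp: erosion_def)
  fix a b c d S
  assume R: "{a..b} \<times> {c..d} \<subseteq> M" and S: "ne_set S" "S \<subseteq> {a..b} \<times> {c..d} - erosion M k"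
  show "card S \<le> k"
  proof (rule ccontr)
    assume "\<not> card S \<le> k"
    then have fin: "finite S" and "S \<noteq> {}" using S by (auto simp: ne_set_def)
    then have "Min (fst ` S) \<in> fst ` S" by simp
    then obtain x where x: "x \<in> S" "fst x = Min (fst ` S)" by auto
    have least: "fst x \<le> fst y" if "y \<in> S" for y using fin that x(2) by simp
    obtain i j where ij: "x = (i, j)" by (cases x)
    have "S \<subseteq> {i..b} \<times> {c..j}"
    proof
      fix y assume y: "y \<in> S"
      then have "y = x \<or> north_east_of x y"
        using S(1) x(1) least[of y] unfolding ne_set_def north_east_of_def by (metis leD)
      then show "y \<in> {i..b} \<times> {c..j}" using S(2) y x ij by (cases y) (force simp: north_east_of_def)
    qed
    then have "k < Suc b - i" "k < Suc j - c"
      using ne_set_card_box[OF S(1), of i b c j] \<open>\<not> card S \<le> k\<close> by linarith+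
    moreover have "a \<le> i" "j \<le> d" "x \<notin> erosion M k" using S(2) x ij by auto
    ultimately have "{i..i + k} \<times> {j - k..j} \<subseteq> {a..b} \<times> {c..d}" by auto
    then show False using R \<open>x \<notin> _\<close> ij by (auto simp: erosion_def)
  qed
qed

text \<open>The square of such a cell would contain \<open>(b + 1, c - 1)\<close>, south-west of the
  rectangle. The diagonal from the south-west corner thus supplies ones of the topmost
  filling.\<close>

lemma erosion_corner:
  assumes R: "largest_rectangle M a b c d" and "l < k"
  shows "(b - l, c + l) \<notin> erosion M k"
proof
  have "(a, c) \<in> M" using R by (auto simp: largest_rectangle_def)
  then have "1 \<le> c" using M_pos by blast
  assume "(b - l, c + l) \<in> erosion M k"
  then have "{b - l..b - l + k} \<times> {c + l - k..c + l} \<subseteq> M" by (simp add: erosion_def)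
  moreover have "(Suc b, c - 1) \<in> {b - l..b - l + k} \<times> {c + l - k..c + l}" using assms(2) by auto
  ultimately have "(Suc b, c - 1) \<in> M" by blast
  then show False using largest_rectangle_quadrants(2)[OF R] \<open>1 \<le> c\<close> by force
qed

lemma erosion_facet: "erosion M k \<in> facets M k"
  unfolding facets_def mem_Collect_eq
proof (intro conjI ballI)
  show "chain_free M k (erosion M k)" by (rule erosion_chain_free)
  fix x assume x: "x \<in> erosion M k"
  obtain i j where ij: "x = (i, j)" by (cases x)
  then have sq: "{i..i + k} \<times> {j - k..j} \<subseteq> M" using x by (simp add: erosion_def)
  obtain a b c d where R: "largest_rectangle M a b c d"
    and le: "a \<le> i" "i + k \<le> b" "c \<le> j - k" "j \<le> d"
    using sq by (rule largest_rectangle_exists) auto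
  have RM: "{a..b} \<times> {c..d} \<subseteq> M" and "a \<le> b" "c \<le> d" using R by (auto simp: largest_rectangle_def)
  then have "(a, c) \<in> M" by auto
  then have c1: "c \<ge> 1" using M_pos by blast
  \<comment> \<open>The chain that appears when \<open>x\<close> is deleted: \<open>k\<close> cells
    on the diagonal from the south-west corner of the rectangle, and \<open>x\<close> as the last
    one.\<close>
  define f g where "f l = (if l < k then b - l else i)" and "g l = (if l < k then c + l else j)"
    for l
  have jk: "c + k \<le> j" using le(3) c1 by linarith
  have fg: "f t < f s \<and> g s < g t" if "s < t" "t < Suc k" for s t
    using that le jk by (auto simp: f_def g_def)
  define S where "S = (\<lambda>l. (f l, g l)) ` {..<Suc k}"
  have S: "ne_set S" "card S = Suc k" unfolding S_def
    by (rule ne_set_sequence, rule fg, assumption+)+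
  have "S \<subseteq> {a..b} \<times> {c..d} - (erosion M k - {x})"
  proof
    fix y assume "y \<in> S"
    then obtain l where l: "l \<le> k" "y = (f l, g l)"
      by (auto simp: S_def less_Suc_eq_le)
    show "y \<in> {a..b} \<times> {c..d} - (erosion M k - {x})"
    proof (cases "l < k")
      case True
      have "y \<notin> erosion M k" using erosion_corner[OF R True] True l by (simp add: f_def g_def)
      then show ?thesis using True l le jk by (auto simp: f_def g_def)
    next
      case False
      then show ?thesis using l le jk ij by (auto simp: f_def g_def)
    qed
  qed
  then have "chain_free M k (erosion M k - {x}) \<Longrightarrow> card S \<le> k"
    using RM S(1) unfolding chain_free_def by blast
  then show "\<not> chain_free M k (erosion M k - {x})" using S(2) by auto
qed

text \<open>If every box \<open>{n-t..i-t} \<times> {t+1..j-n+t+1}\<close> has a corner outside \<open>M\<close>, such corners can be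
  chosen to form a chain: first lower left ones, then only upper left or only lower right
  ones, finally upper right ones.\<close>

lemma avoiding_chain:
  assumes n: "n \<le> i" "n \<le> j"
    and box: "\<And>t. t < n \<Longrightarrow> \<not> {n - t..i - t} \<times> {Suc t..j - n + t + 1} \<subseteq> M"
  obtains S where "ne_set S" and "S \<subseteq> {1..i} \<times> {1..j} - M" and "card S = n"
proof -
  note chain = that
  \<comment> \<open>The thresholds \<open>u\<close> and \<open>v\<close> say when the chosen corner
    changes from the lower to the upper row and from the left to the right column; every choice of
    thresholds gives a chain.\<close>
  define f where "f u t = (if t < u then i - t else n - t)" for u t :: nat
  define g where "g v t = (if t < v then Suc t else j - n + t + 1)" for v t :: nat
  have *: thesis if M: "\<And>t. t < n \<Longrightarrow> (f u t, g v t) \<notin> M" for u v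
  proof -
    define S where "S = (\<lambda>t. (f u t, g v t)) ` {..<n}"
    have "f u t < f u s \<and> g v s < g v t" if "s < t" "t < n" for s t
      using that n by (auto simp: f_def g_def)
    then have "ne_set S" "card S = n" unfolding S_def by (intro ne_set_sequence; blast)+
    moreover have "S \<subseteq> {1..i} \<times> {1..j} - M"
      using M n by (auto simp: S_def f_def g_def split: if_splits)
    ultimately show thesis by (intro chain)
  qed
  define A B where "A = {t. t < n \<and> (i - t, Suc t) \<in> M}"
    and "B = {t. t < n \<and> (n - t, j - n + t + 1) \<in> M}"
  have fin: "finite A" "finite B" by (auto simp: A_def B_def)
  show thesis
  proof (cases "\<exists>t0\<in>A. \<exists>t1\<in>B. t0 \<le> t1")
    case False
    define u where "u = (if A = {} then n else Min A)"
    have "(f u t, g u t) \<notin> M" if "t < n" for t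
    proof (cases "t < u")
      case True
      then have "t \<notin> A" using fin Min_le[of A t] by (auto simp: u_def split: if_splits)
      then show ?thesis using True that by (auto simp: A_def f_def g_def)
    next
      case ge: False
      then have "A \<noteq> {}" "u \<le> t" using that by (auto simp: u_def split: if_splits)
      then have "u \<in> A" using fin by (auto simp: u_def)
      then have "t \<notin> B" using False \<open>u \<le> t\<close> by blast
      then show ?thesis using ge that by (auto simp: B_def f_def g_def)
    qed
    then show thesis by (rule *)
  next
    case True
    define t0 t1 where "t0 = Min A" and "t1 = Max B"
    have ne: "A \<noteq> {}" "B \<noteq> {}" using True by auto
    have t01: "t0 \<in> A" "t1 \<in> B" using ne fin by (auto simp: t0_def t1_def)
    have "t0 \<le> t1" using True fin Min_le[of A] Max_ge[of B] unfolding t0_def t1_def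
      by (meson order_trans)
    have before: "t < n \<Longrightarrow> t < t0 \<Longrightarrow> (i - t, Suc t) \<notin> M" for t
    proof
      assume "t < n" "t < t0" "(i - t, Suc t) \<in> M"
      then have "t \<in> A" by (simp add: A_def)
      then show False using Min_le[OF fin(1), of t] \<open>t < t0\<close> by (simp add: t0_def)
    qed
    have after: "t < n \<Longrightarrow> t1 < t \<Longrightarrow> (n - t, j - n + t + 1) \<notin> M" for t
    proof
      assume "t < n" "t1 < t" "(n - t, j - n + t + 1) \<in> M"
      then have "t \<in> B" by (simp add: B_def)
      then show False using Max_ge[OF fin(2), of t] \<open>t1 < t\<close> by (simp add: t1_def)
    qed
    have lt: "t0 < n" "t1 < n" and sw: "(i - t0, Suc t0) \<in> M" and ne: "(n - t1, j - n + t1 + 1) \<in> M"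
      using t01 by (auto simp: A_def B_def)
    \<comment> \<open>\<open>t0\<close> is the first index whose lower left corner is in
      \<open>M\<close>, \<open>t1\<close> the last one whose upper right corner is. If the cell
      south-east of both is in \<open>M\<close>, no upper left corner in between can be; if the cell
      north-west of both is, no lower right corner can.\<close>
    from corner[OF sw ne] show thesis
    proof
      assume Q: "(i - t0, j - n + t1 + 1) \<in> M"
      have mid: "(n - t, Suc t) \<notin> M" if t: "t0 \<le> t" "t \<le> t1" for t
      proof
        assume nw: "(n - t, Suc t) \<in> M"
        have right: "(n - t, j - n + t1 + 1) \<in> M" using col_convex[OF ne Q, of "n - t"] t n lt
          by simp
        then have 1: "(n - t, j - n + t + 1) \<in> M"
          using row_convex[OF nw right, of "j - n + t + 1"] t by simp
        have "(i - t0, Suc t) \<in> M" using row_convex[OF sw Q, of "Suc t"] t by simp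
        then have 2: "(i - t, Suc t) \<in> M" using col_convex[OF nw, of "i - t0" "i - t"] t n by simp
        have "(i - t0, j - n + t + 1) \<in> M" using row_convex[OF sw Q, of "j - n + t + 1"] t by simp
        then have 3: "(i - t, j - n + t + 1) \<in> M" using col_convex[OF 1, of "i - t0" "i - t"] t n
          by simp
        show False using rectangle_in_M[OF nw 1 2 3] box[of t] t lt by simp
      qed
      have "(f t0 t, g (Suc t1) t) \<notin> M" if "t < n" for t
        using before[OF that] after[OF that] mid[of t] \<open>t0 \<le> t1\<close> by (auto simp: f_def g_def)
      then show thesis by (rule *)
    next
      assume P: "(n - t1, Suc t0) \<in> M"
      have mid: "(i - t, j - n + t + 1) \<notin> M" if t: "t0 \<le> t" "t \<le> t1" for t
      proof
        assume se: "(i - t, j - n + t + 1) \<in> M"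
        have "(n - t1, j - n + t + 1) \<in> M" using row_convex[OF P ne, of "j - n + t + 1"] t by simp
        then have 1: "(n - t, j - n + t + 1) \<in> M"
          using col_convex[OF _ se, of "n - t1" "n - t"] t n by simp
        have l: "(i - t, Suc t0) \<in> M" using col_convex[OF P sw, of "i - t"] t n lt by simp
        then have 2: "(i - t, Suc t) \<in> M" using row_convex[OF l se, of "Suc t"] t by simp
        have "(n - t1, Suc t) \<in> M" using row_convex[OF P ne, of "Suc t"] t by simp
        then have 3: "(n - t, Suc t) \<in> M" using col_convex[OF _ 2, of "n - t1" "n - t"] t n by simp
        show False using rectangle_in_M[OF 3 1 2 se] box[of t] t lt by simp
      qed
      have "(f (Suc t1) t, g t0 t) \<notin> M" if "t < n" for t
        using before[OF that] after[OF that] mid[of t] \<open>t0 \<le> t1\<close> by (auto simp: f_def g_def)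
      then show thesis by (rule *)
    qed
  qed
qed

text \<open>\<open>avoiding_chain\<close> is applied to the erosion: a box inside the erosion would
  yield a rectangle of \<open>M\<close> that bounds the length of \<open>S\<close> below its actual
  value.\<close>

lemma chain_free_box:
  assumes cf: "chain_free M k D" and S: "ne_set S" "S \<subseteq> {1..i} \<times> {1..j} - D"
  obtains S' where "ne_set S'" and "S' \<subseteq> {1..i} \<times> {1..j} - erosion M k" and "card S' = card S"
proof -
  interpret E: moon_shape "erosion M k" by (rule erosion_moon)
  define n where "n = card S"
  have Sb: "S \<subseteq> {1..i} \<times> {1..j}" using S by auto
  have n: "n \<le> i" "n \<le> j" using ne_set_card_box[OF S(1) Sb] by (auto simp: n_def)
  have "\<not> {n - t..i - t} \<times> {Suc t..j - n + t + 1} \<subseteq> erosion M k" if t: "t < n" for t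
  proof
    assume B: "{n - t..i - t} \<times> {Suc t..j - n + t + 1} \<subseteq> erosion M k"
    \<comment> \<open>Each cell of the thickened box lies in the square of the nearest cell
      \<open>(u', v')\<close> of the box.\<close>
    have R: "{n - t..i - t + k} \<times> {Suc t - k..j - n + t + 1} \<subseteq> M"
    proof
      fix y assume "y \<in> {n - t..i - t + k} \<times> {Suc t - k..j - n + t + 1}"
      then obtain u v where y: "y = (u, v)" "n - t \<le> u" "u \<le> i - t + k" "Suc t - k \<le> v"
        "v \<le> j - n + t + 1" by auto
      define u' v' where "u' = min u (i - t)" and "v' = max v (Suc t)"
      have "(u', v') \<in> erosion M k" using B y n t by (auto simp: u'_def v'_def)
      moreover have "u \<in> {u'..u' + k}" "v \<in> {v' - k..v'}" using y by (auto simp: u'_def v'_def)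
      ultimately show "y \<in> M" using y by (auto simp: erosion_def)
    qed
    have "(n - t, Suc t - k) \<in> {n - t..i - t + k} \<times> {Suc t - k..j - n + t + 1}" using n t by auto
    then have "(n - t, Suc t - k) \<in> M" using R by blast
    \<comment> \<open>Otherwise the truncated \<open>Suc t - k\<close> would be \<open>0\<close>, a
      column outside the grid; so this subtraction is exact.\<close>
    then have tk: "k \<le> t" using M_pos by fastforce
    have "card (S \<inter> {n - t..i - t + k} \<times> {Suc t - k..j - n + t + 1}) \<le> k"
    proof -
      have "ne_set (S \<inter> {n - t..i - t + k} \<times> {Suc t - k..j - n + t + 1})"
        using S(1) by (rule ne_set_subset) auto
      then show ?thesis using cf R S(2) unfolding chain_free_def by blast
    qed
    \<comment> \<open>In each maximum both terms agree, and the bound is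
      \<open>k + (n - t - 1) + (t - k) = n - 1\<close>.\<close>
    from ne_set_card_rectangle[OF S(1) Sb this] show False using n t tk by (simp add: n_def)
  qed
  from E.avoiding_chain[OF n this] show thesis using that unfolding n_def by blast
qed

lemma largest_rectangle_chain:
  assumes R: "largest_rectangle M a b c d" and D: "D \<subseteq> M"
    and S: "ne_set S" "S \<subseteq> {a..b} \<times> {c..d} - D"
  obtains S' where "ne_set S'" and "S' \<subseteq> {1..b + c - 1} \<times> {1..d + a - 1} - D"
    and "card S' = card S + (a - 1) + (c - 1)"
proof -
  have ab: "a \<le> b" "c \<le> d" and RM: "{a..b} \<times> {c..d} \<subseteq> M" using R
    by (auto simp: largest_rectangle_def)
  then have "(a, c) \<in> M" by auto
  then have ac: "1 \<le> a" "1 \<le> c" using M_pos by blast+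
  define N where "N = (\<lambda>t. (a - 1 - t, Suc d + t)) ` {..<a - 1}"
  define W where "W = (\<lambda>t. (b + c - 1 - t, Suc t)) ` {..<c - 1}"
  have N: "ne_set N" "card N = a - 1" unfolding N_def by (rule ne_set_sequence; auto)+
  have W: "ne_set W" "card W = c - 1" unfolding W_def by (rule ne_set_sequence; auto)+
  have sub: "a \<le> fst x \<and> fst x \<le> b \<and> c \<le> snd x \<and> snd x \<le> d" if "x \<in> S" for x using S that by auto
  have 1: "north_east_of x y" if "x \<in> S" "y \<in> W" for x y
    using sub[OF that(1)] that(2) by (auto simp: W_def north_east_of_def)
  have 2: "north_east_of x y" if "x \<in> N" "y \<in> S \<union> W" for x y
    using that ab by (auto simp: N_def W_def north_east_of_def dest: sub)
  have "N \<subseteq> {1..b + c - 1} \<times> {1..d + a - 1} - D"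
    using ab ac D largest_rectangle_quadrants(1)[OF R] by (fastforce simp: N_def)
  moreover have "W \<subseteq> {1..b + c - 1} \<times> {1..d + a - 1} - D"
    using ab ac D largest_rectangle_quadrants(2)[OF R] by (fastforce simp: W_def)
  moreover have "S \<subseteq> {1..b + c - 1} \<times> {1..d + a - 1} - D"
    using S(2) ac by fastforce
  ultimately have "N \<union> (S \<union> W) \<subseteq> {1..b + c - 1} \<times> {1..d + a - 1} - D" by blast
  moreover have "ne_set (N \<union> (S \<union> W))" "card (N \<union> (S \<union> W)) = card S + (a - 1) + (c - 1)"
    using ne_set_Un[OF N(1) ne_set_Un(1)[OF S(1) W(1) 1] 2] ne_set_Un(2)[OF S(1) W(1) 1] N W by auto
  ultimately show thesis by (intro that)
qed

text \<open>For this box the two terms of each maximum in \<open>ne_set_card_rectangle\<close>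
  coincide. The result is exactly \<open>k\<close> plus the cells that
  \<open>largest_rectangle_chain\<close> adds, so the box detects the bound
  \<open>k\<close>.\<close>

lemma erosion_box_card:
  assumes R: "largest_rectangle M a b c d" and cf: "chain_free M k D"
    and S: "ne_set S" "S \<subseteq> {1..b + c - 1} \<times> {1..d + a - 1} - D"
  shows "card S \<le> k + (a - 1) + (c - 1)"
proof -
  have RM: "{a..b} \<times> {c..d} \<subseteq> M" and ab: "a \<le> b" "c \<le> d" using R
    by (auto simp: largest_rectangle_def)
  have "ne_set (S \<inter> {a..b} \<times> {c..d})" using S(1) by (rule ne_set_subset) auto
  then have "card (S \<inter> {a..b} \<times> {c..d}) \<le> k" using cf RM S(2) unfolding chain_free_def by blast
  moreover have "S \<subseteq> {1..b + c - 1} \<times> {1..d + a - 1}" using S by auto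
  ultimately have "card S \<le> k + max (a - 1) (d + a - 1 - d) + max (c - 1) (b + c - 1 - b)"
    using ne_set_card_rectangle S(1) by blast
  then show ?thesis using ab by auto
qed

text \<open>From boxes back to rectangles: a chain of a largest rectangle is lengthened into the
  anchored box, exchanged for one avoiding the erosion, and bounded there.\<close>

lemma chain_free_iff:
  assumes "D \<subseteq> M"
  shows "chain_free M k D \<longleftrightarrow> (\<forall>i j S. ne_set S \<longrightarrow> S \<subseteq> {1..i} \<times> {1..j} - D \<longrightarrow>
     (\<exists>S'. ne_set S' \<and> S' \<subseteq> {1..i} \<times> {1..j} - erosion M k \<and> card S' = card S))" (is "_ \<longleftrightarrow> ?R")
proof
  assume "chain_free M k D"
  then show ?R using chain_free_box by metis
next
  assume r: ?R
  show "chain_free M k D"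
    unfolding chain_free_def
  proof (intro conjI allI impI)
    fix a b c d S
    assume RM: "{a..b} \<times> {c..d} \<subseteq> M" and S: "ne_set S" "S \<subseteq> {a..b} \<times> {c..d} - D"
    show "card S \<le> k"
    proof (cases "S = {}")
      case False
      then have "a \<le> b" "c \<le> d" using S by force+
      then obtain a' b' c' d' where R: "largest_rectangle M a' b' c' d'"
        and le: "a' \<le> a" "b \<le> b'" "c' \<le> c" "d \<le> d'" using largest_rectangle_exists RM by metis
      have "S \<subseteq> {a'..b'} \<times> {c'..d'} - D" using S le by fastforce
      then obtain S1 where S1: "ne_set S1" "S1 \<subseteq> {1..b' + c' - 1} \<times> {1..d' + a' - 1} - D"
          "card S1 = card S + (a' - 1) + (c' - 1)"
        using largest_rectangle_chain[OF R assms S(1)] by metis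
      then obtain S2 where "ne_set S2" "S2 \<subseteq> {1..b' + c' - 1} \<times> {1..d' + a' - 1} - erosion M k"
        "card S2 = card S1"
        using r by blast
      then show ?thesis using erosion_box_card[OF R erosion_chain_free] S1(3) by fastforce
    qed simp
  qed (rule assms)
qed

end

section \<open>Ranks and the Bruhat order\<close>

definition rank_count :: "(nat \<Rightarrow> nat) \<Rightarrow> nat \<Rightarrow> nat \<Rightarrow> nat" where
  "rank_count u i j = card {i' \<in> {1..i}. u i' \<le> j}"

lemma rank_count_transpose_le:
  assumes inj: "inj_on u {1..}" and i: "1 \<le> i1" "i1 < i2" "u i2 < u i1"
  shows "rank_count (\<lambda>i. transpose (u i2) (u i1) (u i)) i j \<le>
    rank_count u i j + (if i1 \<le> i \<and> i < i2 \<and> u i2 \<le> j \<and> j < u i1 then 1 else 0)"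
proof -
  have eq: "transpose (u i2) (u i1) (u i') = u (transpose i1 i2 i')" if "i' \<ge> 1" for i'
    using that i inj by (auto simp: transpose_def inj_on_eq_iff)
  have set: "{i' \<in> {1..i}. transpose (u i2) (u i1) (u i') \<le> j} = {i' \<in> {1..i}. u (transpose i1 i2 i') \<le> j}"
    using eq by auto
  consider "i < i1" | "i2 \<le> i" | "i1 \<le> i" "i < i2" by linarith
  then show ?thesis
  proof cases
    case 1
    then have "{i' \<in> {1..i}. u (transpose i1 i2 i') \<le> j} = {i' \<in> {1..i}. u i' \<le> j}"
      using i by (auto simp: transpose_def)
    then show ?thesis using set by (simp add: rank_count_def)
  next
    case 2
    have "{i' \<in> {1..i}. u (transpose i1 i2 i') \<le> j} = transpose i1 i2 ` {i' \<in> {1..i}. u i' \<le> j}"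
    proof (intro equalityI subsetI)
      fix x assume x: "x \<in> {i' \<in> {1..i}. u (transpose i1 i2 i') \<le> j}"
      then have "transpose i1 i2 x \<in> {i' \<in> {1..i}. u i' \<le> j}" using i 2
        by (auto simp: transpose_def)
      then show "x \<in> transpose i1 i2 ` {i' \<in> {1..i}. u i' \<le> j}"
        by (metis image_eqI transpose_involutory)
    next
      fix x assume "x \<in> transpose i1 i2 ` {i' \<in> {1..i}. u i' \<le> j}"
      then show "x \<in> {i' \<in> {1..i}. u (transpose i1 i2 i') \<le> j}"
        using i 2 by (auto simp: transpose_def split: if_splits)
    qed
    then have "card {i' \<in> {1..i}. u (transpose i1 i2 i') \<le> j} = card {i' \<in> {1..i}. u i' \<le> j}"
      by (simp only: card_image[OF inj_on_transpose])
    then show ?thesis using set by (simp add: rank_count_def)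
  next
    case 3
    define A where "A = {i' \<in> {1..i}. u i' \<le> j}"
    have "{i' \<in> {1..i}. u (transpose i1 i2 i') \<le> j} \<subseteq> (if u i2 \<le> j \<and>
      j < u i1 then insert i1 A else A)"
      using i 3 by (auto simp: A_def transpose_def)
    then have "card {i' \<in> {1..i}. u (transpose i1 i2 i') \<le> j} \<le> card (if u i2 \<le> j \<and>
      j < u i1 then insert i1 A else A)"
      by (intro card_mono) (auto simp: A_def)
    also have "\<dots> \<le> card A + (if u i2 \<le> j \<and> j < u i1 then 1 else 0)"
      by (auto intro: card_insert_le_m1 simp: card_insert_if A_def)
    finally show ?thesis using set 3 by (simp add: rank_count_def A_def)
  qed
qed

text \<open>The standard step in Bruhat order: \<open>i1\<close> is the first place of disagreement,
  and \<open>i2\<close> the next place whose value is at least \<open>w i1\<close> and below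
  \<open>u i1\<close>.\<close>

lemma bruhat_step:
  assumes u: "bij_betw u {1..} {1..}" and w: "bij_betw w {1..} {1..}"
    and le: "\<And>i j. rank_count u i j \<le> rank_count w i j" and ne: "\<exists>i\<ge>1. u i \<noteq> w i"
  obtains i1 i2 where "1 \<le> i1" and "i1 < i2" and "u i2 < u i1"
    and "\<And>i j. rank_count (\<lambda>i. transpose (u i2) (u i1) (u i)) i j \<le> rank_count w i j"
proof -
  have inju: "inj_on u {1..}" and injw: "inj_on w {1..}" using u w by (auto simp: bij_betw_def)
  define i1 where "i1 = (LEAST i. i \<ge> 1 \<and> u i \<noteq> w i)"
  have i1: "i1 \<ge> 1" "u i1 \<noteq> w i1" using LeastI_ex[OF ne[unfolded Bex_def]] unfolding i1_def by auto
  have before: "u i = w i" if "1 \<le> i" "i < i1" for i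
    using not_less_Least[of i] that unfolding i1_def by blast
  define x where "x = w i1"
  have x: "x \<ge> 1" using w i1 by (auto simp: x_def bij_betw_def)
  have "x < u i1"
  proof (rule ccontr)
    assume "\<not> x < u i1"
    then have lt: "u i1 < w i1" using i1 by (simp add: x_def)
    have "{i' \<in> {1..i1}. w i' \<le> u i1} \<subset> {i' \<in> {1..i1}. u i' \<le> u i1}"
    proof
      show "{i' \<in> {1..i1}. w i' \<le> u i1} \<subseteq> {i' \<in> {1..i1}. u i' \<le> u i1}"
        using before lt by (auto simp: le_less)
      show "{i' \<in> {1..i1}. w i' \<le> u i1} \<noteq> {i' \<in> {1..i1}. u i' \<le> u i1}"
        using i1 lt by (auto simp: set_eq_iff intro!: exI[of _ i1])
    qed
    then have "rank_count w i1 (u i1) < rank_count u i1 (u i1)"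
      unfolding rank_count_def by (intro psubset_card_mono) auto
    then show False using le[of i1 "u i1"] by simp
  qed
  have "x \<in> u ` {1..}" using u x by (auto simp: bij_betw_def)
  then obtain i' where i': "i' \<ge> 1" "u i' = x" by auto
  have "i' \<ge> i1"
  proof (rule ccontr)
    assume lt: "\<not> i1 \<le> i'"
    then have "w i' = w i1" using before i' by (simp add: x_def)
    then show False using injw i' i1 lt by (auto simp: inj_on_eq_iff)
  qed
  then have "i' > i1" using i' \<open>x < u i1\<close> by (auto simp: le_less)
  then have ex: "\<exists>i>i1. x \<le> u i \<and> u i < u i1" using i' \<open>x < u i1\<close> by auto
  define i2 where "i2 = (LEAST i. i > i1 \<and> x \<le> u i \<and> u i < u i1)"
  have i2: "i2 > i1" "x \<le> u i2" "u i2 < u i1" using LeastI_ex[OF ex] unfolding i2_def by auto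
  have between: "u i < x \<or> u i1 \<le> u i" if "i1 < i" "i < i2" for i
    using not_less_Least[OF that(2)[unfolded i2_def]] that(1) by auto
  have "rank_count (\<lambda>i. transpose (u i2) (u i1) (u i)) i j \<le> rank_count w i j" for i j
  proof (cases "i1 \<le> i \<and> i < i2 \<and> u i2 \<le> j \<and> j < u i1")
    case False
    then have "rank_count (\<lambda>i. transpose (u i2) (u i1) (u i)) i j \<le> rank_count u i j"
      using rank_count_transpose_le[OF inju i1(1) i2(1,3), of i j]
        by (simp only: if_False add_0_right)
    then show ?thesis using le by (meson order_trans)
  next
    case True
    \<comment> \<open>Up to place \<open>i\<close>, values of \<open>u\<close> from \<open>x\<close>
      to \<open>j\<close> occur only before \<open>i1\<close>, where \<open>u\<close> and
      \<open>w\<close> agree. Since \<open>w\<close> also has the value \<open>x\<close> at place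
      \<open>i1\<close>, comparing ranks at \<open>x - 1\<close> leaves \<open>w\<close> one ahead
      at \<open>j\<close>.\<close>
    define P where "P = {i' \<in> {1..<i1}. x \<le> w i' \<and> w i' \<le> j}"
    have "{i' \<in> {1..i}. u i' \<le> j} \<subseteq> {i' \<in> {1..i}. u i' \<le> x - 1} \<union> P"
    proof
      fix y assume y: "y \<in> {i' \<in> {1..i}. u i' \<le> j}"
      then show "y \<in> {i' \<in> {1..i}. u i' \<le> x - 1} \<union> P"
        using between[of y] before[of y] True
          by (cases y i1 rule: linorder_cases) (auto simp: P_def)
    qed
    then have "rank_count u i j \<le> card ({i' \<in> {1..i}. u i' \<le> x - 1} \<union> P)"
      unfolding rank_count_def by (intro card_mono) (auto simp: P_def)
    also have "\<dots> \<le> rank_count u i (x - 1) + card P"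
      unfolding rank_count_def by (rule card_Un_le)
    also have "\<dots> \<le> rank_count w i (x - 1) + card P" using le by simp
    also have "Suc \<dots> = card ({i' \<in> {1..i}. w i' \<le> x - 1} \<union> insert i1 P)"
    proof -
      have "{i' \<in> {1..i}. w i' \<le> x - 1} \<inter> insert i1 P = {}" using x by (auto simp: P_def x_def)
      then show ?thesis by (simp add: card_Un_disjoint rank_count_def P_def)
    qed
    also have "\<dots> \<le> rank_count w i j"
      unfolding rank_count_def using True i1 i2 by (intro card_mono) (auto simp: P_def x_def)
    finally have "Suc (rank_count u i j) \<le> rank_count w i j" by simp
    then show ?thesis
      using rank_count_transpose_le[OF inju i1(1) i2(1,3), of i j] True by simp
  qed
  then show ?thesis using that i1(1) i2(1,3) by blast
qed

text \<open>At the left border, \<open>j = 0\<close>, the flow counts exits, so it is the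
  rank.\<close>

lemma chain_le_rank:
  assumes "labeling D t r" and "ne_set S" and "S \<subseteq> {1..i} \<times> {1..j} - D"
  shows "card S \<le> rank_count (\<lambda>i. r i 0) i j"
  using ne_set_le_flow[OF assms(1), of 0 j S i] assms by (simp add: flow_def rank_count_def)

lemma chain_attains_rank:
  assumes "labeling D t r" and "pipe_dream D" and "reduced D"
  obtains S where "ne_set S" and "S \<subseteq> {1..i} \<times> {1..j} - D" and "card S = rank_count (\<lambda>i. r i 0) i j"
proof -
  have "\<exists>S. ne_set S \<and> S \<subseteq> {1..i} \<times> {Suc 0..j} - D \<and> card S = flow r j i 0"
    using reduced_iff_labels(1)[OF assms(1,2)] assms(3) by (intro flow_attained[OF assms(1)]) auto
  then show ?thesis using that by (auto simp: flow_def rank_count_def)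
qed

definition inversion_pairs :: "(nat \<Rightarrow> nat) \<Rightarrow> nat set set" where
  "inversion_pairs u = {{u i2, u i1} | i1 i2. 1 \<le> i1 \<and> i1 < i2 \<and> u i2 < u i1}"

lemma inversion_pairs_subset:
  assumes "labeling D t r" and "pipe_dream D"
  shows "inversion_pairs (\<lambda>i. r i 0) \<subseteq> (\<lambda>(i, j). {t i j, r i j}) ` D"
proof
  fix P assume "P \<in> inversion_pairs (\<lambda>i. r i 0)"
  then obtain i1 i2 where "1 \<le> i1" "i1 < i2" "r i2 0 < r i1 0" "P = {r i2 0, r i1 0}"
    unfolding inversion_pairs_def by blast
  then show "P \<in> (\<lambda>(i, j). {t i j, r i j}) ` D"
    using labeling_inversion_crossing[OF assms, of i1 i2]
    by (metis (mono_tags, lifting) case_prod_conv image_eqI)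
qed

text \<open>Every inversion is realized by some cross; with as many crosses as inversions, no pair
  can cross again.\<close>

lemma reduced_if_card:
  assumes lab: "labeling D t r" and D: "pipe_dream D"
    and card: "card D = card (inversion_pairs (\<lambda>i. r i 0))"
  shows "reduced D"
proof -
  have fin: "finite D" using D by (simp add: pipe_dream_def)
  then have "card (inversion_pairs (\<lambda>i. r i 0)) \<le> card ((\<lambda>(i, j). {t i j, r i j}) ` D)"
    using inversion_pairs_subset[OF lab D] by (intro card_mono) auto
  then have "card ((\<lambda>(i, j). {t i j, r i j}) ` D) = card D"
    using card card_image_le[OF fin, of "\<lambda>(i, j). {t i j, r i j}"] by linarith
  then show ?thesis using reduced_iff_labels(3)[OF lab D] eq_card_imp_inj_on[OF fin] by blast
qed

lemma inversion_pairs_cong: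
  assumes "\<And>i. i \<ge> 1 \<Longrightarrow> u i = w i"
  shows "inversion_pairs u = inversion_pairs w"
proof -
  have "inversion_pairs u \<subseteq> inversion_pairs w" if eq: "\<And>i. i \<ge> 1 \<Longrightarrow> u i = w i" for u w
  proof
    fix P assume "P \<in> inversion_pairs u"
    then obtain i1 i2 where i: "1 \<le> i1" "i1 < i2" "u i2 < u i1" "P = {u i2, u i1}"
      unfolding inversion_pairs_def by blast
    then have "w i2 < w i1" "P = {w i2, w i1}" using eq[of i1] eq[of i2] by auto
    then show "P \<in> inversion_pairs w" using i unfolding inversion_pairs_def by blast
  qed
  from this[of u w] this[of w u] show ?thesis using assms by fastforce
qed

lemma reduced_card:
  assumes lab: "labeling D t r" and D: "pipe_dream D" and "reduced D"
  shows "card D = card (inversion_pairs (\<lambda>i. r i 0))"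
proof -
  have "(\<lambda>(i, j). {t i j, r i j}) ` D = inversion_pairs (\<lambda>i. r i 0)"
  proof (intro equalityI subsetI)
    fix P assume "P \<in> (\<lambda>(i, j). {t i j, r i j}) ` D"
    then obtain i j where ij: "(i, j) \<in> D" "P = {t i j, r i j}" by auto
    then have "t i j < r i j" using reduced_iff_labels(1)[OF lab D] assms(3) by auto
    then show "P \<in> inversion_pairs (\<lambda>i. r i 0)"
      using reduced_iff_labels(2)[OF lab D assms(3) ij(1)] ij(2) unfolding inversion_pairs_def
        by force
  qed (use inversion_pairs_subset[OF lab D] in blast)
  then show ?thesis using reduced_iff_labels(3)[OF lab D] assms(3) card_image by fastforce
qed

section \<open>Transposing a pipe dream\<close>

definition flip :: "cell set \<Rightarrow> cell set" where
  "flip D = prod.swap ` D"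

lemma flip_iff [simp]: "(i, j) \<in> flip D \<longleftrightarrow> (j, i) \<in> D"
  by (force simp: flip_def)

lemma flip_flip [simp]: "flip (flip D) = D"
  by auto

text \<open>Transposition runs the pipes backwards, so a pipe is named by its former exit row, which
  \<open>v\<close> computes. The top and right edges of \<open>(i, j)\<close> are the former left
  and bottom edges of \<open>(j, i)\<close>.\<close>

lemma labeling_flip:
  assumes lab: "labeling D t r" and D: "pipe_dream D"
  defines "v \<equiv> inv_into {1..} (\<lambda>i. r i 0)"
  shows "labeling (flip D) (\<lambda>i j. v (r j (i - 1))) (\<lambda>i j. v (t (j + 1) i))"
proof -
  have v: "v (r i 0) = i" if "i \<ge> 1" for i
    using labeling_exits_bij[OF lab D] that unfolding v_def
      by (intro inv_into_f_f) (auto simp: bij_betw_def)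
  have "finite (fst ` D)" using D by (simp add: pipe_dream_def)
  then obtain N where "\<forall>x\<in>fst ` D. x \<le> N" by (meson finite_nat_set_iff_bounded_le)
  then have N: "\<And>i j. (i, j) \<in> D \<Longrightarrow> i \<le> N" by force
  have far: "v (t (j + 1) i) = i + j" if "i \<ge> 1" "j \<ge> N" for i j
  proof -
    have "(j + 1, i) \<notin> D" using N that(2) by force
    then have "t (j + 1) i = r (j + 1) (i - 1)" using labelingD(4)[OF lab _ that(1)] by simp
    also have "\<dots> = r (j + 1 + (i - 1)) 0" using that by (intro labeling_exit(3)[OF lab N]) auto
    also have "\<dots> = r (i + j) 0" using that by (simp add: add.commute)
    finally show ?thesis using v that by simp
  qed
  show ?thesis
    unfolding labeling_def
  proof (intro conjI allI impI)
    show "\<exists>m. \<forall>i\<ge>1. \<forall>j\<ge>m. v (t (j + 1) i) = i + j" using far by blast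
  next
    fix j :: nat assume "1 \<le> j"
    then show "v (r j (1 - 1)) = j" using v by simp
  next
    fix i j :: nat assume "1 \<le> i" "1 \<le> j"
    then show "v (t (j - 1 + 1) i) = (if (i, j) \<in> flip D then v (t (j + 1) i) else v (r j (i - 1)))"
      "v (r j (i + 1 - 1)) = (if (i, j) \<in> flip D then v (r j (i - 1)) else v (t (j + 1) i))"
      using labelingD(3-5)[OF lab, of j i] by auto
  qed
qed

text \<open>The rows above \<open>a\<close> have only elbow joints right of column \<open>d\<close>,
  so the pipes entering row \<open>a\<close> from above in those columns are exactly those from
  \<open>d + a\<close> on. A smaller pipe can no longer get to the right of column \<open>d\<close>,
  and a larger one cannot reach the columns up to \<open>d\<close> before row
  \<open>a\<close>.\<close>

lemma crossing_south_west:
  assumes lab: "labeling D t r" and NE: "\<And>i j. (i, j) \<in> D \<Longrightarrow> \<not> (i < a \<and> d < j)" and a: "1 \<le> a"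
    and ij: "(i, j) \<in> D" "1 \<le> i" "1 \<le> j" and pq: "t i j < d + a" "d + a \<le> r i j"
  shows "a \<le> i \<and> j \<le> d"
proof -
  have r1: "r i j = i + j" if "1 \<le> i" "i < a" "d \<le> j" "\<forall>j>d. t i j = i + j - 1" for i j
  proof -
    have "(i, Suc j) \<notin> D" using NE that by force
    then show ?thesis using labelingD(2)[OF lab that(1), of j] that by auto
  qed
  have t1: "\<forall>j>d. t i j = i + j - 1" if "1 \<le> i" "i \<le> a" for i
    using that
  proof (induction i rule: dec_induct)
    case base
    then show ?case using labelingD(1)[OF lab] by simp
  next
    case (step i)
    then have "\<forall>j\<ge>d. r i j = i + j" using r1 by simp
    moreover have "(i, j) \<notin> D" if "d < j" for j using NE step.prems that by force
    ultimately show ?case using labelingD(3)[OF lab step.hyps(1)] by auto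
  qed
  have r2: "r i j < d + a" if i: "1 \<le> i" "i < a" and t: "\<forall>j. 1 \<le> j \<longrightarrow> j \<le> d \<longrightarrow> t i j < d + a"
    and "j \<le> d" for i j
    using \<open>j \<le> d\<close>
  proof (induction j rule: inc_induct)
    case base
    then show ?case using r1[of i d] t1 i by simp
  next
    case (step j)
    then show ?case using labelingD(2)[OF lab i(1), of j] t by auto
  qed
  have t2: "\<forall>j. 1 \<le> j \<longrightarrow> j \<le> d \<longrightarrow> t i j < d + a" if "1 \<le> i" "i \<le> a" for i
    using that
  proof (induction i rule: dec_induct)
    case base
    then show ?case using labelingD(1)[OF lab] a by auto
  next
    case (step i)
    then show ?case using labelingD(3)[OF lab step.hyps(1)] r2[of i] by auto
  qed
  obtain m where m: "\<And>i j. i \<ge> 1 \<Longrightarrow> j \<ge> m \<Longrightarrow> r i j = i + j" using lab labeling_far by metis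
  have r3: "d + a \<le> r i j" if i: "a \<le> i" and t: "\<forall>j>d. d + a \<le> t i j" and "d \<le> j" for i j
    using \<open>d \<le> j\<close>
  proof (induction "m - j" arbitrary: j rule: less_induct)
    case less
    show ?case
    proof (cases "j \<ge> m")
      case True
      then show ?thesis using m[of i j] i a less.prems by simp
    next
      case False
      then have "d + a \<le> r i (Suc j)" using less by auto
      then show ?thesis using labelingD(2)[OF lab, of i j] t less.prems i a by auto
    qed
  qed
  have t3: "\<forall>j>d. d + a \<le> t i j" if "a \<le> i" for i
    using that
  proof (induction i rule: dec_induct)
    case base
    then show ?case using t1[of a] a by auto
  next
    case (step i)
    then show ?case using labelingD(3)[OF lab, of i] r3[of i] a by auto
  qed
  have "a \<le> i"
  proof (rule ccontr)
    assume "\<not> a \<le> i"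
    then have "j \<le> d" using NE[OF ij(1)] by simp
    then show False using r2[of i j] t2[of i] ij \<open>\<not> a \<le> i\<close> pq by auto
  qed
  moreover have "j \<le> d" using t3[OF \<open>a \<le> i\<close>] pq by (meson not_le)
  ultimately show ?thesis by blast
qed

section \<open>Maximal fillings and their permutation\<close>

context moon_shape
begin

lemma pipe_dream_M: "D \<subseteq> M \<Longrightarrow> pipe_dream D"
  using finite_M M_grid finite_subset unfolding pipe_dream_def by blast

lemma facet_subset: "D \<in> facets M k \<Longrightarrow> D \<subseteq> M"
  by (simp add: facets_def chain_free_def)

lemma facet_exists:
  assumes "chain_free M k D"
  obtains D0 where "D0 \<in> facets M k" and "D0 \<subseteq> D"
proof -
  have "finite D" using assms finite_M finite_subset unfolding chain_free_def by blast
  then have "\<exists>D0\<in>facets M k. D0 \<subseteq> D" using assms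
  proof (induction D rule: finite_psubset_induct)
    case (psubset D)
    show ?case
    proof (cases "D \<in> facets M k")
      case False
      then obtain x where "x \<in> D" "chain_free M k (D - {x})" using psubset.prems
        by (auto simp: facets_def)
      then show ?thesis using psubset.IH[of "D - {x}"] by blast
    qed auto
  qed
  then show ?thesis using that by blast
qed

lemma facet_reduced:
  assumes "D \<in> facets M k"
  shows "reduced D"
proof (rule ccontr)
  assume nr: "\<not> reduced D"
  have D: "D \<subseteq> M" "pipe_dream D" using facet_subset[OF assms] pipe_dream_M by auto
  obtain t r where lab: "labeling D t r" using labeling_exists[OF D(2)] by blast
  obtain x where x: "x \<in> D"
    and *: "\<And>S i J. ne_set S \<Longrightarrow> S \<subseteq> {1..i} \<times> {1..J} - (D - {x}) \<Longrightarrow>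
      \<exists>S'. ne_set S' \<and> S' \<subseteq> {1..i} \<times> {1..J} - D \<and> card S' = card S"
    using redundant_cross[OF lab D(2) nr] by blast
  have "D - {x} \<subseteq> M" "chain_free M k D" using D assms by (auto simp: facets_def)
  then have "chain_free M k (D - {x})"
    using * chain_free_iff[OF D(1), of k] unfolding chain_free_iff[OF \<open>D - {x} \<subseteq> M\<close>] by metis
  then show False using assms x by (simp add: facets_def)
qed

lemma facet_pipe_dream: "D \<in> facets M k \<Longrightarrow> pipe_dream D"
  by (rule pipe_dream_M[OF facet_subset])

lemma erosion_subset: "erosion M k \<subseteq> M"
  and erosion_pipe_dream: "pipe_dream (erosion M k)"
  and erosion_reduced: "reduced (erosion M k)"
  using facet_subset[OF erosion_facet] facet_pipe_dream[OF erosion_facet] facet_reduced[OF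
    erosion_facet]
  by simp_all

text \<open>Chains of \<open>D\<close> are bounded by its ranks, and the ranks of the erosion are
  attained by chains. Only the erosion uses its reducedness, so the criterion applies to a pipe
  dream with a cross deleted.\<close>

lemma chain_free_rank:
  assumes "D \<subseteq> M" and "labeling D t r" and "labeling (erosion M k) t' r'"
    and "\<And>i j. rank_count (\<lambda>i. r i 0) i j \<le> rank_count (\<lambda>i. r' i 0) i j"
  shows "chain_free M k D"
  unfolding chain_free_iff[OF assms(1)]
proof (intro allI impI)
  fix i j S
  assume S: "ne_set S" "S \<subseteq> {1..i} \<times> {1..j} - D"
  have E: "erosion M k \<subseteq> M" "pipe_dream (erosion M k)" "reduced (erosion M k)"
    by (rule erosion_subset erosion_pipe_dream erosion_reduced)+
  obtain T where T: "ne_set T" "T \<subseteq> {1..i} \<times> {1..j} - erosion M k"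
      "card T = rank_count (\<lambda>i. r' i 0) i j"
    using chain_attains_rank[OF assms(3) E(2,3)] by blast
  have "card S \<le> card T" using chain_le_rank[OF assms(2) S] assms(4)[of i j] T(3) by simp
  then obtain S' where "S' \<subseteq> T" "ne_set S'" "card S' = card S" using ne_set_card_subset[OF T(1)]
    by blast
  then show "\<exists>S'. ne_set S' \<and> S' \<subseteq> {1..i} \<times> {1..j} - erosion M k \<and> card S' = card S" using T(2)
    by blast
qed

lemma facet_exits:
  assumes D: "D \<in> facets M k" and lab: "labeling D t r" and labE: "labeling (erosion M k) t' r'"
    and "i \<ge> 1"
  shows "r i 0 = r' i 0"
proof (rule ccontr)
  assume ne: "r i 0 \<noteq> r' i 0"
  have DM: "D \<subseteq> M" "pipe_dream D" "reduced D"
    using facet_subset[OF D] pipe_dream_M facet_reduced[OF D] by auto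
  have E: "pipe_dream (erosion M k)" by (rule erosion_pipe_dream)
  have le: "rank_count (\<lambda>i. r i 0) i j \<le> rank_count (\<lambda>i. r' i 0) i j" for i j
  proof -
    obtain S where S: "ne_set S" "S \<subseteq> {1..i} \<times> {1..j} - D" "card S = rank_count (\<lambda>i. r i 0) i j"
      using chain_attains_rank[OF lab DM(2,3)] by blast
    obtain S' where "ne_set S'" "S' \<subseteq> {1..i} \<times> {1..j} - erosion M k" "card S' = card S"
      using chain_free_box[of k D S i j] D S by (auto simp: facets_def)
    then show ?thesis using chain_le_rank[OF labE] S(3) by metis
  qed
  have ne': "\<exists>i\<ge>1. r i 0 \<noteq> r' i 0" using ne assms(4) by blast
  obtain i1 i2 where i12: "1 \<le> i1" "i1 < i2" "r i2 0 < r i1 0"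
    and step: "\<And>i j. rank_count (\<lambda>i. transpose (r i2 0) (r i1 0) (r i 0)) i j \<le> rank_count (\<lambda>i. r' i 0) i j"
    using bruhat_step[OF labeling_exits_bij[OF lab DM(2)] labeling_exits_bij[OF labE E] le ne']
      by blast
  obtain a b where ab: "(a, b) \<in> D" "{t a b, r a b} = {r i2 0, r i1 0}"
    using labeling_inversion_crossing[OF lab DM(2) i12] by blast
  have D': "D - {(a, b)} \<subseteq> M" using DM by auto
  obtain t2 r2 where lab2: "labeling (D - {(a, b)}) t2 r2"
    using labeling_exists[OF pipe_dream_M[OF D']] by blast
  \<comment> \<open>Deleting a cross of the two pipes acts on the exits by their transposition, so
    the rank bounds of \<open>bruhat_step\<close> become bounds for the smaller pipe dream.\<close>
  have r2: "r2 i 0 = transpose (r i2 0) (r i1 0) (r i 0)" if "i \<ge> 1" for i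
  proof -
    have "r2 i 0 = transpose (t a b) (r a b) (r i 0)"
      by (rule labeling_delete[OF lab DM(2) ab(1) lab2 that])
    then show ?thesis using ab(2) by (auto simp: doubleton_eq_iff transpose_commute)
  qed
  have "rank_count (\<lambda>i. r2 i 0) i j = rank_count (\<lambda>i. transpose (r i2 0) (r i1 0) (r i 0)) i j"
    for i j
    unfolding rank_count_def using r2 by (intro arg_cong[where f = card]) auto
  then have "chain_free M k (D - {(a, b)})" using chain_free_rank[OF D' lab2 labE] step by simp
  then show False using D ab(1) by (auto simp: facets_def)
qed

text \<open>A facet inside \<open>D\<close> has as many crosses as the erosion, hence as
  \<open>D\<close>, and is therefore all of \<open>D\<close>.\<close>

lemma facetI:
  assumes D: "D \<subseteq> M" and lab: "labeling D t r" and labE: "labeling (erosion M k) t' r'"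
    and w: "\<And>i. i \<ge> 1 \<Longrightarrow> r i 0 = r' i 0" and card: "card D = card (erosion M k)"
  shows "D \<in> facets M k"
proof -
  have "rank_count (\<lambda>i. r i 0) i j \<le> rank_count (\<lambda>i. r' i 0) i j" for i j
    unfolding rank_count_def using w by (intro card_mono) auto
  then have "chain_free M k D" using chain_free_rank[OF D lab labE] by blast
  then obtain D0 where D0: "D0 \<in> facets M k" "D0 \<subseteq> D" using facet_exists by blast
  have E: "erosion M k \<in> facets M k" by (rule erosion_facet)
  have pd: "pipe_dream D0" "pipe_dream (erosion M k)"
    using facet_pipe_dream[OF D0(1)] erosion_pipe_dream by auto
  obtain t0 r0 where lab0: "labeling D0 t0 r0" using labeling_exists[OF pd(1)] by blast
  have "inversion_pairs (\<lambda>i. r0 i 0) = inversion_pairs (\<lambda>i. r' i 0)"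
    using facet_exits[OF D0(1) lab0 labE] by (rule inversion_pairs_cong)
  then have "card D0 = card D"
    using reduced_card[OF lab0 pd(1) facet_reduced[OF D0(1)]] reduced_card[OF labE pd(2)
      facet_reduced[OF E]] card
    by simp
  then have "D0 = D" using D0(2) D finite_M card_subset_eq finite_subset by metis
  then show ?thesis using D0 by simp
qed

lemma separation:
  assumes lab: "labeling (erosion M k) t r" and ij: "(i, j) \<in> erosion M k"
  obtains a b c d i1 i2 where "largest_rectangle M a b c d" and "1 \<le> i1" and "i1 < b + c"
    and "b + c \<le> i2"
    and "t i j < d + a" and "d + a \<le> r i j" and "r i1 0 = r i j" and "r i2 0 = t i j"
proof -
  define E where "E = erosion M k"
  have E: "E \<in> facets M k" "E \<subseteq> M" "pipe_dream E" "reduced E" "chain_free M k E"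
    unfolding E_def by (rule erosion_facet erosion_subset erosion_pipe_dream erosion_reduced
      erosion_chain_free)+
  have lab: "labeling E t r" using lab by (simp add: E_def)
  have ij: "(i, j) \<in> E" using ij by (simp add: E_def)
  have pq: "t i j < r i j" using reduced_iff_labels(1)[OF lab E(3)] E(4) ij by auto
  obtain i1 i2 where i12: "1 \<le> i1" "i1 < i2" "r i1 0 = r i j" "r i2 0 = t i j"
    using reduced_iff_labels(2)[OF lab E(3,4) ij] by blast
  have E': "E - {(i, j)} \<subseteq> M" using E by auto
  obtain t2 r2 where lab2: "labeling (E - {(i, j)}) t2 r2"
    using labeling_exists[OF pipe_dream_M[OF E']] by blast
  have "\<not> chain_free M k (E - {(i, j)})" using E(1) ij by (simp add: facets_def)
  then obtain a0 b0 c0 d0 S0 where R0: "{a0..b0} \<times> {c0..d0} \<subseteq> M" and S0: "ne_set S0"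
      "S0 \<subseteq> {a0..b0} \<times> {c0..d0} - (E - {(i, j)})" "k < card S0"
    unfolding chain_free_def using E' by (auto simp: not_le)
  then have "S0 \<noteq> {}" by auto
  then have "a0 \<le> b0" "c0 \<le> d0" using S0 by force+
  then obtain a b c d where R: "largest_rectangle M a b c d"
    and le: "a \<le> a0" "b0 \<le> b" "c \<le> c0" "d0 \<le> d"
    using largest_rectangle_exists[OF R0] by metis
  have ac: "a \<ge> 1" "c \<ge> 1"
    using R M_pos[of a c] unfolding largest_rectangle_def by (auto simp: subset_iff)
  have "S0 \<subseteq> {a..b} \<times> {c..d} - (E - {(i, j)})" using S0 le by fastforce
  then obtain S where S: "ne_set S" "S \<subseteq> {1..b + c - 1} \<times> {1..d + a - 1} - (E - {(i, j)})"
      "card S = card S0 + (a - 1) + (c - 1)"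
    using largest_rectangle_chain[OF R E' S0(1)] by metis
  obtain T where T: "ne_set T" "T \<subseteq> {1..b + c - 1} \<times> {1..d + a - 1} - E"
      "card T = rank_count (\<lambda>i. r i 0) (b + c - 1) (d + a - 1)"
    using chain_attains_rank[OF lab E(3,4)] by blast
  have "card T \<le> k + (a - 1) + (c - 1)" using erosion_box_card[OF R E(5) T(1,2)] .
  moreover have "card S \<le> rank_count (\<lambda>i. r2 i 0) (b + c - 1) (d + a - 1)"
    using chain_le_rank[OF lab2 S(1,2)] .
  moreover have "rank_count (\<lambda>i. r2 i 0) (b + c - 1) (d + a - 1) =
      rank_count (\<lambda>i. transpose (r i2 0) (r i1 0) (r i 0)) (b + c - 1) (d + a - 1)"
    unfolding rank_count_def using labeling_delete[OF lab E(3) ij lab2] i12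
    by (intro arg_cong[where f = card]) auto
  moreover have "inj_on (\<lambda>i. r i 0) {1..}" using labeling_exits_bij[OF lab E(3)]
    by (simp add: bij_betw_def)
  \<comment> \<open>Deleting the cross raises the rank of this box. A transposition does so only if
    the box separates both the places and the values of the inversion.\<close>
  ultimately have "i1 \<le> b + c - 1 \<and> b + c - 1 < i2 \<and> t i j \<le> d + a - 1 \<and> d + a - 1 < r i j"
    using rank_count_transpose_le[of "\<lambda>i. r i 0" i1 i2 "b + c - 1"
      "d + a - 1"] i12 pq S(3) S0(3) T(3)
    by (auto split: if_splits)
  then have "i1 < b + c" "b + c \<le> i2" "t i j < d + a" "d + a \<le> r i j" using ac by auto
  then show ?thesis using that[OF R i12(1)] i12 by blast
qed

lemma confinement:
  assumes D: "pipe_dream D" "reduced D" and lab: "labeling D t r"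
    and labE: "labeling (erosion M k) t' r'"
    and w: "\<And>i. i \<ge> 1 \<Longrightarrow> r i 0 = r' i 0"
    and quadrants: "\<And>a b c d i j. largest_rectangle M a b c d \<Longrightarrow> (i, j) \<in> D \<Longrightarrow>
      \<not> (i < a \<and> d < j) \<and> \<not> (b < i \<and> j < c)"
  shows "D \<subseteq> M"
proof
  fix x assume "x \<in> D"
  then obtain i j where x: "x = (i, j)" and ij: "(i, j) \<in> D" by (cases x) auto
  then have pos: "1 \<le> i" "1 \<le> j" using D by (auto simp: pipe_dream_def grid_def)
  define E where "E = erosion M k"
  have E: "pipe_dream E" "reduced E"
    unfolding E_def by (rule erosion_pipe_dream erosion_reduced)+
  have labE: "labeling E t' r'" using labE by (simp add: E_def)
  have pq: "t i j < r i j" using reduced_iff_labels(1)[OF lab D(1)] D(2) ij by auto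
  obtain i1 i2 where i12: "1 \<le> i1" "i1 < i2" "r i1 0 = r i j" "r i2 0 = t i j"
    using reduced_iff_labels(2)[OF lab D ij] by blast
  have w12: "r' i1 0 = r i j" "r' i2 0 = t i j" using w i12 by auto
  \<comment> \<open>The erosion has the same exits, so the same two pipes cross in it;
    \<open>separation\<close> is applied to that cross.\<close>
  obtain i0 j0 where ij0: "(i0, j0) \<in> E" "{t' i0 j0, r' i0 j0} = {r' i2 0, r' i1 0}"
    using labeling_inversion_crossing[OF labE E(1) i12(1,2)] w12 pq by auto
  have "t' i0 j0 < r' i0 j0" using reduced_iff_labels(1)[OF labE E(1)] E(2) ij0 by auto
  then have tr: "t' i0 j0 = t i j" "r' i0 j0 = r i j" using ij0(2) w12 pq
    by (auto simp: doubleton_eq_iff)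
  obtain a b c d i1' i2' where R: "largest_rectangle M a b c d"
    and i': "1 \<le> i1'" "i1' < b + c" "b + c \<le> i2'"
    and p: "t i j < d + a" "d + a \<le> r i j" and r': "r' i1' 0 = r i j" "r' i2' 0 = t i j"
    using separation[of k t' r' i0 j0] labE ij0(1) unfolding E_def tr by blast
  have inj: "inj_on (\<lambda>i. r' i 0) {1..}" using labeling_exits_bij[OF labE E(1)]
    by (simp add: bij_betw_def)
  have i1: "i1' = i1" "i2' = i2"
    using inj_onD[OF inj, of i1' i1] inj_onD[OF inj, of i2' i2] w12 r' i12 i' by auto
  have RM: "{a..b} \<times> {c..d} \<subseteq> M" and "(a, c) \<in> M" using R by (auto simp: largest_rectangle_def)
  then have ac: "1 \<le> a" "1 \<le> c" using M_pos by blast+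
  have 1: "a \<le> i \<and> j \<le> d"
    using quadrants[OF R] by (intro crossing_south_west[OF lab _ ac(1) ij pos p]) blast
  define v where "v = inv_into {1..} (\<lambda>i. r i 0)"
  have v: "v (r i 0) = i" if "i \<ge> 1" for i
    using labeling_exits_bij[OF lab D(1)] that unfolding v_def
      by (intro inv_into_f_f) (auto simp: bij_betw_def)
  have labF: "labeling (flip D) (\<lambda>i j. v (r j (i - 1))) (\<lambda>i j. v (t (j + 1) i))"
    unfolding v_def by (rule labeling_flip[OF lab D(1)])
  have "v (r i (j - 1)) = i1"
    using labelingD(5)[OF lab pos ij] v[of i1] i12 by simp
  moreover have "v (t (i + 1) j) = i2"
    using labelingD(3)[OF lab pos] ij v[of i2] i12 by simp
  \<comment> \<open>The transposed pipe dream handles the other quadrant: its labels are exit rows,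
    and these are separated by \<open>b + c\<close>.\<close>
  ultimately have "c \<le> j \<and> i \<le> b"
    using quadrants[OF R] ij pos i' unfolding i1
      by (intro crossing_south_west[OF labF _ ac(2)]) auto
  then show "x \<in> M" using 1 RM x by auto
qed

end

section \<open>Chute moves\<close>

lemma row_run:
  assumes lab: "labeling D t r" and "i \<ge> 1" and "j \<le> j2" and "\<And>j'. j < j' \<Longrightarrow> j' \<le> j2 \<Longrightarrow> (i, j') \<in> D"
  shows "r i j = r i j2"
  using assms(3,4)
proof (induction j rule: inc_induct)
  case (step n)
  then have "(i, Suc n) \<in> D" "r i (Suc n) = r i j2" by auto
  then show ?case using labelingD(2)[OF lab assms(2), of n] by simp
qed simp

lemma column_run:
  assumes lab: "labeling D t r" and "i1 \<ge> 1" and "j \<ge> 1" and "i1 \<le> i"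
    and "\<And>i'. i1 \<le> i' \<Longrightarrow> i' < i \<Longrightarrow> (i', j) \<in> D"
  shows "t i j = t i1 j"
  using assms(4,5)
proof (induction i rule: dec_induct)
  case (step n)
  then have "(n, j) \<in> D" "t n j = t i1 j" by auto
  then show ?case using labelingD(3)[OF lab _ assms(3), of n] step.hyps assms(2) by simp
qed simp

lemma chutable_cells:
  assumes "chutable E a b c d"
  shows "1 \<le> a" "a < b" "1 \<le> c" "c < d" "(a, c) \<notin> E" "(b, c) \<notin> E" "(b, d) \<notin> E"
    and "\<And>i j. a \<le> i \<Longrightarrow> i \<le> b \<Longrightarrow> c \<le> j \<Longrightarrow> j \<le> d \<Longrightarrow> (i, j) \<noteq> (a, c) \<Longrightarrow> (i, j) \<noteq> (b, c) \<Longrightarrow>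
      (i, j) \<noteq> (b, d) \<Longrightarrow> (i, j) \<in> E"
proof -
  have eq: "{a..b} \<times> {c..d} - E = {(a, c), (b, c), (b, d)}" and 1: "1 \<le> a" "a < b" "1 \<le> c" "c < d"
    using assms by (auto simp: chutable_def)
  show "1 \<le> a" "a < b" "1 \<le> c" "c < d" by (rule 1)+
  have "(a, c) \<in> {a..b} \<times> {c..d} - E" "(b, c) \<in> {a..b} \<times> {c..d} - E" "(b, d) \<in> {a..b} \<times> {c..d} - E"
    unfolding eq by simp_all
  then show "(a, c) \<notin> E" "(b, c) \<notin> E" "(b, d) \<notin> E" by simp_all
  fix i j assume "a \<le> i" "i \<le> b" "c \<le> j" "j \<le> d" "(i, j) \<noteq> (a, c)" "(i, j) \<noteq> (b, c)"
    "(i, j) \<noteq> (b, d)"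
  then have "(i, j) \<in> {a..b} \<times> {c..d}" "(i, j) \<notin> {a..b} \<times> {c..d} - E" unfolding eq by auto
  then show "(i, j) \<in> E" by blast
qed

text \<open>A chute move only exchanges the two pipes on the boundary of the rectangle.\<close>

lemma chute_labeling:
  assumes lab: "labeling E t r" and ch: "chutable E a b c d"
  obtains t' r' where "labeling (insert (b, c) (E - {(a, d)})) t' r'" and "\<And>i. r' i 0 = r i 0"
proof -
  note c = chutable_cells[OF ch]
  define D where "D = insert (b, c) (E - {(a, d)})"
  \<comment> \<open>In the rectangle \<open>p\<close> runs down column \<open>d\<close> and on along
    row \<open>b\<close>, while \<open>q\<close> runs along row \<open>a\<close> and on down column
    \<open>c\<close>. Moving the cross exchanges these two routes, which \<open>t'\<close> and
    \<open>r'\<close> record.\<close>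
  define p q where "p = t a d" and "q = r a d"
  have A: "t i d = p" if "a \<le> i" "i \<le> b" for i
    unfolding p_def using c that by (intro column_run[OF lab]) auto
  have "r b (d - 1) = t b d" using labelingD(4)[OF lab, of b d] c by simp
  then have B: "r b j = p" if "c \<le> j" "j < d" for j
    using row_run[OF lab, of b j "d - 1"] A[of b] c that by auto
  have C: "r a j = q" if "c \<le> j" "j \<le> d" for j
    unfolding q_def using c that by (intro row_run[OF lab]) auto
  have "t (Suc a) c = r a c" using labelingD(3)[OF lab, of a c] c by simp
  then have Dc: "t i c = q" if "a < i" "i \<le> b" for i
    using column_run[OF lab, of "Suc a" c i] C[of c] c that by auto
  define t' where "t' i j = (if j = d \<and> a < i \<and> i \<le> b then q else if j = c \<and> a < i \<and>
    i \<le> b then p else t i j)" for i j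
  define r' where "r' i j = (if i = a \<and> c \<le> j \<and> j < d then p else if i = b \<and> c \<le> j \<and>
    j < d then q else r i j)" for i j
  have mem: "(i, j) \<in> D \<longleftrightarrow> (if (i, j) = (a, d) then False else if (i, j) = (b, c) then True else (i, j) \<in> E)" for i j
    using c by (auto simp: D_def)
  have left: "r' i (j - 1) = (if (i, j) \<in> D then r' i j else t' i j)" if ij: "1 \<le> i" "1 \<le> j" for i j
  proof -
    consider "a \<le> i" "i \<le> b" "c \<le> j" "j \<le> d" | "\<not> (a \<le> i \<and> i \<le> b \<and> c \<le> j \<and> j \<le> d)" by blast
    then show ?thesis
    proof cases
      case 1
      have in_E: "(i, j) \<in> E" if "(i, j) \<noteq> (a, c)" "(i, j) \<noteq> (b, c)" "(i, j) \<noteq> (b, d)"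
        using c(8) 1 that by blast
      have base: "r i (j - 1) = (if (i, j) \<in> E then r i j else t i j)"
        using labelingD(4,5)[OF lab ij] by simp
      have "i = a \<or> i = b \<or> a < i \<and> i < b" "j = c \<or> j = d \<or> c < j \<and> j < d" using 1 by auto
      then consider "i = a" "j = d" | "i = a" "c < j" "j < d" | "i = a" "j = c" | "i = b" "j = d"
        | "i = b" "c < j" "j < d" | "i = b" "j = c" | "a < i" "i < b" by blast
      then show ?thesis
      proof cases
        case 1 then show ?thesis using c(1-4) A[of a] by (auto simp: mem r'_def t'_def)
      next
        case 2 then show ?thesis using c(1-4) in_E base by (auto simp: mem r'_def t'_def)
      next
        case 3 then show ?thesis using c(1-5) base by (auto simp: mem r'_def t'_def)
      next
        case 4 then show ?thesis using c(1-4,7) base by (auto simp: mem r'_def t'_def)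
      next
        case 5 then show ?thesis using c(1-4) in_E base by (auto simp: mem r'_def t'_def)
      next
        case 6 then show ?thesis using c(1-4,6) base Dc[of b] by (auto simp: mem r'_def t'_def)
      next
        case 7 then show ?thesis using c(1-4) in_E base by (auto simp: mem r'_def t'_def)
      qed
    next
      case 2
      have "r' i (j - 1) = r i (j - 1)" using 2 c by (auto simp: r'_def)
      moreover have "r' i j = r i j" "t' i j = t i j" "(i, j) \<in> D \<longleftrightarrow> (i, j) \<in> E" using 2 c
        by (auto simp: r'_def t'_def mem)
      ultimately show ?thesis using labelingD(4,5)[OF lab ij] by simp
    qed
  qed
  have bottom: "t' (i + 1) j = (if (i, j) \<in> D then t' i j else r' i j)" if ij: "1 \<le> i" "1 \<le> j"
    for i j
  proof -
    consider "a \<le> i" "i \<le> b" "c \<le> j" "j \<le> d" | "\<not> (a \<le> i \<and> i \<le> b \<and> c \<le> j \<and> j \<le> d)" by blast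
    then show ?thesis
    proof cases
      case 1
      have in_E: "(i, j) \<in> E" if "(i, j) \<noteq> (a, c)" "(i, j) \<noteq> (b, c)" "(i, j) \<noteq> (b, d)"
        using c(8) 1 that by blast
      have base: "t (i + 1) j = (if (i, j) \<in> E then t i j else r i j)"
        using labelingD(3)[OF lab ij] by simp
      have "i = a \<or> i = b \<or> a < i \<and> i < b" "j = c \<or> j = d \<or> c < j \<and> j < d" using 1 by auto
      then consider "i = a" "j = d" | "i = a" "c < j" "j < d" | "i = a" "j = c" | "i = b" "j = d"
        | "i = b" "c < j" "j < d" | "i = b" "j = c" | "a < i" "i < b" by blast
      then show ?thesis
      proof cases
        case 1 then show ?thesis using c(1-4) C[of d] by (auto simp: mem r'_def t'_def)
      next
        case 2 then show ?thesis using c(1-4) in_E base by (auto simp: mem r'_def t'_def)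
      next
        case 3 then show ?thesis using c(1-5) base by (auto simp: mem r'_def t'_def)
      next
        case 4 then show ?thesis using c(1-4,7) base by (auto simp: mem r'_def t'_def)
      next
        case 5 then show ?thesis using c(1-4) in_E base by (auto simp: mem r'_def t'_def)
      next
        case 6 then show ?thesis using c(1-4,6) base B[of c] by (auto simp: mem r'_def t'_def)
      next
        case 7 then show ?thesis using c(1-4) in_E base by (auto simp: mem r'_def t'_def)
      qed
    next
      case 2
      have "t' (i + 1) j = t (i + 1) j" using 2 c by (auto simp: t'_def)
      moreover have "r' i j = r i j" "t' i j = t i j" "(i, j) \<in> D \<longleftrightarrow> (i, j) \<in> E" using 2 c
        by (auto simp: r'_def t'_def mem)
      ultimately show ?thesis using labelingD(3)[OF lab ij] by simp
    qed
  qed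
  obtain m where m: "\<And>i j. i \<ge> 1 \<Longrightarrow> j \<ge> m \<Longrightarrow> r i j = i + j" using lab labeling_far by metis
  have "labeling D t' r'"
    unfolding labeling_def
  proof (intro conjI allI impI exI)
    show "t' 1 j = j" if "1 \<le> j" for j using labelingD(1)[OF lab that] c by (auto simp: t'_def)
    show "r' i j = i + j" if "1 \<le> i" "max m d \<le> j" for i j using m[of i j] that
      by (auto simp: r'_def)
  qed (use left bottom in blast)+
  moreover have "r' i 0 = r i 0" for i using c by (auto simp: r'_def)
  ultimately show ?thesis using that by (simp add: D_def)
qed

section \<open>Inverted pipes and inverse chute moves\<close>

definition inverted :: "(nat \<Rightarrow> nat) \<Rightarrow> nat \<Rightarrow> nat \<Rightarrow> bool" where
  "inverted u p q \<longleftrightarrow> p < q \<and> (\<exists>i1\<ge>1. \<exists>i2>i1. u i1 = q \<and> u i2 = p)"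

lemma inverted_trans:
  assumes "inj_on u {1..}" and "inverted u p q" and "inverted u q h"
  shows "inverted u p h"
proof -
  obtain i1 i2 where 1: "1 \<le> i1" "i1 < i2" "u i1 = q" "u i2 = p" using assms(2)
    by (auto simp: inverted_def)
  obtain k1 k2 where 2: "1 \<le> k1" "k1 < k2" "u k1 = h" "u k2 = q" using assms(3)
    by (auto simp: inverted_def)
  have "k2 = i1" using inj_onD[OF assms(1), of k2 i1] 1 2 by auto
  then have "k1 < i2" using 1 2 by simp
  moreover have "p < h" using assms(2,3) by (simp add: inverted_def)
  ultimately show ?thesis
    using 1 2 unfolding inverted_def by (intro conjI exI[of _ k1] exI[of _ i2]) auto
qed

lemma crossing_inverted:
  assumes "labeling D t r" and "pipe_dream D" and "reduced D" and "(i, j) \<in> D"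
  shows "inverted (\<lambda>i. r i 0) (t i j) (r i j)"
  using reduced_iff_labels(1,2)[OF assms(1,2)] assms(3,4) unfolding inverted_def by auto

text \<open>The two pipes that touch at an elbow joint and cross later leave it leftwards and downwards.
  Their first turns span a rectangle whose south-west corner and interior are crosses, unless it
  contains another such elbow joint, further to the south-west: a pipe running into the rectangle
  has crossed one of the two, so inversions compose.\<close>

lemma inverse_chute:
  assumes lab: "labeling D t r" and D: "pipe_dream D" and red: "reduced D"
    and "(a, d) \<notin> D" and "1 \<le> a" and "1 \<le> d" and "inverted (\<lambda>i. r i 0) (t a d) (r a d)"
  shows "\<exists>a' b' c' d'. a \<le> a' \<and> d' \<le> d \<and> a' < b' \<and> 1 \<le> c' \<and> c' < d' \<and>
    {a'..b'} \<times> {c'..d'} - D = {(a', c'), (a', d'), (b', d')}"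
proof -
  define inv where "inv = inverted (\<lambda>i. r i 0)"
  have bij: "bij_betw (\<lambda>i. r i 0) {1..} {1..}" by (rule labeling_exits_bij[OF lab D])
  then have inj: "inj_on (\<lambda>i. r i 0) {1..}" by (simp add: bij_betw_def)
  have trans: "inv p h" if "inv p q" "inv q h" for p q h
    using inverted_trans[OF inj] that unfolding inv_def by blast
  have cross: "inv (t i j) (r i j)" if "(i, j) \<in> D" for i j
    using crossing_inverted[OF lab D red that] by (simp add: inv_def)
  have "finite (fst ` D)" using D by (simp add: pipe_dream_def)
  then obtain N where "\<forall>x\<in>fst ` D. x \<le> N" by (meson finite_nat_set_iff_bounded_le)
  then have N: "\<And>i j. (i, j) \<in> D \<Longrightarrow> i \<le> N" by force
  \<comment> \<open>Below the last cross, the pipe entering a cell from above leaves before the one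
    entering from the right, so the two are not inverted. This makes \<open>N - a\<close> usable in
    the induction.\<close>
  have bound: "i \<le> N" if ij: "1 \<le> i" "1 \<le> j" "(i, j) \<notin> D" "inv (t i j) (r i j)" for i j
  proof (rule ccontr)
    assume n: "\<not> i \<le> N"
    have "t i j = r i (j - 1)" using labelingD(4)[OF lab ij(1,2)] ij by simp
    also have "\<dots> = r (i + (j - 1)) 0" using n by (intro labeling_exit(3)[OF lab N]) (use ij in auto)
    finally have 1: "t i j = r (i + (j - 1)) 0" .
    have 2: "r i j = r (i + j) 0" using n by (intro labeling_exit(3)[OF lab N]) (use ij in auto)
    obtain i1 i2 where k: "1 \<le> i1" "i1 < i2" "r i1 0 = r i j" "r i2 0 = t i j"
      using ij(4) by (auto simp: inv_def inverted_def)
    have "i1 = i + j" using inj_onD[OF inj, of i1 "i + j"] k 2 ij by auto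
    moreover have "i2 = i + (j - 1)" using inj_onD[OF inj, of i2 "i + (j - 1)"] k 1 ij by auto
    ultimately show False using k by simp
  qed
  have "(a, d) \<notin> D \<Longrightarrow> 1 \<le> a \<Longrightarrow> 1 \<le> d \<Longrightarrow> inv (t a d) (r a d) \<Longrightarrow>
    \<exists>a' b' c' d'. a \<le> a' \<and> d' \<le> d \<and> a' < b' \<and> 1 \<le> c' \<and> c' < d' \<and>
    {a'..b'} \<times> {c'..d'} - D = {(a', c'), (a', d'), (b', d')}" for a d
  proof (induction "d + (N - a)" arbitrary: a d rule: less_induct)
    case less
    note elbow = less.prems(1) and a = less.prems(2) and d = less.prems(3)
    define p q where "p = t a d" and "q = r a d"
    have pq: "inv p q" using less.prems by (simp add: p_def q_def)
    have smaller: ?case if y: "(i, j) \<notin> D" "a \<le> i" "1 \<le> j" "j \<le> d" "(i, j) \<noteq> (a, d)"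
      "inv (t i j) (r i j)" for i j
    proof -
      have "i \<le> N" using bound[of i j] y a by simp
      then have "j + (N - i) < d + (N - a)" using y by (auto simp: prod_eq_iff)
      then have "\<exists>a' b' c' d'. i \<le> a' \<and> d' \<le> j \<and> a' < b' \<and> 1 \<le> c' \<and> c' < d' \<and>
        {a'..b'} \<times> {c'..d'} - D = {(a', c'), (a', d'), (b', d')}"
        using less.hyps[of j i] y a by auto
      then obtain a' b' c' d' where "i \<le> a'" "d' \<le> j" and *: "a' < b' \<and> 1 \<le> c' \<and> c' < d' \<and>
        {a'..b'} \<times> {c'..d'} - D = {(a', c'), (a', d'), (b', d')}" by blast
      then have "a \<le> a'" "d' \<le> d" using y by auto
      then show ?thesis using * by blast
    qed
    obtain i1 i2 where i12: "1 \<le> i1" "i1 < i2" "r i1 0 = q" "r i2 0 = p"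
      using pq by (auto simp: inv_def inverted_def)
    define C where "C = {j. 1 \<le> j \<and> j < d \<and> (a, j) \<notin> D}"
    have rd: "r a (d - 1) = p" using labelingD(4)[OF lab a d elbow] by (simp add: p_def)
    \<comment> \<open>Without a further elbow joint \<open>p\<close> would leave from row
      \<open>a\<close> itself, while \<open>q\<close> leaves from row \<open>a\<close> or below,
      contrary to the inversion.\<close>
    have "C \<noteq> {}"
    proof
      assume "C = {}"
      then have "r a 0 = r a (d - 1)" using d by (intro row_run[OF lab a]) (auto simp: C_def)
      then have "i2 = a" using inj_onD[OF inj, of i2 a] rd i12 a by simp
      moreover have "\<exists>i'\<ge>a. r i' 0 = r a d" by (rule labeling_exit(1)[OF lab _ a]) (rule N)
      then obtain i' where i': "i' \<ge> a" "r i' 0 = q" unfolding q_def by blast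
      moreover have "i' = i1" using inj_onD[OF inj, of i' i1] i' i12 a by simp
      ultimately show False using i12 by simp
    qed
    moreover have finC: "finite C" by (auto simp: C_def)
    ultimately have "Max C \<in> C" by simp
    define c where "c = Max C"
    have c: "1 \<le> c" "c < d" "(a, c) \<notin> D" using \<open>Max C \<in> C\<close> by (auto simp: c_def C_def)
    have row_a: "(a, j) \<in> D" if "c < j" "j < d" for j
    proof (rule ccontr)
      assume "(a, j) \<notin> D"
      then have "j \<in> C" using that c(1) by (auto simp: C_def)
      then show False using Max_ge[OF finC, of j] that(1) by (simp add: c_def)
    qed
    define B where "B = {i. a < i \<and> (i, d) \<notin> D}"
    have "Suc (max a N) \<in> B" using N[of "Suc (max a N)" d] by (auto simp: B_def)
    define b where "b = (LEAST i. i \<in> B)"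
    have "b \<in> B" unfolding b_def by (rule LeastI) (rule \<open>Suc (max a N) \<in> B\<close>)
    then have b: "a < b" "(b, d) \<notin> D" by (auto simp: B_def)
    have col_d: "(i, d) \<in> D" if "a < i" "i < b" for i
      using not_less_Least[of i "\<lambda>i. i \<in> B"] that by (auto simp: b_def B_def)
    have ra: "r a j = p" if "c \<le> j" "j < d" for j
      using row_run[OF lab a, of j "d - 1"] row_a rd that by auto
    have "t (Suc a) d = q" using labelingD(3)[OF lab a d] elbow by (simp add: q_def)
    then have td: "t i d = q" if "a < i" "i \<le> b" for i
      using column_run[OF lab _ d, of "Suc a" i] col_d that a by auto
    have "t (Suc a) c = p" using labelingD(3)[OF lab a c(1)] c ra by simp
    moreover have "r b (d - 1) = q" using labelingD(4)[OF lab _ d b(2)] b a td by simp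
    note tc = calculation and rb = this
    show ?case
    proof (cases "\<exists>i j. a < i \<and> i < b \<and> c < j \<and> j < d \<and> (i, j) \<notin> D")
      case True
      \<comment> \<open>Take the highest interior elbow joint, rightmost in its row. Above it and to
        its right there are only crosses inside the rectangle, so its pipes cross \<open>p\<close>
        in row \<open>a\<close> and \<open>q\<close> in column \<open>d\<close>.\<close>
      define i where "i = (LEAST i. \<exists>j. a < i \<and> i < b \<and> c < j \<and> j < d \<and> (i, j) \<notin> D)"
      have ex: "\<exists>j. a < i \<and> i < b \<and> c < j \<and> j < d \<and> (i, j) \<notin> D"
        unfolding i_def by (rule LeastI_ex) (rule True)
      have above: "(i', j) \<in> D" if "a < i'" "i' < i" "c < j" "j < d" for i' j
        using not_less_Least[OF that(2)[unfolded i_def]] that ex by auto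
      define J where "J = {j. c < j \<and> j < d \<and> (i, j) \<notin> D}"
      have J: "finite J" "J \<noteq> {}" using ex by (auto simp: J_def)
      define j where "j = Max J"
      have "j \<in> J" using J by (simp add: j_def)
      then have j: "c < j" "j < d" "(i, j) \<notin> D" by (auto simp: J_def)
      have i: "a < i" "i < b" using ex by auto
      have right: "(i, j') \<in> D" if "j < j'" "j' \<le> d" for j'
      proof (rule ccontr)
        assume n: "(i, j') \<notin> D"
        then have "j' \<noteq> d" using col_d[OF i] by auto
        then have "j' \<in> J" using that n j by (auto simp: J_def)
        then show False using Max_ge[OF J(1), of j'] that(1) by (simp add: j_def)
      qed
      have "(i', j) \<in> D" if "a \<le> i'" "i' < i" for i'
        using row_a[of j] above[of i' j] that j by (cases "i' = a") auto
      then have "t i j = t a j" using i j c a by (intro column_run[OF lab]) auto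
      moreover have "r i j = r i d" using i j a right by (intro row_run[OF lab]) auto
      moreover have "inv (t a j) p" using cross[OF row_a[OF j(1,2)]] ra[of j] j by simp
      moreover have "inv q (r i d)" using cross[OF col_d[OF i]] td[of i] i by simp
      ultimately have "inv (t i j) (r i j)" using trans pq by metis
      then show ?thesis using smaller[of i j] i j c by auto
    next
      case False
      then have interior: "(i, j) \<in> D" if "a < i" "i < b" "c < j" "j < d" for i j using that
        by blast
      show ?thesis
      proof (cases "\<exists>j. c < j \<and> j < d \<and> (b, j) \<notin> D")
        case True
        define J where "J = {j. c < j \<and> j < d \<and> (b, j) \<notin> D}"
        have J: "finite J" "J \<noteq> {}" using True by (auto simp: J_def)
        define j where "j = Max J"
        have "j \<in> J" using J by (simp add: j_def)
        then have j: "c < j" "j < d" "(b, j) \<notin> D" by (auto simp: J_def)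
        have right: "(b, j') \<in> D" if "j < j'" "j' < d" for j'
        proof (rule ccontr)
          assume n: "(b, j') \<notin> D"
          then have "j' \<in> J" using that n j by (auto simp: J_def)
          then show False using Max_ge[OF J(1), of j'] that(1) by (simp add: j_def)
        qed
        have "(i', j) \<in> D" if "a \<le> i'" "i' < b" for i'
          using row_a[of j] interior[of i' j] that j by (cases "i' = a") auto
        then have "t b j = t a j" using b j c a by (intro column_run[OF lab]) auto
        moreover have "r b j = r b (d - 1)" using b j a right by (intro row_run[OF lab]) auto
        moreover have "inv (t a j) p" using cross[OF row_a[OF j(1,2)]] ra[of j] j by simp
        ultimately have "inv (t b j) (r b j)" using trans pq rb by metis
        then show ?thesis using smaller[of b j] b j c by auto
      next
        case nJ: False
        then have row_b: "(b, j) \<in> D" if "c < j" "j < d" for j using that by blast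
        show ?thesis
        proof (cases "\<exists>i. a < i \<and> i < b \<and> (i, c) \<notin> D")
          case True
          define i where "i = (LEAST i. a < i \<and> i < b \<and> (i, c) \<notin> D)"
          have i: "a < i" "i < b" "(i, c) \<notin> D" using LeastI_ex[OF True] by (auto simp: i_def)
          have above: "(i', c) \<in> D" if "a < i'" "i' < i" for i'
            using not_less_Least[OF that(2)[unfolded i_def]] that i by auto
          have "(i, j') \<in> D" if "c < j'" "j' \<le> d" for j'
            using col_d[OF i(1,2)] interior[of i j'] that i by (cases "j' = d") auto
          then have "r i c = r i d" using i c a by (intro row_run[OF lab]) auto
          moreover have "t i c = t (Suc a) c" using i c a above by (intro column_run[OF lab]) auto
          moreover have "inv q (r i d)" using cross[OF col_d[OF i(1,2)]] td[of i] i by simp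
          ultimately have "inv (t i c) (r i c)" using trans pq tc by metis
          then show ?thesis using smaller[of i c] i c by auto
        next
          case nI: False
          then have col_c: "(i, c) \<in> D" if "a < i" "i < b" for i using that by blast
          show ?thesis
          proof (cases "(b, c) \<in> D")
            case False
            \<comment> \<open>At this corner \<open>p\<close> and \<open>q\<close> touch once more,
              further to the south-west.\<close>
            have "t b c = p" using column_run[OF lab _ c(1), of "Suc a" b] tc col_c b a by auto
            moreover have "r b c = q" using row_run[OF lab, of b c "d - 1"] rb row_b b a c by auto
            ultimately show ?thesis using smaller[of b c] False b c pq by auto
          next
            case True
            have "{a..b} \<times> {c..d} - D = {(a, c), (a, d), (b, d)}"
            proof (intro equalityI subsetI)
              fix x assume x: "x \<in> {a..b} \<times> {c..d} - D"
              then obtain i j where x': "x = (i, j)" "a \<le> i" "i \<le> b" "c \<le> j" "j \<le> d" "(i, j) \<notin> D"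
                by auto
              then show "x \<in> {(a, c), (a, d), (b, d)}"
                using True row_a[of j] row_b[of j] col_c[of i] col_d[of i] interior[of i j]
                by (auto simp: le_less)
            qed (use elbow b c in auto)
            then show ?thesis using b c by blast
          qed
        qed
      qed
    qed
  qed
  then show ?thesis using assms by (simp add: inv_def)
qed

section \<open>Transposition and the interval\<close>

lemma flip_mono [simp]: "flip A \<subseteq> flip B \<longleftrightarrow> A \<subseteq> B"
  by (auto simp: flip_def)

lemma flip_Diff: "flip (A - B) = flip A - flip B"
  by auto

lemma flip_Times [simp]: "flip (A \<times> B) = B \<times> A"
  by auto

lemma card_flip [simp]: "card (flip A) = card A"
  unfolding flip_def by (intro card_image) (auto simp: inj_on_def)

lemma ne_set_flip [simp]: "ne_set (flip S) \<longleftrightarrow> ne_set S"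
proof -
  have "ne_set (flip S)" if "ne_set S" for S
    using that unfolding ne_set_def flip_def north_east_of_def by fastforce
  from this[of S] this[of "flip S"] show ?thesis by auto
qed

lemma chain_free_flip [simp]: "chain_free (flip M) k (flip D) \<longleftrightarrow> chain_free M k D"
proof -
  have "chain_free (flip M) k (flip D)" if "chain_free M k D" for M D
    unfolding chain_free_def
  proof (intro conjI allI impI)
    show "flip D \<subseteq> flip M" using that by (simp add: chain_free_def)
    fix a b c d S
    assume *: "{a..b} \<times> {c..d} \<subseteq> flip M" "ne_set S" "S \<subseteq> {a..b} \<times> {c..d} - flip D"
    then have "flip ({a..b} \<times> {c..d}) \<subseteq> flip (flip M)" "flip S \<subseteq> flip ({a..b} \<times> {c..d} - flip D)"
      by (simp_all only: flip_mono)
    then have "{c..d} \<times> {a..b} \<subseteq> M" "flip S \<subseteq> {c..d} \<times> {a..b} - D" by (simp_all add: flip_Diff)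
    then have "card (flip S) \<le> k" using that *(2) unfolding chain_free_def by (metis ne_set_flip)
    then show "card S \<le> k" by simp
  qed
  from this[of M D] this[of "flip M" "flip D"] show ?thesis by auto
qed

lemma facets_flip [simp]: "flip D \<in> facets (flip M) k \<longleftrightarrow> D \<in> facets M k"
proof -
  have "flip D - {prod.swap x} = flip (D - {x})" for x by (cases x) auto
  then have "chain_free (flip M) k (flip D - {prod.swap x}) \<longleftrightarrow> chain_free M k (D - {x})" for x
    by (metis chain_free_flip)
  moreover have "(\<forall>x\<in>flip D. P x) \<longleftrightarrow> (\<forall>x\<in>D. P (prod.swap x))" for P by (simp add: flip_def)
  ultimately show ?thesis by (simp add: facets_def)
qed

text \<open>After a move the elbow corners are north-west, north-east and south-east; transposed,
  they are those of a chutable rectangle. Hence the direction is reversed.\<close>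

lemma chute_move_flip:
  assumes "chute_move E D"
  shows "chute_move (flip D) (flip E)"
proof -
  obtain a b c d where ch: "chutable E a b c d" and D: "D = insert (b, c) (E - {(a, d)})"
    using assms unfolding chute_move_def by blast
  note c = chutable_cells[OF ch]
  have "{c..d} \<times> {a..b} - flip D = {(c, a), (d, a), (d, b)}"
  proof (intro equalityI subsetI)
    fix x assume "x \<in> {c..d} \<times> {a..b} - flip D"
    then obtain i j where "x = (j, i)" "a \<le> i" "i \<le> b" "c \<le> j" "j \<le> d" "(i, j) \<notin> D" by auto
    then show "x \<in> {(c, a), (d, a), (d, b)}" using c(8)[of i j] D by auto
  qed (use c D in auto)
  then have "chutable (flip D) c d a b" using c by (simp add: chutable_def)
  moreover have "(a, d) \<in> E" using c by auto
  then have "flip E = insert (d, a) (flip D - {(c, b)})" using c D by auto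
  ultimately show ?thesis unfolding chute_move_def by blast
qed

section \<open>Chute moves between maximal fillings\<close>

context moon_shape
begin

lemma moon_flip: "moon_shape (flip M)"
proof
  show "finite (flip M)" using finite_M by (simp add: flip_def)
  show "flip M \<subseteq> grid" using M_grid by (auto simp: flip_def grid_def)
qed (auto intro: row_convex col_convex dest: corner)

lemma facet_card: "D \<in> facets M k \<Longrightarrow> card D = card (erosion M k)"
proof -
  assume D: "D \<in> facets M k"
  obtain t r where lab: "labeling D t r" using labeling_exists[OF facet_pipe_dream[OF D]] by blast
  obtain t' r' where labE: "labeling (erosion M k) t' r'"
    using labeling_exists[OF erosion_pipe_dream] by blast
  have "inversion_pairs (\<lambda>i. r i 0) = inversion_pairs (\<lambda>i. r' i 0)"
    using facet_exits[OF D lab labE] by (rule inversion_pairs_cong)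
  then show ?thesis
    using reduced_card[OF lab facet_pipe_dream[OF D] facet_reduced[OF D]]
      reduced_card[OF labE erosion_pipe_dream erosion_reduced] by simp
qed

text \<open>Otherwise a chain through the cell could be continued by the south-west corner of a largest
  rectangle, all of whose cells are ones of the topmost filling.\<close>

lemma first_difference_in_erosion:
  assumes D: "D \<in> facets M k" and y: "(a, d) \<in> D"
    and agree: "\<And>i j. i < a \<Longrightarrow> (i, j) \<in> D \<longleftrightarrow> (i, j) \<in> erosion M k"
  shows "(a, d) \<in> erosion M k"
proof (rule ccontr)
  assume nE: "(a, d) \<notin> erosion M k"
  have "\<not> chain_free M k (D - {(a, d)})" "D \<subseteq> M" and cf: "chain_free M k D"
    using D y facet_subset[OF D] by (auto simp: facets_def)
  then obtain a0 b0 c0 d0 S where R0: "{a0..b0} \<times> {c0..d0} \<subseteq> M" and S: "ne_set S"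
      "S \<subseteq> {a0..b0} \<times> {c0..d0} - (D - {(a, d)})" "k < card S"
    unfolding chain_free_def by (auto simp: not_le)
  have yS: "(a, d) \<in> S"
  proof (rule ccontr)
    assume "(a, d) \<notin> S"
    then have "S \<subseteq> {a0..b0} \<times> {c0..d0} - D" using S(2) by blast
    then show False using cf R0 S(1,3) unfolding chain_free_def by (meson not_le)
  qed
  then have "a0 \<le> b0" "c0 \<le> d0" using S by force+
  then obtain a1 b1 c1 d1 where R: "largest_rectangle M a1 b1 c1 d1"
    and le: "a1 \<le> a0" "b0 \<le> b1" "c1 \<le> c0" "d0 \<le> d1"
    using largest_rectangle_exists[OF R0] by metis
  have RM: "{a1..b1} \<times> {c1..d1} \<subseteq> M" using R by (simp add: largest_rectangle_def)
  have SR: "a1 \<le> fst x \<and> fst x \<le> b1 \<and> c1 \<le> snd x \<and> snd x \<le> d1" if "x \<in> S" for x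
    using S(2) le that by fastforce
  define S1 S2 where "S1 = {x \<in> S. north_east_of x (a, d)}"
    and "S2 = {x \<in> S. north_east_of (a, d) x}"
  have s12: "ne_set S1" "ne_set S2" using S(1) by (auto intro: ne_set_subset simp: S1_def S2_def)
  have "S = S1 \<union> ({(a, d)} \<union> S2)" using S(1) yS by (auto simp: S1_def S2_def ne_set_def)
  then have "card S \<le> card S1 + (1 + card S2)"
    using card_Un_le[of S1 "{(a, d)} \<union> S2"] card_Un_le[of "{(a, d)}" S2] by simp
  \<comment> \<open>The cap \<open>k\<close> costs nothing: \<open>k\<close> corner cells together
    with \<open>(a, d)\<close> already form a chain that is too long.\<close>
  moreover define s where "s = min k (card S2)"
  define T where "T = (\<lambda>l. (b1 - l, c1 + l)) ` {..<s}"
  have "S2 \<subseteq> {Suc a..b1} \<times> {c1..d - 1}"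
  proof
    fix x assume "x \<in> S2"
    then show "x \<in> {Suc a..b1} \<times> {c1..d - 1}" using SR[of x]
      by (cases x) (auto simp: S2_def north_east_of_def)
  qed
  then have s: "s \<le> b1 - a" "s \<le> d - c1"
    using ne_set_card_box[OF s12(2), of "Suc a" b1 c1 "d - 1"] SR[OF yS] M_pos[of a d] y \<open>D \<subseteq> M\<close>
    by (auto simp: s_def)
  have T: "ne_set T" "card T = s" unfolding T_def using s by (intro ne_set_sequence; linarith)+
  have TR: "x \<in> {a1..b1} \<times> {c1..d1} \<and> north_east_of (a, d) x \<and> x \<notin> erosion M k" if "x \<in> T" for x
  proof -
    obtain l where l: "l < s" "x = (b1 - l, c1 + l)" using \<open>x \<in> T\<close> by (auto simp: T_def)
    then show ?thesis using s SR[OF yS] erosion_corner[OF R, of l k]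
      by (auto simp: north_east_of_def s_def)
  qed
  have n2: "north_east_of x z" if "x \<in> {(a, d)}" "z \<in> T" for x z using TR that by auto
  have n1: "north_east_of x z" if "x \<in> S1" "z \<in> {(a, d)} \<union> T" for x z
    using TR[of z] that by (auto simp: S1_def north_east_of_def)
  have S1E: "x \<notin> erosion M k" if "x \<in> S1" for x
  proof -
    have "fst x < a" "x \<in> S" "x \<noteq> (a, d)" using that by (auto simp: S1_def north_east_of_def)
    then have "x \<notin> D" using S(2) by blast
    then show ?thesis using agree[OF \<open>fst x < a\<close>, of "snd x"] by simp
  qed
  have "S1 \<union> ({(a, d)} \<union> T) \<subseteq> {a1..b1} \<times> {c1..d1} - erosion M k"
  proof
    fix x assume "x \<in> S1 \<union> ({(a, d)} \<union> T)"
    then consider "x \<in> S1" | "x = (a, d)" | "x \<in> T" by blast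
    then show "x \<in> {a1..b1} \<times> {c1..d1} - erosion M k"
    proof cases
      case 1
      then have "x \<in> S" by (simp add: S1_def)
      then show ?thesis using SR[of x] S1E[OF 1] by (cases x) auto
    next
      case 2
      then show ?thesis using SR[OF yS] nE by auto
    next
      case 3
      then show ?thesis using TR by blast
    qed
  qed
  moreover have "ne_set (S1 \<union> ({(a, d)} \<union> T))" "card (S1 \<union> ({(a, d)} \<union> T)) = card S1 + (1 + s)"
    using ne_set_Un[OF s12(1) ne_set_Un(1)[OF ne_set_cell T(1) n2] n1] ne_set_Un(2)[OF ne_set_cell
      T(1) n2] T(2)
    by simp_all
  ultimately have "card S1 + (1 + s) \<le> k"
    using erosion_chain_free[of k] RM unfolding chain_free_def by metis
  then show False using \<open>card S \<le> card S1 + (1 + card S2)\<close> S(3)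
    by (auto simp: s_def min_def split: if_splits)
qed

lemma facet_ascent:
  assumes D: "D \<in> facets M k" and ne: "D \<noteq> erosion M k"
  obtains D' where "D' \<in> facets M k" and "chute_move D' D" and "sum fst D' < sum fst D"
proof -
  define E where "E = erosion M k"
  have E: "E \<in> facets M k" "pipe_dream E" "reduced E" "E \<subseteq> M"
    unfolding E_def by (rule erosion_facet erosion_pipe_dream erosion_reduced erosion_subset)+
  have pD: "pipe_dream D" "reduced D" "D \<subseteq> M"
    using facet_pipe_dream[OF D] facet_reduced[OF D] facet_subset[OF D] by auto
  obtain t r where lab: "labeling D t r" using labeling_exists[OF pD(1)] by blast
  obtain t' r' where labE: "labeling E t' r'" using labeling_exists[OF E(2)] by blast
  have w: "r i 0 = r' i 0" if "i \<ge> 1" for i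
    using facet_exits[OF D lab labE[unfolded E_def] that] .
  define \<Delta> where "\<Delta> = (D - E) \<union> (E - D)"
  have \<Delta>: "finite \<Delta>" "\<Delta> \<noteq> {}" using pD(1) E(2) ne by (auto simp: \<Delta>_def pipe_dream_def E_def)
  define a where "a = Min (fst ` \<Delta>)"
  have a: "a \<in> fst ` \<Delta>" "\<And>y. y \<in> \<Delta> \<Longrightarrow> a \<le> fst y" using \<Delta> by (auto simp: a_def)
  define C where "C = {j. (a, j) \<in> \<Delta>}"
  have "C \<subseteq> snd ` \<Delta>" by (force simp: C_def)
  then have C: "finite C" "C \<noteq> {}" using \<Delta> a(1) finite_subset by (auto simp: C_def)
  define d where "d = Max C"
  have d: "d \<in> C" "\<And>y. y \<in> C \<Longrightarrow> y \<le> d" using C by (auto simp: d_def)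
  have agree: "(i, j) \<in> D \<longleftrightarrow> (i, j) \<in> E" if "i < a \<or> i = a \<and> d < j" for i j
  proof (rule ccontr)
    assume "\<not> ((i, j) \<in> D \<longleftrightarrow> (i, j) \<in> E)"
    then have "(i, j) \<in> \<Delta>" by (auto simp: \<Delta>_def)
    then show False using that a(2)[of "(i, j)"] d(2)[of j] by (auto simp: C_def)
  qed
  have y: "(a, d) \<in> E" "(a, d) \<notin> D"
  proof -
    have "(a, d) \<in> \<Delta>" using d(1) by (simp add: C_def)
    moreover have "(a, d) \<in> D \<Longrightarrow> (a, d) \<in> E"
      using first_difference_in_erosion[OF D] agree unfolding E_def by blast
    ultimately show "(a, d) \<in> E" "(a, d) \<notin> D" by (auto simp: \<Delta>_def)
  qed
  have yM: "(a, d) \<in> M" using y E(4) by blast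
  then have pos: "1 \<le> a" "1 \<le> d" using M_pos by auto
  \<comment> \<open>All cells read before \<open>(a, d)\<close> agree, so the same two pipes arrive
    there in both; they cross at this cell in \<open>E\<close>, hence are inverted.\<close>
  have "t a d = t' a d" "r a d = r' a d"
    using labeling_agree[OF lab labE, of a] agree pos by auto
  moreover have "inverted (\<lambda>i. r' i 0) (t' a d) (r' a d)"
    using crossing_inverted[OF labE E(2,3) y(1)] .
  ultimately have "inverted (\<lambda>i. r i 0) (t a d) (r a d)"
    using w unfolding inverted_def by (metis less_imp_le_nat order_trans)
  from inverse_chute[OF lab pD(1,2) y(2) pos this]
  obtain a' b' c' d' where le: "a \<le> a'" "d' \<le> d" and b': "a' < b'" "1 \<le> c'" "c' < d'"
    and rect: "{a'..b'} \<times> {c'..d'} - D = {(a', c'), (a', d'), (b', d')}" by blast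
  have el: "(a', c') \<notin> D" "(a', d') \<notin> D" "(b', d') \<notin> D" using rect by blast+
  have cr: "(i, j) \<in> D" if "a' \<le> i" "i \<le> b'" "c' \<le> j" "j \<le> d'" "(i, j) \<noteq> (a', c')"
    "(i, j) \<noteq> (a', d')" "(i, j) \<noteq> (b', d')" for i j
  proof -
    have "(i, j) \<in> {a'..b'} \<times> {c'..d'}" "(i, j) \<notin> {(a', c'), (a', d'), (b', d')}" using that by auto
    then show ?thesis unfolding rect[symmetric] by blast
  qed
  have bc: "(b', c') \<in> D" using cr[of b' c'] b' by auto
  define D' where "D' = insert (a', d') (D - {(b', c')})"
  have "{a'..b'} \<times> {c'..d'} - D' = {(a', c'), (b', c'), (b', d')}"
  proof (intro equalityI subsetI)
    fix x assume "x \<in> {a'..b'} \<times> {c'..d'} - D'"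
    then obtain i j where "x = (i, j)" "a' \<le> i" "i \<le> b'" "c' \<le> j" "j \<le> d'" "(i, j) \<notin> D'" by auto
    then show "x \<in> {(a', c'), (b', c'), (b', d')}" using cr[of i j] by (auto simp: D'_def)
  qed (use el b' in \<open>auto simp: D'_def\<close>)
  then have ch: "chutable D' a' b' c' d'" using pos le b' by (simp add: chutable_def)
  have D_eq: "D = insert (b', c') (D' - {(a', d')})" using bc el b' by (auto simp: D'_def)
  have pD': "pipe_dream D'" using pD(1) pos le b' by (auto simp: D'_def pipe_dream_def grid_def)
  have fin: "finite D" using pD(1) by (simp add: pipe_dream_def)
  have card: "card D' = card D"
    using card.remove[OF fin bc] fin el by (simp add: D'_def)
  obtain t2 r2 where lab2: "labeling D' t2 r2" using labeling_exists[OF pD'] by blast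
  obtain t3 r3 where lab3: "labeling D t3 r3" and r3: "\<And>i. r3 i 0 = r2 i 0"
    using chute_labeling[OF lab2 ch] D_eq by metis
  have w2: "r2 i 0 = r' i 0" if "i \<ge> 1" for i
    using labeling_unique(2)[OF lab3 lab that, of 0] r3[of i] w[OF that] by simp
  have cE: "card D = card E" using facet_card[OF D] by (simp add: E_def)
  have "card D' = card (inversion_pairs (\<lambda>i. r2 i 0))"
    using card cE reduced_card[OF labE E(2,3)] inversion_pairs_cong[OF w2] by simp
  then have red: "reduced D'" by (rule reduced_if_card[OF lab2 pD'])
  \<comment> \<open>Only the new cross \<open>(a', d')\<close> could leave \<open>M\<close>. If it
    were north-east of a largest rectangle, so would be \<open>(a, d) \<in> M\<close>; if
    south-west, so would be \<open>(b', c') \<in> M\<close>.\<close>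
  have "D' \<subseteq> M"
  proof (rule confinement[OF pD' red lab2 labE[unfolded E_def] w2])
    fix A B C G i j
    assume R: "largest_rectangle M A B C G" and ij: "(i, j) \<in> D'"
    show "\<not> (i < A \<and> G < j) \<and> \<not> (B < i \<and> j < C)"
    proof (cases "(i, j) = (a', d')")
      case True
      have "(b', c') \<in> M" using bc pD(3) by blast
      then show ?thesis
        using True le b' largest_rectangle_quadrants(1)[OF R yM] largest_rectangle_quadrants(2)[OF
          R, of b' c'] by auto
    next
      case False
      then have "(i, j) \<in> M" using ij pD(3) by (auto simp: D'_def)
      then show ?thesis using largest_rectangle_quadrants[OF R] by blast
    qed
  qed
  then have "D' \<in> facets M k"
    using facetI[OF _ lab2 labE[unfolded E_def] w2] card cE by (simp add: E_def)
  moreover have "chute_move D' D" using ch D_eq unfolding chute_move_def by blast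
  moreover have "sum fst D' < sum fst D"
  proof -
    have "sum fst D = b' + sum fst (D - {(b', c')})" using bc fin by (simp add: sum.remove)
    moreover have "sum fst D' = a' + sum fst (D - {(b', c')})" using fin el by (simp add: D'_def)
    ultimately show ?thesis using b' by simp
  qed
  ultimately show thesis by (rule that)
qed

text \<open>Each inverse chute move lowers the total of the row numbers of the crosses, so the
  ascent can only stop at the erosion.\<close>

lemma facet_below_erosion:
  "D \<in> facets M k \<Longrightarrow> chute_move\<^sup>*\<^sup>* (erosion M k) D"
proof (induction "sum fst D" arbitrary: D rule: less_induct)
  case less
  show ?case
  proof (cases "D = erosion M k")
    case False
    then obtain D' where "D' \<in> facets M k" "chute_move D' D" "sum fst D' < sum fst D"
      using facet_ascent[OF less.prems] by blast
    then show ?thesis using less.hyps by (meson rtranclp.rtrancl_into_rtrancl)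
  qed simp
qed

text \<open>In the transposed shape chute moves descend from its erosion; transposing back reverses
  them.\<close>

lemma facet_above_flipped_erosion:
  assumes "D \<in> facets M k"
  shows "chute_move\<^sup>*\<^sup>* D (flip (erosion (flip M) k))"
proof -
  interpret F: moon_shape "flip M" by (rule moon_flip)
  have "chute_move\<^sup>*\<^sup>* (erosion (flip M) k) (flip D)"
    using F.facet_below_erosion[of "flip D" k] assms by simp
  then have "chute_move\<^sup>*\<^sup>* (flip (flip D)) (flip (erosion (flip M) k))"
  proof (induction rule: rtranclp_induct)
    case (step y z)
    then show ?case using chute_move_flip by (meson converse_rtranclp_into_rtranclp)
  qed simp
  then show ?thesis by simp
qed

lemma flipped_erosion_facet: "flip (erosion (flip M) k) \<in> facets M k"
proof -
  interpret F: moon_shape "flip M" by (rule moon_flip)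
  show ?thesis using F.erosion_facet[of k] facets_flip[of "flip (erosion (flip M) k)" M k] by simp
qed

end

text \<open>\<open>inv w i\<close> is the exit row of the pipe \<open>i\<close>, whereas
  \<open>r i 0\<close> is the pipe with exit row \<open>i\<close>: inverse descriptions of the same
  permutation.\<close>

lemma pipe_dream_for_iff:
  assumes "labeling D t r" and "pipe_dream D" and "w permutes {1..}"
  shows "pipe_dream_for w D \<longleftrightarrow> (\<forall>i\<ge>1. r i 0 = w i)"
proof -
  have 1: "w i \<ge> 1 \<longleftrightarrow> i \<ge> 1" for i using permutes_in_image[OF assms(3), of i] by simp
  have 2: "inv w i \<ge> 1 \<longleftrightarrow> i \<ge> 1" for i using permutes_in_image[OF permutes_inv[OF assms(3)], of i]
    by simp
  have "pipe_dream_for w D \<longleftrightarrow> (\<forall>i\<ge>1. r (inv w i) 0 = i)"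
    using assms(2) 2 labeling_enters(2)[OF assms(1,2)]
      by (auto simp: pipe_dream_for_def exits_from_row_def)
  also have "\<dots> \<longleftrightarrow> (\<forall>i\<ge>1. r i 0 = w i)"
  proof
    assume *: "\<forall>i\<ge>1. r (inv w i) 0 = i"
    show "\<forall>i\<ge>1. r i 0 = w i"
    proof (intro allI impI)
      fix i :: nat assume "1 \<le> i"
      then have "r (inv w (w i)) 0 = w i" using * 1 by blast
      then show "r i 0 = w i" using permutes_inverses(2)[OF assms(3)] by simp
    qed
  next
    assume *: "\<forall>i\<ge>1. r i 0 = w i"
    show "\<forall>i\<ge>1. r (inv w i) 0 = i"
    proof (intro allI impI)
      fix i :: nat assume "1 \<le> i"
      then have "r (inv w i) 0 = w (inv w i)" using * 2 by blast
      then show "r (inv w i) 0 = i" using permutes_inverses(1)[OF assms(3)] by simp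
    qed
  qed
  finally show ?thesis .
qed

lemma chute_south_west:
  assumes "chute_move E D"
  obtains a b c d where "a < b" and "c < d" and "(a, d) \<in> E" and "(b, c) \<notin> E"
    and "D = insert (b, c) (E - {(a, d)})"
proof -
  obtain a b c d where ch: "chutable E a b c d" and D: "D = insert (b, c) (E - {(a, d)})"
    using assms unfolding chute_move_def by blast
  then show thesis using chutable_cells[OF ch] that[of a b c d] by auto
qed

text \<open>A chute move shifts a cross to the south-west, so a descent cannot fill an empty
  north-east quadrant; dually, an ascent cannot fill an empty south-west one.\<close>

lemma chutes_avoid_north_east:
  assumes "chute_move\<^sup>*\<^sup>* E D" and "\<And>i j. (i, j) \<in> E \<Longrightarrow> \<not> (i < a \<and> d < j)"
  shows "(i, j) \<in> D \<Longrightarrow> \<not> (i < a \<and> d < j)"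
  using assms(1)
proof (induction arbitrary: i j rule: rtranclp_induct)
  case base
  then show ?case using assms(2) by blast
next
  case (step F G)
  obtain a' b' c' d' where "a' < b'" "c' < d'" "(a', d') \<in> F" "G = insert (b', c') (F - {(a', d')})"
    using chute_south_west[OF step.hyps(2)] by metis
  then show ?case using step.IH[of a' d'] step.IH[of i j] step.prems by auto
qed

lemma chutes_avoid_south_west:
  assumes "chute_move\<^sup>*\<^sup>* D E" and "\<And>i j. (i, j) \<in> E \<Longrightarrow> \<not> (b < i \<and> j < c)"
  shows "(i, j) \<in> D \<Longrightarrow> \<not> (b < i \<and> j < c)"
  using assms(1)
proof (induction arbitrary: i j rule: converse_rtranclp_induct)
  case base
  then show ?case using assms(2) by blast
next
  case (step F G)
  obtain a' b' c' d' where m: "a' < b'" "c' < d'" "(a', d') \<in> F"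
    "G = insert (b', c') (F - {(a', d')})"
    using chute_south_west[OF step.hyps(1)] by metis
  then have "(b', c') \<in> G" by simp
  then show ?case using m step.IH[of b' c'] step.IH[of i j] step.prems
    by (cases "(i, j) = (a', d')") auto
qed

context moon_shape
begin

lemma facets_permutation:
  obtains w where "w permutes {1..}" and "facets M k = {D \<in> RC w. D \<subseteq> M}"
    and "facets M k = chute_interval w (flip (erosion (flip M) k)) (erosion M k)"
proof -
  define E where "E = erosion M k"
  obtain t' r' where labE: "labeling (erosion M k) t' r'"
    using labeling_exists[OF erosion_pipe_dream] by blast
  \<comment> \<open>The exit permutation of the erosion; \<open>0\<close> is not a row and stays
    fixed.\<close>
  define w where "w i = (if i = 0 then 0 else r' i 0)" for i
  have bij: "bij_betw (\<lambda>i. r' i 0) {1..} {1..}"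
    by (rule labeling_exits_bij[OF labE erosion_pipe_dream])
  have w: "w permutes {1..}"
  proof (rule bij_imp_permutes)
    show "bij_betw w {1..} {1..}" using bij bij_betw_cong[of "{1..}" w "\<lambda>i. r' i 0" "{1..}"]
      by (auto simp: w_def)
    show "w x = x" if "x \<notin> {1..}" for x using that by (auto simp: w_def not_less_eq_eq)
  qed
  have exits: "pipe_dream_for w D \<longleftrightarrow> (\<forall>i\<ge>1. r i 0 = r' i 0)" if "labeling D t r" "pipe_dream D"
    for D t r
    using pipe_dream_for_iff[OF that w] by (auto simp: w_def)
  have sub: "D \<in> RC w" "D \<subseteq> M" if D: "D \<in> facets M k" for D
  proof -
    obtain t r where lab: "labeling D t r" using labeling_exists[OF facet_pipe_dream[OF D]] by blast
    show "D \<in> RC w"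
      using exits[OF lab facet_pipe_dream[OF D]] facet_exits[OF D lab labE] facet_reduced[OF D]
        by (simp add: RC_def)
  qed (rule facet_subset[OF that])
  have sup: "D \<in> facets M k" if D: "D \<in> RC w" "D \<subseteq> M" for D
  proof -
    have pD: "pipe_dream D" "reduced D" using D by (auto simp: RC_def pipe_dream_for_def)
    obtain t r where lab: "labeling D t r" using labeling_exists[OF pD(1)] by blast
    have ex: "\<And>i. i \<ge> 1 \<Longrightarrow> r i 0 = r' i 0" using exits[OF lab pD(1)] D by (simp add: RC_def)
    have "card D = card (erosion M k)"
      using reduced_card[OF lab pD] reduced_card[OF labE erosion_pipe_dream erosion_reduced]
        inversion_pairs_cong[OF ex] by simp
    then show ?thesis using facetI[OF D(2) lab labE ex] by blast
  qed
  have eq: "facets M k = {D \<in> RC w. D \<subseteq> M}" using sub sup by blast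
  have "facets M k = chute_interval w (flip (erosion (flip M) k)) (erosion M k)"
  proof (intro equalityI subsetI)
    fix D assume "D \<in> facets M k"
    then show "D \<in> chute_interval w (flip (erosion (flip M) k)) (erosion M k)"
      using sub facet_below_erosion facet_above_flipped_erosion
        by (simp add: chute_interval_def chute_le_def)
  next
    fix D assume "D \<in> chute_interval w (flip (erosion (flip M) k)) (erosion M k)"
    then have D: "D \<in> RC w" "chute_move\<^sup>*\<^sup>* (erosion M k) D"
      "chute_move\<^sup>*\<^sup>* D (flip (erosion (flip M) k))"
      by (auto simp: chute_interval_def chute_le_def)
    have pD: "pipe_dream D" "reduced D" using D by (auto simp: RC_def pipe_dream_for_def)
    obtain t r where lab: "labeling D t r" using labeling_exists[OF pD(1)] by blast
    have ex: "\<And>i. i \<ge> 1 \<Longrightarrow> r i 0 = r' i 0" using exits[OF lab pD(1)] D by (simp add: RC_def)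
    \<comment> \<open>Both ends of the interval lie in \<open>M\<close>. Descent from the upper end
      keeps the north-east quadrants empty, ascent from the lower end the south-west ones.\<close>
    have "D \<subseteq> M"
    proof (rule confinement[OF pD lab labE ex])
      fix a b c d i j
      assume R: "largest_rectangle M a b c d" and ij: "(i, j) \<in> D"
      have "\<not> (i < a \<and> d < j)"
        using largest_rectangle_quadrants(1)[OF R] erosion_subset
        by (intro chutes_avoid_north_east[OF D(2) _ ij]) blast
      moreover have "\<not> (b < i \<and> j < c)"
        using largest_rectangle_quadrants(2)[OF R] facet_subset[OF flipped_erosion_facet]
        by (intro chutes_avoid_south_west[OF D(3) _ ij]) blast
      ultimately show "\<not> (i < a \<and> d < j) \<and> \<not> (b < i \<and> j < c)" by blast
    qed
    then show "D \<in> facets M k" using sup D(1) by blast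
  qed
  then show thesis using that w eq by blast
qed

end

section \<open>Fillings\<close>

text \<open>For nonempty \<open>S\<close> the bounding box is itself one of the rectangles and
  contained in all others, so it is the hull.\<close>

lemma rectangle_hull_subset_iff:
  assumes "finite S"
  shows "rectangle hull S \<subseteq> M \<longleftrightarrow> (\<exists>a b c d. S \<subseteq> {a..b} \<times> {c..d} \<and> {a..b} \<times> {c..d} \<subseteq> M)"
proof
  assume hull: "rectangle hull S \<subseteq> M"
  show "\<exists>a b c d. S \<subseteq> {a..b} \<times> {c..d} \<and> {a..b} \<times> {c..d} \<subseteq> M"
  proof (cases "S = {}")
    case True
    then show ?thesis by (intro exI[of _ 1] exI[of _ 0]) auto
  next
    case False
    define R where "R = {Min (fst ` S)..Max (fst ` S)} \<times> {Min (snd ` S)..Max (snd ` S)}"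
    have SR: "S \<subseteq> R"
    proof
      fix x assume "x \<in> S"
      then have "Min (fst ` S) \<le> fst x" "fst x \<le> Max (fst ` S)" "Min (snd ` S) \<le> snd x"
        "snd x \<le> Max (snd ` S)"
        using assms by simp_all
      then show "x \<in> R" by (cases x) (simp add: R_def)
    qed
    have "R \<subseteq> T" if T: "S \<subseteq> T" "rectangle T" for T
    proof -
      obtain a b c d where abcd: "T = {a..b} \<times> {c..d}" using T(2) by (auto simp: rectangle_def)
      have "Min (fst ` S) \<in> fst ` S" "Max (fst ` S) \<in> fst ` S" "Min (snd ` S) \<in> snd ` S"
        "Max (snd ` S) \<in> snd ` S"
        using assms False by simp_all
      moreover have "fst ` S \<subseteq> {a..b}" "snd ` S \<subseteq> {c..d}" using T(1) unfolding abcd by auto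
      ultimately have "Min (fst ` S) \<in> {a..b}" "Max (fst ` S) \<in> {a..b}" "Min (snd ` S) \<in> {c..d}"
        "Max (snd ` S) \<in> {c..d}"
        by blast+
      then show ?thesis unfolding R_def abcd by auto
    qed
    then have "R \<subseteq> rectangle hull S" unfolding hull_def by blast
    then show ?thesis using SR hull unfolding R_def by blast
  qed
next
  assume "\<exists>a b c d. S \<subseteq> {a..b} \<times> {c..d} \<and> {a..b} \<times> {c..d} \<subseteq> M"
  then obtain a b c d where "S \<subseteq> {a..b} \<times> {c..d}" and M: "{a..b} \<times> {c..d} \<subseteq> M" by blast
  then have "rectangle hull S \<subseteq> {a..b} \<times> {c..d}" by (intro hull_minimal) (auto simp: rectangle_def)
  then show "rectangle hull S \<subseteq> M" using M by blast
qed

lemma ne_chain_iff: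
  "(\<exists>cs. ne_chain M F cs \<and> length cs = n) \<longleftrightarrow>
     (\<exists>a b c d S. {a..b} \<times> {c..d} \<subseteq> M \<and> ne_set S \<and> S \<subseteq> {a..b} \<times> {c..d} \<and> (\<forall>x\<in>S. F x = 1) \<and> card S = n)"
    (is "?L \<longleftrightarrow> ?R")
proof
  assume ?L
  then obtain cs where cs: "set cs \<subseteq> {x \<in> M. F x = 1}" "rectangle hull (set cs) \<subseteq> M"
      "sorted_wrt (\<lambda>x y. north_east_of x y \<or> north_east_of y x) cs" "length cs = n"
    by (auto simp: ne_chain_def)
  have nth: "north_east_of (cs ! i) (cs ! j) \<or> north_east_of (cs ! j) (cs ! i)"
    if "i < length cs" "j < length cs" "i \<noteq> j" for i j
    using cs(3) that unfolding sorted_wrt_iff_nth_less by (metis linorder_neqE_nat)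
  have "distinct cs"
    unfolding distinct_conv_nth using nth by (metis north_east_of_def less_irrefl)
  then have "card (set cs) = n" using cs(4) by (simp add: distinct_card)
  moreover have "ne_set (set cs)"
    unfolding ne_set_def
  proof (intro conjI ballI impI)
    fix x y assume "x \<in> set cs" "y \<in> set cs" "x \<noteq> y"
    then obtain i j where "i < length cs" "j < length cs" "x = cs ! i" "y = cs ! j" "i \<noteq> j"
      unfolding in_set_conv_nth by blast
    then show "north_east_of x y \<or> north_east_of y x" using nth by blast
  qed simp
  moreover obtain a b c d where "set cs \<subseteq> {a..b} \<times> {c..d}" "{a..b} \<times> {c..d} \<subseteq> M"
    using cs(2) rectangle_hull_subset_iff[of "set cs" M] by auto
  ultimately show ?R using cs(1) by blast
next
  assume ?R
  then obtain a b c d S where R: "{a..b} \<times> {c..d} \<subseteq> M" and S: "ne_set S" "S \<subseteq> {a..b} \<times> {c..d}"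
      "\<forall>x\<in>S. F x = 1" "card S = n" by blast
  have "finite S" using S(1) by (simp add: ne_set_def)
  then obtain cs where cs: "set cs = S" "distinct cs" using finite_distinct_list by blast
  have "sorted_wrt (\<lambda>x y. north_east_of x y \<or> north_east_of y x) cs"
    unfolding sorted_wrt_iff_nth_less
  proof (intro allI impI)
    fix i j assume ij: "i < j" "j < length cs"
    then have "cs ! i \<in> S" "cs ! j \<in> S" "cs ! i \<noteq> cs ! j" using cs
      by (auto simp: nth_eq_iff_index_eq)
    then show "north_east_of (cs ! i) (cs ! j) \<or> north_east_of (cs ! j) (cs ! i)"
      using S(1) by (simp add: ne_set_def)
  qed
  moreover have "rectangle hull (set cs) \<subseteq> M"
    using R S(1,2) rectangle_hull_subset_iff[of S M] unfolding cs(1) ne_set_def by blast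
  ultimately have "ne_chain M F cs" using cs R S by (auto simp: ne_chain_def)
  then show ?L using cs S(4) by (auto simp: distinct_card)
qed

lemma filling_one_iff:
  assumes "F \<in> fillings M" and "x \<in> M"
  shows "F x = 1 \<longleftrightarrow> x \<notin> filling_to_pipe_dream M F"
proof -
  have "F x \<in> {0, 1}" using assms by (auto simp: fillings_def)
  then show ?thesis using assms(2) by (auto simp: filling_to_pipe_dream_def)
qed

lemma filling_chain_free:
  assumes "F \<in> fillings M"
  shows "chain_free M k (filling_to_pipe_dream M F) \<longleftrightarrow> (\<forall>cs. ne_chain M F cs \<longrightarrow> length cs \<le> k)"
proof -
  have "(\<forall>cs. ne_chain M F cs \<longrightarrow> length cs \<le> k) \<longleftrightarrow> (\<forall>n. (\<exists>cs. ne_chain M F cs \<and> length cs = n) \<longrightarrow>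
    n \<le> k)"
    by blast
  also have "\<dots> \<longleftrightarrow> (\<forall>a b c d S. {a..b} \<times> {c..d} \<subseteq> M \<longrightarrow> ne_set S \<longrightarrow>
      S \<subseteq> {a..b} \<times> {c..d} \<and> (\<forall>x\<in>S. F x = 1) \<longrightarrow> card S \<le> k)"
    unfolding ne_chain_iff by blast
  also have "\<dots> \<longleftrightarrow> (\<forall>a b c d S. {a..b} \<times> {c..d} \<subseteq> M \<longrightarrow> ne_set S \<longrightarrow>
      S \<subseteq> {a..b} \<times> {c..d} - filling_to_pipe_dream M F \<longrightarrow> card S \<le> k)"
  proof -
    have "S \<subseteq> R \<and> (\<forall>x\<in>S. F x = 1) \<longleftrightarrow> S \<subseteq> R - filling_to_pipe_dream M F" if "R \<subseteq> M" for R S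
      using filling_one_iff[OF assms] that by blast
    then show ?thesis by (intro iff_allI imp_cong refl) simp
  qed
  finally show ?thesis by (auto simp: chain_free_def filling_to_pipe_dream_def)
qed

lemma filling_update:
  assumes "F \<in> fillings M" and "x \<in> M"
  shows "F(x := 1) \<in> fillings M"
    and "filling_to_pipe_dream M (F(x := 1)) = filling_to_pipe_dream M F - {x}"
  using assms by (auto simp: fillings_def filling_to_pipe_dream_def PiE_iff extensional_def)

text \<open>Maximality asks for a chain of length exactly \<open>k + 1\<close>, while
  \<open>chain_free\<close> fails as soon as some chain is longer than \<open>k\<close>. Subsets of
  a chain are chains in the same rectangle, so a long one can be cut down.\<close>

lemma F01ne_iff:
  assumes "F \<in> fillings M"
  shows "F \<in> F01ne M k \<longleftrightarrow> filling_to_pipe_dream M F \<in> facets M k"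
proof -
  have "(\<exists>cs. ne_chain M (F(x := 1)) cs \<and> length cs = k + 1) \<longleftrightarrow>
      \<not> chain_free M k (filling_to_pipe_dream M F - {x})" if "x \<in> M" for x
  proof -
    have "\<not> chain_free M k (filling_to_pipe_dream M F - {x}) \<longleftrightarrow> (\<exists>cs. ne_chain M (F(x := 1)) cs \<and>
      k < length cs)"
      using filling_chain_free[OF filling_update(1)[OF assms that], of k] filling_update(2)[OF
        assms that]
      by (auto simp: not_le)
    also have "\<dots> \<longleftrightarrow> (\<exists>cs. ne_chain M (F(x := 1)) cs \<and> length cs = k + 1)"
    proof
      assume "\<exists>cs. ne_chain M (F(x := 1)) cs \<and> k < length cs"
      then obtain n where "k + 1 \<le> n" "\<exists>cs. ne_chain M (F(x := 1)) cs \<and> length cs = n"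
        by (auto simp: Suc_le_eq)
      then obtain a b c d S where *: "{a..b} \<times> {c..d} \<subseteq> M" "ne_set S" "S \<subseteq> {a..b} \<times> {c..d}"
          "\<forall>y\<in>S. (F(x := 1)) y = 1" "k + 1 \<le> card S" unfolding ne_chain_iff by blast
      obtain T where "T \<subseteq> S" "ne_set T" "card T = k + 1" using ne_set_card_subset[OF *(2,5)]
        by blast
      then show "\<exists>cs. ne_chain M (F(x := 1)) cs \<and> length cs = k + 1"
        unfolding ne_chain_iff using * by (meson subset_iff)
    qed auto
    finally show ?thesis by blast
  qed
  then show ?thesis
    using assms filling_chain_free[OF assms, of k]
    by (auto simp: F01ne_def facets_def filling_to_pipe_dream_def)
qed

lemma filling_to_pipe_dream_inj: "inj_on (filling_to_pipe_dream M) (fillings M)"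
proof (rule inj_onI)
  fix F G assume FG: "F \<in> fillings M" "G \<in> fillings M"
    and eq: "filling_to_pipe_dream M F = filling_to_pipe_dream M G"
  have "F x = G x" if "x \<in> M" for x
  proof -
    have "F x \<in> {0, 1}" "G x \<in> {0, 1}" using FG that by (auto simp: fillings_def)
    moreover have "F x = 1 \<longleftrightarrow> G x = 1"
      using filling_one_iff[OF FG(1) that] filling_one_iff[OF FG(2) that] eq by simp
    ultimately show ?thesis by auto
  qed
  then show "F = G" using FG unfolding fillings_def by (intro PiE_ext)
qed

lemma filling_of_pipe_dream:
  assumes "D \<subseteq> M"
  shows "(\<lambda>x\<in>M. if x \<in> D then 0 else 1) \<in> fillings M"
    and "filling_to_pipe_dream M (\<lambda>x\<in>M. if x \<in> D then 0 else 1) = D"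
  using assms by (auto simp: fillings_def filling_to_pipe_dream_def)

lemma F01ne_image: "filling_to_pipe_dream M ` F01ne M k = facets M k"
proof (intro equalityI subsetI)
  fix D assume "D \<in> filling_to_pipe_dream M ` F01ne M k"
  then obtain F where "F \<in> F01ne M k" "D = filling_to_pipe_dream M F" by blast
  then show "D \<in> facets M k" using F01ne_iff[of F M k] by (auto simp: F01ne_def)
next
  fix D assume D: "D \<in> facets M k"
  then have "D \<subseteq> M" by (simp add: facets_def chain_free_def)
  note f = filling_of_pipe_dream[OF this]
  have "(\<lambda>x\<in>M. if x \<in> D then 0 else 1) \<in> F01ne M k" using F01ne_iff[OF f(1)] f(2) D by simp
  then show "D \<in> filling_to_pipe_dream M ` F01ne M k" using f(2) by (metis image_eqI)
qed

text \<open>A cell of \<open>D_top\<close> is a zero iff the square to its south-west can be grown to size \<open>k + 1\<close>: when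
  the growth gets stuck, a rectangle inside the current square touches the boundary of \<open>M\<close>.\<close>

lemma erosion_iff_D_top:
  assumes M: "M \<subseteq> grid" and x: "x \<in> M"
  shows "x \<in> erosion M k \<longleftrightarrow> D_top M k x = 0"
proof -
  obtain i j where ij: "x = (i, j)" by (cases x)
  have "x \<in> erosion M k \<longleftrightarrow> \<not> (\<exists>a b c d. x \<in> {a..b} \<times> {c..d} \<and> {a..b} \<times> {c..d} \<subseteq> M \<and>
       card {a..b} \<le> k \<and> card {c..d} \<le> k \<and> lower_left_on_boundary M b c)" (is "_ \<longleftrightarrow> \<not> ?B")
  proof
    assume "x \<in> erosion M k"
    then have sq: "{i..i + k} \<times> {j - k..j} \<subseteq> M" by (simp add: erosion_def ij)
    show "\<not> ?B"
    proof
      assume ?B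
      then obtain a b c d where *: "(i, j) \<in> {a..b} \<times> {c..d}" "{a..b} \<times> {c..d} \<subseteq> M"
          "card {a..b} \<le> k" "card {c..d} \<le> k" "lower_left_on_boundary M b c" unfolding ij by blast
      then have "Suc b \<le> i + k" "j \<le> c - 1 + k" "i \<le> b" "c \<le> j" by auto
      then have "(b, c - 1) \<in> {i..i + k} \<times> {j - k..j}" "(Suc b, c - 1) \<in> {i..i + k} \<times> {j - k..j}"
        "(Suc b, c) \<in> {i..i + k} \<times> {j - k..j}" by auto
      then have "(b, c - 1) \<in> M" "(Suc b, c - 1) \<in> M" "(Suc b, c) \<in> M" using sq by blast+
      then show False using *(5) by (simp add: lower_left_on_boundary_def)
    qed
  next
    assume nB: "\<not> ?B"
    have "n \<le> k \<Longrightarrow> {i..i + n} \<times> {j - n..j} \<subseteq> M" for n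
    proof (induction n)
      case 0
      then show ?case using x ij by simp
    next
      case (Suc n)
      then have sq: "{i..i + n} \<times> {j - n..j} \<subseteq> M" and n: "Suc n \<le> k" by auto
      then have "(i, j - n) \<in> M" by auto
      \<comment> \<open>So \<open>j - Suc n\<close> is the column directly left of the square and
        not a truncated value.\<close>
      then have jn: "1 \<le> j - n" using M by (auto simp: grid_def)
      \<comment> \<open>The rectangle from \<open>x\<close> to a cell \<open>(u, v)\<close> of the
        square has at most \<open>n + 1 \<le> k\<close> rows and columns, so it may not touch the
        boundary: the other three cells around its lower left corner point belong to
        \<open>M\<close>.\<close>
      have inner: "\<not> lower_left_on_boundary M u v" if "i \<le> u" "u \<le> i + n" "j - n \<le> v" "v \<le> j"
        for u v
      proof
        assume "lower_left_on_boundary M u v"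
        moreover have "{i..u} \<times> {v..j} \<subseteq> M" using sq that by (auto simp: subset_iff)
        moreover have "card {i..u} \<le> k" "card {v..j} \<le> k" using that n by auto
        moreover have "x \<in> {i..u} \<times> {v..j}" using that ij by auto
        ultimately show False using nB by blast
      qed
      show ?case
      proof
        fix y assume "y \<in> {i..i + Suc n} \<times> {j - Suc n..j}"
        then obtain u v where y: "y = (u, v)" "i \<le> u" "u \<le> Suc (i + n)" "j - Suc n \<le> v" "v \<le> j"
          by auto
        consider "u \<le> i + n" "j - n \<le> v" | "u = Suc (i + n)" "j - n \<le> v" | "u \<le> i + n"
          "v = j - n - 1"
          | "u = Suc (i + n)" "v = j - n - 1" using y by linarith
        then show "y \<in> M"
        proof cases
          case 1
          then show ?thesis using sq y by auto
        next
          case 2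
          then show ?thesis using inner[of "i + n" v] y by (simp add: lower_left_on_boundary_def)
        next
          case 3
          then show ?thesis using inner[of u "j - n"] y by (simp add: lower_left_on_boundary_def)
        next
          case 4
          then show ?thesis using inner[of "i + n" "j - n"] y
            by (simp add: lower_left_on_boundary_def)
        qed
      qed
    qed
    then show "x \<in> erosion M k" by (simp add: erosion_def ij)
  qed
  moreover have "D_top M k x = (if ?B then 1 else 0)"
    unfolding D_top_def by (rule restrict_apply'[OF x])
  moreover have "\<not> P \<longleftrightarrow> (if P then 1 else (0::nat)) = 0" for P by simp
  ultimately show ?thesis by (simp only:)
qed

text \<open>Transposition takes the upper right corner point of a rectangle to the lower left
  one.\<close>

lemma D_bot_flip: "(i, j) \<in> M \<Longrightarrow> D_bot M k (i, j) = D_top (flip M) k (j, i)"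
proof -
  assume ij: "(i, j) \<in> M"
  have rect: "{c..d} \<times> {a..b} \<subseteq> flip M \<longleftrightarrow> {a..b} \<times> {c..d} \<subseteq> M" for a b c d :: nat
    using flip_mono[of "{a..b} \<times> {c..d}" M] by simp
  have boundary: "lower_left_on_boundary (flip M) d a \<longleftrightarrow> upper_right_on_boundary M a d" for a d
    by (auto simp: lower_left_on_boundary_def upper_right_on_boundary_def)
  have "D_bot M k (i, j) = (if \<exists>a b c d. (i, j) \<in> {a..b} \<times> {c..d} \<and> {a..b} \<times> {c..d} \<subseteq> M \<and>
       card {a..b} \<le> k \<and> card {c..d} \<le> k \<and> upper_right_on_boundary M a d then 1 else 0)" (is "_ = (if ?U then _ else _)")
    unfolding D_bot_def by (rule restrict_apply'[OF ij])
  moreover have "D_top (flip M) k (j, i) = (if \<exists>c d a b. (j, i) \<in> {c..d} \<times> {a..b} \<and>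
    {c..d} \<times> {a..b} \<subseteq> flip M \<and>
       card {c..d} \<le> k \<and> card {a..b} \<le> k \<and> lower_left_on_boundary (flip M) d a then 1 else 0)" (is "_ = (if ?L then _ else _)")
    unfolding D_top_def by (rule restrict_apply') (simp add: ij)
  moreover have "?U \<longleftrightarrow> ?L"
    unfolding rect boundary mem_Sigma_iff
    by (rule iffI; elim exE conjE; intro exI conjI; assumption)
  ultimately show ?thesis by (simp only:)
qed

lemma D_top_filling: "D_top M k \<in> fillings M"
  by (auto simp: fillings_def D_top_def)

lemma D_bot_filling: "D_bot M k \<in> fillings M"
  by (auto simp: fillings_def D_bot_def)

lemma (in moon_shape) D_top_pipe_dream: "filling_to_pipe_dream M (D_top M k) = erosion M k"
proof -
  have "erosion M k = {x \<in> M. x \<in> erosion M k}" using erosion_subset[of k] by blast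
  also have "\<dots> = {x \<in> M. D_top M k x = 0}" using erosion_iff_D_top[OF M_grid] by blast
  finally show ?thesis by (simp add: filling_to_pipe_dream_def)
qed

lemma (in moon_shape) D_bot_pipe_dream: "filling_to_pipe_dream M (D_bot M k) = flip (erosion (flip M) k)"
proof -
  interpret F: moon_shape "flip M" by (rule moon_flip)
  have "(i, j) \<in> filling_to_pipe_dream M (D_bot M k) \<longleftrightarrow> (j, i) \<in> erosion (flip M) k" for i j
  proof -
    have "(j, i) \<in> erosion (flip M) k \<longleftrightarrow> (i, j) \<in> M \<and> D_top (flip M) k (j, i) = 0"
      unfolding F.D_top_pipe_dream[of k, symmetric] by (simp add: filling_to_pipe_dream_def)
    then show ?thesis using D_bot_flip[of i j M k] by (auto simp: filling_to_pipe_dream_def)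
  qed
  then show ?thesis by auto
qed

lemma moon_polyomino_shape:
  assumes "moon_polyomino M"
  shows "moon_shape M"
proof
  show "finite M" "M \<subseteq> grid" using assms by (auto simp: moon_polyomino_def polyomino_def)
  have conv: "convex_polyomino M" and int: "intersection_free M" using assms
    by (auto simp: moon_polyomino_def)
  show "\<And>i j j' l. (i, j) \<in> M \<Longrightarrow> (i, j') \<in> M \<Longrightarrow> j \<le> l \<Longrightarrow> l \<le> j' \<Longrightarrow> (i, l) \<in> M"
    "\<And>i i' j l. (i, j) \<in> M \<Longrightarrow> (i', j) \<in> M \<Longrightarrow> i \<le> l \<Longrightarrow> l \<le> i' \<Longrightarrow> (l, j) \<in> M"
    using conv unfolding convex_polyomino_def by blast+
  show "\<And>i j i' j'. (i, j) \<in> M \<Longrightarrow> (i', j') \<in> M \<Longrightarrow> (i, j') \<in> M \<or> (i', j) \<in> M"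
    using int unfolding intersection_free_def by blast
qed

theorem theorem3p2:
  fixes M :: "(nat \<times> nat) set" and k :: nat
  assumes "moon_polyomino M"
  shows "\<exists>w. w permutes {1..} \<and>
    (\<forall>r :: nat \<Rightarrow> int.
       bij_betw (filling_to_pipe_dream M) (F01ne_rows M k r) {D \<in> RC_rows w r. D \<subseteq> M}) \<and>
    D_top M k \<in> F01ne M k \<and> D_bot M k \<in> F01ne M k \<and>
    filling_to_pipe_dream M ` F01ne M k =
      chute_interval w (filling_to_pipe_dream M (D_bot M k)) (filling_to_pipe_dream M (D_top M k))"
proof -
  interpret moon_shape M using assms by (rule moon_polyomino_shape)
  obtain w where w: "w permutes {1..}" and RC: "facets M k = {D \<in> RC w. D \<subseteq> M}"
    and interval: "facets M k = chute_interval w (flip (erosion (flip M) k)) (erosion M k)"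
    by (rule facets_permutation)
  have "bij_betw (filling_to_pipe_dream M) (F01ne_rows M k r) {D \<in> RC_rows w r. D \<subseteq> M}"
    for r :: "nat \<Rightarrow> int"
  proof -
    have "F01ne_rows M k r \<subseteq> fillings M" by (auto simp: F01ne_rows_def F01ne_def)
    then have "inj_on (filling_to_pipe_dream M) (F01ne_rows M k r)"
      using filling_to_pipe_dream_inj inj_on_subset by blast
    \<comment> \<open>Zeros in a row of the filling are the crosses in that row, so the row
      condition is carried over unchanged.\<close>
    moreover have "filling_to_pipe_dream M ` F01ne_rows M k r =
        {D \<in> facets M k. \<forall>i\<ge>1. int (card {j. (i, j) \<in> D}) = r i}"
      unfolding F01ne_image[symmetric] F01ne_rows_def by (auto simp: filling_to_pipe_dream_def)
    ultimately show ?thesis using RC by (auto simp: bij_betw_def RC_rows_def)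
  qed
  moreover have "D_top M k \<in> F01ne M k"
    using F01ne_iff[OF D_top_filling] erosion_facet by (simp add: D_top_pipe_dream)
  moreover have "D_bot M k \<in> F01ne M k"
    using F01ne_iff[OF D_bot_filling] flipped_erosion_facet by (simp add: D_bot_pipe_dream)
  ultimately show ?thesis
    using w interval by (intro exI[of _ w]) (simp add: D_top_pipe_dream D_bot_pipe_dream
      F01ne_image)
qed

end
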